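(* Let $k$ be a field, let $A=k[x_0,\ldots,x_n]$ be the homogeneous coordinate ring of $\mathbb P^n=\mathbb P^n_k$, and let $V\subset\mathbb P^n$ be a variety of codimension $r$ with homogeneous ideal $I\subset A$. If $V$ is a set-theoretic complete intersection, then $H^r_I(A)$ is a graded quasi-cyclic $A$-module.
   Context: A variety $V\subset\mathbb P^n$ of codimension $r$ with ideal $I$ is a set-theoretic complete intersection if it is set-theoretically the intersection of $r$ hypersurfaces, i.e. there are homogeneous $f_1,\ldots,f_r\in A$ with $\sqrt{I}=\sqrt{(f_1,\ldots,f_r)}$. Graded quasi-cyclic: a graded $A$-module is quasi-cyclic if it is a countable increasing union of cyclic submodules, each generated by a homogeneous element. *)

theory Defs
  imports
    "HOL-Library.Poly_Mapping"
    "HOL-Library.Extended_Nat"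
    "HOL-Algebra.Module"
    "HOL-Algebra.Ideal_Product"
begin

section \<open>Graded rings and graded modules\<close>

record 'a gring = "'a ring" +
  ring_part :: "int \<Rightarrow> 'a set"

record ('a, 'm) gmodule = "('a, 'm) module" +
  mod_part :: "int \<Rightarrow> 'm set"

definition homogeneous_elems :: "('a, 'x) gring_scheme \<Rightarrow> 'a set" where
  "homogeneous_elems A = (\<Union>d. ring_part A d)"

definition graded_module ::
    "('a, 'x) gring_scheme \<Rightarrow> ('a, 'm, 'y) gmodule_scheme \<Rightarrow> bool" where
  "graded_module A M \<longleftrightarrow>
     module A M \<and>
     (\<forall>d. subgroup (mod_part M d) (add_monoid M)) \<and>
     (\<forall>d e. \<forall>a\<in>ring_part A d. \<forall>x\<in>mod_part M e. a \<odot>\<^bsub>M\<^esub> x \<in> mod_part M (d + e)) \<and>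
     (\<forall>x\<in>carrier M. \<exists>!c :: int \<Rightarrow> 'm.
        (\<forall>d. c d \<in> mod_part M d) \<and> finite {d. c d \<noteq> \<zero>\<^bsub>M\<^esub>} \<and>
        x = (\<Oplus>\<^bsub>M\<^esub>d\<in>{d. c d \<noteq> \<zero>\<^bsub>M\<^esub>}. c d))"

text \<open>A graded ring as a graded module over itself.\<close>

definition self_gmodule :: "('a, 'x) gring_scheme \<Rightarrow> ('a, 'a) gmodule" where
  "self_gmodule A =
     \<lparr>carrier = carrier A, mult = mult A, one = one A, zero = zero A, add = add A,
      smult = mult A, mod_part = ring_part A\<rparr>"

text \<open>Homomorphisms of graded modules are homogeneous of degree 0.\<close>

definition graded_hom ::
    "('a, 'x) gring_scheme \<Rightarrow> ('a, 'm, 'y) gmodule_scheme \<Rightarrow> ('a, 'n, 'z) gmodule_scheme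
      \<Rightarrow> ('m \<Rightarrow> 'n) set" where
  "graded_hom A M N =
     {f \<in> carrier M \<rightarrow> carrier N.
        (\<forall>x\<in>carrier M. \<forall>y\<in>carrier M. f (x \<oplus>\<^bsub>M\<^esub> y) = f x \<oplus>\<^bsub>N\<^esub> f y) \<and>
        (\<forall>a\<in>carrier A. \<forall>x\<in>carrier M. f (a \<odot>\<^bsub>M\<^esub> x) = a \<odot>\<^bsub>N\<^esub> f x) \<and>
        (\<forall>d. f ` mod_part M d \<subseteq> mod_part N d)}"

definition gsub :: "('a, 'm) gmodule \<Rightarrow> 'm set \<Rightarrow> ('a, 'm) gmodule" where
  "gsub M N = M\<lparr>carrier := N, mod_part := (\<lambda>d. N \<inter> mod_part M d)\<rparr>"

text \<open>The quotient \<open>M / N\<close>, with cosets as elements.  The fields \<open>mult\<close> and \<open>one\<close>, which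
  module records inherit from ring records, play no role for modules.\<close>

definition gquot :: "('a, 'm) gmodule \<Rightarrow> 'm set \<Rightarrow> ('a, 'm set) gmodule" where
  "gquot M N =
     \<lparr>carrier = a_rcosets\<^bsub>M\<^esub> N, mult = undefined, one = undefined, zero = N, add = set_add M,
      smult = (\<lambda>a X. \<Union>x\<in>X. N +>\<^bsub>M\<^esub> (a \<odot>\<^bsub>M\<^esub> x)),
      mod_part = (\<lambda>d. (\<lambda>x. N +>\<^bsub>M\<^esub> x) ` mod_part M d)\<rparr>"

definition cyclic_submodule ::
    "('a, 'x) gring_scheme \<Rightarrow> ('a, 'm, 'y) gmodule_scheme \<Rightarrow> 'm \<Rightarrow> 'm set" where
  "cyclic_submodule A M x = {a \<odot>\<^bsub>M\<^esub> x | a. a \<in> carrier A}"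

definition graded_quasi_cyclic ::
    "('a, 'x) gring_scheme \<Rightarrow> ('a, 'm, 'y) gmodule_scheme \<Rightarrow> bool" where
  "graded_quasi_cyclic A M \<longleftrightarrow>
     graded_module A M \<and>
     (\<exists>z :: nat \<Rightarrow> 'm.
        (\<forall>t. z t \<in> (\<Union>d. mod_part M d)) \<and>
        (\<forall>t. cyclic_submodule A M (z t) \<subseteq> cyclic_submodule A M (z (Suc t))) \<and>
        carrier M = (\<Union>t. cyclic_submodule A M (z t)))"


section \<open>Local cohomology\<close>

text \<open>Local cohomology is the right derived functor of the \<open>I\<close>-torsion functor, formed in the
  category of graded modules, so that it carries its natural grading.

  The lifting property defining injective objects is required here for test modules whose carrier
  lies in the element type of \<open>A\<close>, since HOL cannot quantify over all types inside a definition.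
  This loses nothing: that type accommodates every shift of \<open>A\<close> and every homogeneous ideal of
  \<open>A\<close>, to which lifting against arbitrary test modules reduces by the graded Baer criterion.\<close>

definition graded_injective ::
    "('a, 'x) gring_scheme \<Rightarrow> ('a, 'm, 'y) gmodule_scheme \<Rightarrow> bool" where
  "graded_injective A J \<longleftrightarrow>
     graded_module A J \<and>
     (\<forall>(M :: ('a, 'a) gmodule) (N :: ('a, 'a) gmodule). \<forall>i f.
        graded_module A M \<and> graded_module A N \<and>
        i \<in> graded_hom A M N \<and> inj_on i (carrier M) \<and> f \<in> graded_hom A M J \<longrightarrow>
        (\<exists>g\<in>graded_hom A N J. \<forall>x\<in>carrier M. g (i x) = f x))"

text \<open>\<open>0 \<rightarrow> M \<rightarrow> J 0 \<rightarrow> J 1 \<rightarrow> \<dots>\<close> is exact, with augmentation \<open>\<eta>\<close> and differentials \<open>d j : J j \<rightarrow> J (j + 1)\<close>.\<close>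

definition graded_injective_resolution ::
    "('a, 'x) gring_scheme \<Rightarrow> ('a, 'n, 'y) gmodule_scheme \<Rightarrow> ('n \<Rightarrow> 'm) \<Rightarrow>
      (nat \<Rightarrow> ('a, 'm) gmodule) \<Rightarrow> (nat \<Rightarrow> 'm \<Rightarrow> 'm) \<Rightarrow> bool" where
  "graded_injective_resolution A M \<eta> J d \<longleftrightarrow>
     (\<forall>j. graded_injective A (J j)) \<and>
     \<eta> \<in> graded_hom A M (J 0) \<and> inj_on \<eta> (carrier M) \<and>
     (\<forall>j. d j \<in> graded_hom A (J j) (J (Suc j))) \<and>
     \<eta> ` carrier M = {x \<in> carrier (J 0). d 0 x = \<zero>\<^bsub>J 1\<^esub>} \<and>
     (\<forall>j. d j ` carrier (J j) =
          {x \<in> carrier (J (Suc j)). d (Suc j) x = \<zero>\<^bsub>J (Suc (Suc j))\<^esub>})"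

text \<open>\<open>\<Gamma>\<^sub>I(M)\<close>: the elements annihilated by some power of \<open>I\<close>.\<close>

definition torsion_part ::
    "('a, 'x) gring_scheme \<Rightarrow> 'a set \<Rightarrow> ('a, 'm) gmodule \<Rightarrow> ('a, 'm) gmodule" where
  "torsion_part A I M =
     gsub M {x \<in> carrier M. \<exists>t :: nat. \<forall>a \<in> I [^]\<^bsub>ideals_set A\<^esub> t. a \<odot>\<^bsub>M\<^esub> x = \<zero>\<^bsub>M\<^esub>}"

definition cocycles ::
    "(nat \<Rightarrow> ('a, 'm) gmodule) \<Rightarrow> (nat \<Rightarrow> 'm \<Rightarrow> 'm) \<Rightarrow> nat \<Rightarrow> 'm set" where
  "cocycles C d i = {x \<in> carrier (C i). d i x = \<zero>\<^bsub>C (Suc i)\<^esub>}"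

definition coboundaries ::
    "(nat \<Rightarrow> ('a, 'm) gmodule) \<Rightarrow> (nat \<Rightarrow> 'm \<Rightarrow> 'm) \<Rightarrow> nat \<Rightarrow> 'm set" where
  "coboundaries C d i =
     (case i of 0 \<Rightarrow> {\<zero>\<^bsub>C 0\<^esub>} | Suc j \<Rightarrow> d j ` carrier (C j))"

definition cohomology ::
    "(nat \<Rightarrow> ('a, 'm) gmodule) \<Rightarrow> (nat \<Rightarrow> 'm \<Rightarrow> 'm) \<Rightarrow> nat \<Rightarrow> ('a, 'm set) gmodule" where
  "cohomology C d i = gquot (gsub (C i) (cocycles C d i)) (coboundaries C d i)"

text \<open>\<open>H\<^sup>i\<^sub>I(M)\<close>, computed from a graded injective resolution \<open>J\<close>, \<open>d\<close> of \<open>M\<close>.\<close>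

definition local_cohomology ::
    "('a, 'x) gring_scheme \<Rightarrow> 'a set \<Rightarrow> (nat \<Rightarrow> ('a, 'm) gmodule) \<Rightarrow> (nat \<Rightarrow> 'm \<Rightarrow> 'm)
      \<Rightarrow> nat \<Rightarrow> ('a, 'm set) gmodule" where
  "local_cohomology A I J d i = cohomology (\<lambda>j. torsion_part A I (J j)) d i"


section \<open>Projective space and its subvarieties\<close>

text \<open>\<open>k[x\<^sub>0, \<dots>, x\<^sub>n]\<close>: a monomial is a finitely supported exponent function on \<open>{0..n}\<close>.\<close>

definition coordinate_ring :: "nat \<Rightarrow> ((nat \<Rightarrow>\<^sub>0 nat) \<Rightarrow>\<^sub>0 'k :: field) gring" where
  "coordinate_ring n =
     (let P = {p. \<forall>m\<in>Poly_Mapping.keys p. Poly_Mapping.keys m \<subseteq> {0..n}} in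
     \<lparr>carrier = P, mult = (*), one = 1, zero = 0, add = (+),
      ring_part = (\<lambda>e. {p \<in> P. \<forall>m\<in>Poly_Mapping.keys p.
         int (\<Sum>i\<in>Poly_Mapping.keys m. Poly_Mapping.lookup m i) = e})\<rparr>)"

definition homogeneous_ideal :: "('a, 'x) gring_scheme \<Rightarrow> 'a set \<Rightarrow> bool" where
  "homogeneous_ideal A I \<longleftrightarrow> (\<exists>S \<subseteq> homogeneous_elems A. I = Idl\<^bsub>A\<^esub> S)"

definition ideal_radical :: "('a, 'x) ring_scheme \<Rightarrow> 'a set \<Rightarrow> 'a set" where
  "ideal_radical A I = {a \<in> carrier A. \<exists>m :: nat. a [^]\<^bsub>A\<^esub> m \<in> I}"

definition irrelevant_ideal :: "('a, 'x) gring_scheme \<Rightarrow> 'a set" where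
  "irrelevant_ideal A = Idl\<^bsub>A\<^esub> (\<Union>d\<in>{0<..}. ring_part A d)"

text \<open>The field need not be algebraically closed, so points of projective space are the points
  of the scheme \<open>Proj A\<close>.\<close>

definition Proj :: "('a, 'x) gring_scheme \<Rightarrow> 'a set set" where
  "Proj A = {p. primeideal p A \<and> homogeneous_ideal A p \<and> \<not> irrelevant_ideal A \<subseteq> p}"

definition proj_closed :: "('a, 'x) gring_scheme \<Rightarrow> 'a set set \<Rightarrow> bool" where
  "proj_closed A Z \<longleftrightarrow> (\<exists>I. homogeneous_ideal A I \<and> Z = {p \<in> Proj A. I \<subseteq> p})"

definition irreducible_closed :: "('a, 'x) gring_scheme \<Rightarrow> 'a set set \<Rightarrow> bool" where
  "irreducible_closed A Z \<longleftrightarrow>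
     proj_closed A Z \<and> Z \<noteq> {} \<and>
     (\<forall>Z\<^sub>1 Z\<^sub>2. proj_closed A Z\<^sub>1 \<and> proj_closed A Z\<^sub>2 \<and> Z = Z\<^sub>1 \<union> Z\<^sub>2 \<longrightarrow> Z = Z\<^sub>1 \<or> Z = Z\<^sub>2)"

text \<open>A variety is a nonempty reduced closed subscheme, identified with its underlying closed
  subset; it may be reducible, so integral subschemes are a special case.\<close>

definition projective_variety :: "('a, 'x) gring_scheme \<Rightarrow> 'a set set \<Rightarrow> bool" where
  "projective_variety A V \<longleftrightarrow> proj_closed A V \<and> V \<noteq> {}"

definition vanishing_ideal :: "('a, 'x) gring_scheme \<Rightarrow> 'a set set \<Rightarrow> 'a set" where
  "vanishing_ideal A V = carrier A \<inter> \<Inter>V"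

definition codim_irreducible :: "('a, 'x) gring_scheme \<Rightarrow> 'a set set \<Rightarrow> enat" where
  "codim_irreducible A Z =
     Sup {enat m | m. \<exists>C :: nat \<Rightarrow> 'a set set. C 0 = Z \<and>
            (\<forall>i\<le>m. irreducible_closed A (C i)) \<and> (\<forall>i<m. C i \<subset> C (Suc i))}"

definition codimension :: "('a, 'x) gring_scheme \<Rightarrow> 'a set set \<Rightarrow> enat" where
  "codimension A V = (INF Z\<in>{Z. irreducible_closed A Z \<and> Z \<subseteq> V}. codim_irreducible A Z)"

definition set_theoretic_complete_intersection ::
    "('a, 'x) gring_scheme \<Rightarrow> 'a set set \<Rightarrow> bool" where
  "set_theoretic_complete_intersection A V \<longleftrightarrow>
     (\<exists>fs. enat (length fs) = codimension A V \<and> set fs \<subseteq> homogeneous_elems A \<and>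
        ideal_radical A (vanishing_ideal A V) = ideal_radical A (Idl\<^bsub>A\<^esub> (set fs)))"

end

theory Submission
  imports Defs "HOL-Algebra.Ring_Divisibility"
begin

text \<open>
  If \<open>\<surd>I = \<surd>(f\<^sub>1, \<dots>, f\<^sub>r)\<close>, then \<open>\<Gamma>\<^sub>I\<close> cuts out the elements killed by a power of each \<open>f\<^sub>i\<close>, so it is
  obtained from a resolution \<open>J\<close> of \<open>A\<close> by imposing the torsion conditions one at a time.  Over a
  Noetherian graded ring an injective module is divisible by a homogeneous \<open>f\<close> modulo \<open>f\<close>-torsion, and
  the quotient can be chosen with no smaller annihilator, so that this persists on all the
  intermediate torsion subcomplexes \<open>C\<close>.  Hence \<open>0 \<rightarrow> \<Gamma>\<^sub>f C \<rightarrow> C \<rightarrow> C\<^sub>f \<rightarrow> 0\<close> is exact, and if \<open>C\<close> has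
  no cohomology above degree \<open>j\<close>, then \<open>H\<^sup>j\<^sup>+\<^sup>1(\<Gamma>\<^sub>f C)\<close> is the only possible cohomology of \<open>\<Gamma>\<^sub>f C\<close>
  above degree \<open>j\<close> and is a quotient of \<open>H\<^sup>j(C)\<^sub>f\<close>.  If generators \<open>z\<^sub>t\<close> exhibit \<open>H\<^sup>j(C)\<close> as quasi-cyclic,
  the fractions \<open>z\<^sub>t / f\<^sup>t\<close> do so for \<open>H\<^sup>j(C)\<^sub>f\<close>.  The induction starts from \<open>H\<^sup>0(J) = A\<close>.
\<close>

section \<open>Homogeneous components\<close>

text \<open>The localisations and the connecting homomorphism are never formed. A fraction
  \<open>z / f^t\<close> is represented by an element \<open>y\<close> of the complex such that
  \<open>z - f^t y\<close> is killed by a power of \<open>f\<close>. Equality in the localisation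
  becomes membership in \<open>torsion_by A (J j) {f}\<close>, and the connecting map becomes
  \<open>y \<mapsto> d y\<close>. The obstacle is that \<open>y\<close> must lie in the intermediate
  torsion subcomplex, not merely in the injective module containing it. The inclusion of
  \<open>ann x\<close> in \<open>ann y\<close> settles this without showing that torsion submodules
  of injectives are injective: a power of an earlier equation that kills \<open>x\<close> also kills
  \<open>y\<close>. Thus only the injectivity of the original \<open>J j\<close> is ever invoked.
  The exponents in \<open>z\<^sub>t / f\<^sup>t\<close> have to grow, because a fraction may have
  any power of \<open>f\<close> as its denominator, while the given chain accounts for numerators
  only. Noetherianity also supplies finite generators of \<open>I\<close>, so that torsion for
  \<open>I\<close> can be tested elementwise and depends only on the radical.\<close>

lemma additive_zero:
  assumes "abelian_group M" "abelian_group N" "f \<in> carrier M \<rightarrow> carrier N"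
    "\<And>x y. x \<in> carrier M \<Longrightarrow> y \<in> carrier M \<Longrightarrow> f (x \<oplus>\<^bsub>M\<^esub> y) = f x \<oplus>\<^bsub>N\<^esub> f y"
  shows "f \<zero>\<^bsub>M\<^esub> = \<zero>\<^bsub>N\<^esub>"
proof -
  interpret M: abelian_group M by fact
  interpret N: abelian_group N by fact
  have "f \<zero>\<^bsub>M\<^esub> \<oplus>\<^bsub>N\<^esub> f \<zero>\<^bsub>M\<^esub> = f \<zero>\<^bsub>M\<^esub>"
    using assms(4)[of "\<zero>\<^bsub>M\<^esub>" "\<zero>\<^bsub>M\<^esub>"] by simp
  moreover have "f \<zero>\<^bsub>M\<^esub> \<in> carrier N" using assms(3) by auto
  ultimately show ?thesis by (metis N.add.r_cancel_one')
qed

lemma additive_minus: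
  assumes "abelian_group M" "abelian_group N" "f \<in> carrier M \<rightarrow> carrier N"
    "\<And>x y. x \<in> carrier M \<Longrightarrow> y \<in> carrier M \<Longrightarrow> f (x \<oplus>\<^bsub>M\<^esub> y) = f x \<oplus>\<^bsub>N\<^esub> f y"
    and x: "x \<in> carrier M"
  shows "f (\<ominus>\<^bsub>M\<^esub> x) = \<ominus>\<^bsub>N\<^esub> f x"
proof -
  interpret M: abelian_group M by fact
  interpret N: abelian_group N by fact
  have "f (\<ominus>\<^bsub>M\<^esub> x) \<oplus>\<^bsub>N\<^esub> f x = \<zero>\<^bsub>N\<^esub>"
    using assms(4)[of "\<ominus>\<^bsub>M\<^esub> x" x] x additive_zero[OF assms(1-4)] by (simp add: M.l_neg)
  moreover have "f x \<in> carrier N" "f (\<ominus>\<^bsub>M\<^esub> x) \<in> carrier N" using assms(3) x by auto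
  ultimately show ?thesis by (simp add: N.minus_equality)
qed

lemma additive_finsum:
  assumes M: "abelian_group M" and N: "abelian_group N" and f: "f \<in> carrier M \<rightarrow> carrier N"
    and add: "\<And>x y. x \<in> carrier M \<Longrightarrow> y \<in> carrier M \<Longrightarrow> f (x \<oplus>\<^bsub>M\<^esub> y) = f x \<oplus>\<^bsub>N\<^esub> f y"
    and "finite S" "g \<in> S \<rightarrow> carrier M"
  shows "f (\<Oplus>\<^bsub>M\<^esub>i\<in>S. g i) = (\<Oplus>\<^bsub>N\<^esub>i\<in>S. f (g i))"
proof -
  interpret M: abelian_group M by fact
  interpret N: abelian_group N by fact
  show ?thesis using assms(5,6)
  proof (induction S)
    case empty
    show ?case using additive_zero[OF M N f add] by simp
  next
    case (insert i S)
    have "(\<lambda>i. f (g i)) \<in> S \<rightarrow> carrier N" "f (g i) \<in> carrier N" using insert.prems f by auto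
    with insert show ?case by (simp add: add Pi_def M.finsum_closed)
  qed
qed

text \<open>The unique decomposition required by \<open>graded_module\<close>, as a function of the
  element. Off the carrier the description is arbitrary, so facts about components assume
  membership.\<close>

definition homog_comp :: "('a, 'm, 'y) gmodule_scheme \<Rightarrow> 'm \<Rightarrow> int \<Rightarrow> 'm" where
  "homog_comp M x = (THE c. (\<forall>d. c d \<in> mod_part M d) \<and> finite {d. c d \<noteq> \<zero>\<^bsub>M\<^esub>} \<and>
        x = (\<Oplus>\<^bsub>M\<^esub>d\<in>{d. c d \<noteq> \<zero>\<^bsub>M\<^esub>}. c d))"

locale gmod = module A M for A :: "('a, 'x) gring_scheme" (structure)
    and M :: "('a, 'm, 'y) gmodule_scheme" (structure) +
  assumes graded: "graded_module A M"

lemma gmod_iff: "gmod A M \<longleftrightarrow> graded_module A M"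
  unfolding gmod_def gmod_axioms_def graded_module_def by auto

context gmod
begin

lemma part_subgroup: "subgroup (mod_part M d) (add_monoid M)"
  using graded unfolding graded_module_def by blast

lemma part_closed: "x \<in> mod_part M d \<Longrightarrow> x \<in> carrier M"
  using subgroup.subset[OF part_subgroup] by auto

lemma part_zero [simp]: "\<zero>\<^bsub>M\<^esub> \<in> mod_part M d"
  using subgroup.one_closed[OF part_subgroup] by simp

lemma part_add: "x \<in> mod_part M d \<Longrightarrow> y \<in> mod_part M d \<Longrightarrow> x \<oplus>\<^bsub>M\<^esub> y \<in> mod_part M d"
  using subgroup.m_closed[OF part_subgroup] by simp

lemma part_smult:
  "a \<in> ring_part A d \<Longrightarrow> x \<in> mod_part M e \<Longrightarrow> a \<odot>\<^bsub>M\<^esub> x \<in> mod_part M (d + e)"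
  using graded unfolding graded_module_def by blast

lemma homog_comp_spec:
  assumes "x \<in> carrier M"
  shows "(\<forall>d. homog_comp M x d \<in> mod_part M d) \<and> finite {d. homog_comp M x d \<noteq> \<zero>\<^bsub>M\<^esub>} \<and>
        x = (\<Oplus>\<^bsub>M\<^esub>d\<in>{d. homog_comp M x d \<noteq> \<zero>\<^bsub>M\<^esub>}. homog_comp M x d)"
proof -
  have "\<exists>!c. (\<forall>d. c d \<in> mod_part M d) \<and> finite {d. c d \<noteq> \<zero>\<^bsub>M\<^esub>} \<and>
        x = (\<Oplus>\<^bsub>M\<^esub>d\<in>{d. c d \<noteq> \<zero>\<^bsub>M\<^esub>}. c d)"
    using graded assms unfolding graded_module_def by blast
  from theI'[OF this] show ?thesis unfolding homog_comp_def .
qed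

lemma homog_comp_part: "x \<in> carrier M \<Longrightarrow> homog_comp M x d \<in> mod_part M d"
  using homog_comp_spec by blast

lemma homog_comp_closed [simp]: "x \<in> carrier M \<Longrightarrow> homog_comp M x d \<in> carrier M"
  using homog_comp_part part_closed by blast

lemma finsum_support:
  assumes "\<And>d. c d \<in> carrier M" "finite S" "\<And>d. d \<notin> S \<Longrightarrow> c d = \<zero>\<^bsub>M\<^esub>"
  shows "(\<Oplus>\<^bsub>M\<^esub>d\<in>{d. c d \<noteq> \<zero>\<^bsub>M\<^esub>}. c d) = (\<Oplus>\<^bsub>M\<^esub>d\<in>S. c d)"
  using assms by (intro M.add.finprod_mono_neutral_cong_left) auto

text \<open>The finite set \<open>S\<close> may exceed the support of \<open>c\<close>, because
  components of a sum or of an image are naturally indexed by a set on which some of them cancel or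
  vanish.\<close>

lemma homog_comp_eqI:
  assumes c: "\<And>d. c d \<in> mod_part M d" and S: "finite S" "\<And>d. d \<notin> S \<Longrightarrow> c d = \<zero>\<^bsub>M\<^esub>"
    and x: "x = (\<Oplus>\<^bsub>M\<^esub>d\<in>S. c d)"
  shows "homog_comp M x = c"
proof -
  have cc: "c d \<in> carrier M" for d using c part_closed by blast
  hence xc: "x \<in> carrier M" unfolding x by (intro M.finsum_closed) auto
  hence "\<exists>!c. (\<forall>d. c d \<in> mod_part M d) \<and> finite {d. c d \<noteq> \<zero>\<^bsub>M\<^esub>} \<and>
        x = (\<Oplus>\<^bsub>M\<^esub>d\<in>{d. c d \<noteq> \<zero>\<^bsub>M\<^esub>}. c d)"
    using graded unfolding graded_module_def by blast
  moreover have "finite {d. c d \<noteq> \<zero>\<^bsub>M\<^esub>}" by (rule finite_subset[OF _ S(1)]) (use S in auto)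
  moreover have "x = (\<Oplus>\<^bsub>M\<^esub>d\<in>{d. c d \<noteq> \<zero>\<^bsub>M\<^esub>}. c d)"
    unfolding x using finsum_support[OF cc S] by simp
  ultimately show ?thesis using homog_comp_spec[OF xc] c by blast
qed

lemma homog_comp_homog:
  assumes "x \<in> mod_part M e"
  shows "homog_comp M x d = (if d = e then x else \<zero>\<^bsub>M\<^esub>)"
proof -
  have "homog_comp M x = (\<lambda>d. if d = e then x else \<zero>\<^bsub>M\<^esub>)"
    by (rule homog_comp_eqI[where S = "{e}"]) (use assms part_closed in auto)
  thus ?thesis by simp
qed

lemma homog_comp_sum:
  assumes "x \<in> carrier M" "finite S" "\<And>d. d \<notin> S \<Longrightarrow> homog_comp M x d = \<zero>\<^bsub>M\<^esub>"
  shows "(\<Oplus>\<^bsub>M\<^esub>d\<in>S. homog_comp M x d) = x"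
  using finsum_support[OF homog_comp_closed[OF assms(1)] assms(2,3)] homog_comp_spec[OF assms(1)] by simp

lemma homog_comp_add:
  assumes "x \<in> carrier M" "y \<in> carrier M"
  shows "homog_comp M (x \<oplus>\<^bsub>M\<^esub> y) d = homog_comp M x d \<oplus>\<^bsub>M\<^esub> homog_comp M y d"
proof -
  let ?S = "{d. homog_comp M x d \<noteq> \<zero>\<^bsub>M\<^esub>} \<union> {d. homog_comp M y d \<noteq> \<zero>\<^bsub>M\<^esub>}"
  have fin: "finite ?S" using homog_comp_spec assms by auto
  have "homog_comp M (x \<oplus>\<^bsub>M\<^esub> y) = (\<lambda>d. homog_comp M x d \<oplus>\<^bsub>M\<^esub> homog_comp M y d)"
  proof (rule homog_comp_eqI[OF _ fin])
    show "x \<oplus>\<^bsub>M\<^esub> y = (\<Oplus>\<^bsub>M\<^esub>d\<in>?S. homog_comp M x d \<oplus>\<^bsub>M\<^esub> homog_comp M y d)"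
      using homog_comp_sum[OF assms(1) fin] homog_comp_sum[OF assms(2) fin] assms
      by (subst M.finsum_addf) auto
  qed (use assms homog_comp_part part_add in auto)
  thus ?thesis by simp
qed

lemma homog_induct:
  assumes x: "x \<in> carrier M" and "\<And>d. P (homog_comp M x d)" and "P \<zero>\<^bsub>M\<^esub>"
    and "\<And>y z. y \<in> carrier M \<Longrightarrow> z \<in> carrier M \<Longrightarrow> P y \<Longrightarrow> P z \<Longrightarrow> P (y \<oplus>\<^bsub>M\<^esub> z)"
  shows "P x"
proof -
  have "P (\<Oplus>\<^bsub>M\<^esub>d\<in>S. homog_comp M x d)" if "finite S" for S
    using that
  proof induction
    case (insert i S)
    have "(\<lambda>d. homog_comp M x d) \<in> S \<rightarrow> carrier M" using x by auto
    with insert assms show ?case by simp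
  qed (simp add: assms)
  thus ?thesis using homog_comp_spec[OF x] by metis
qed

end

text \<open>Only additivity and a fixed degree \<open>s\<close> are asked of \<open>f\<close>, so
  that it covers multiplication by a homogeneous element, evaluation \<open>b \<mapsto> b x\<close>
  from the ring to a module, and the differentials (\<open>s = 0\<close>).\<close>

lemma homog_comp_map:
  assumes M: "graded_module A M" and N: "graded_module A N" and f: "f \<in> carrier M \<rightarrow> carrier N"
    and add: "\<And>x y. x \<in> carrier M \<Longrightarrow> y \<in> carrier M \<Longrightarrow> f (x \<oplus>\<^bsub>M\<^esub> y) = f x \<oplus>\<^bsub>N\<^esub> f y"
    and deg: "\<And>d y. y \<in> mod_part M d \<Longrightarrow> f y \<in> mod_part N (d + s)"
    and x: "x \<in> carrier M"
  shows "homog_comp N (f x) (d + s) = f (homog_comp M x d)"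
proof -
  interpret M: gmod A M using M by (simp add: gmod_iff)
  interpret N: gmod A N using N by (simp add: gmod_iff)
  have MN: "abelian_group M" "abelian_group N" by unfold_locales
  let ?S = "{d. homog_comp M x d \<noteq> \<zero>\<^bsub>M\<^esub>}"
  have fin: "finite ?S" using M.homog_comp_spec[OF x] by blast
  have "homog_comp N (f x) = (\<lambda>d. f (homog_comp M x (d - s)))"
  proof (rule N.homog_comp_eqI)
    show "f (homog_comp M x (d - s)) \<in> mod_part N d" for d
      using deg[OF M.homog_comp_part[OF x], of "d - s"] by simp
    show "finite ((\<lambda>d. d + s) ` ?S)" using fin by simp
    show "f (homog_comp M x (d - s)) = \<zero>\<^bsub>N\<^esub>" if "d \<notin> (\<lambda>d. d + s) ` ?S" for d
    proof -
      have "d - s \<notin> ?S" using that by (metis diff_add_cancel image_eqI)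
      thus ?thesis using additive_zero[OF MN f add] by auto
    qed
    have "f x = f (\<Oplus>\<^bsub>M\<^esub>d\<in>?S. homog_comp M x d)" using M.homog_comp_spec[OF x] by metis
    also have "\<dots> = (\<Oplus>\<^bsub>N\<^esub>d\<in>?S. f (homog_comp M x d))"
      by (rule additive_finsum[OF MN f add fin]) (use x in auto)
    also have "\<dots> = (\<Oplus>\<^bsub>N\<^esub>d\<in>(\<lambda>d. d + s) ` ?S. f (homog_comp M x (d - s)))"
      by (subst N.M.finsum_reindex) (use f x in \<open>auto simp: inj_on_def\<close>)
    finally show "f x = (\<Oplus>\<^bsub>N\<^esub>d\<in>(\<lambda>d. d + s) ` ?S. f (homog_comp M x (d - s)))" .
  qed
  thus ?thesis by simp
qed

text \<open>Existence of a decomposition is \<open>sum\<close>. For uniqueness, apply the additive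
  projection \<open>\<pi> _ e\<close> to any decomposition \<open>c\<close>: by \<open>homog\<close>
  every summand except \<open>c e\<close> disappears.\<close>

lemma graded_moduleI:
  assumes M: "module A M" and sub: "\<And>d. subgroup (mod_part M d) (add_monoid M)"
    and smult: "\<And>d e a x. a \<in> ring_part A d \<Longrightarrow> x \<in> mod_part M e \<Longrightarrow> a \<odot>\<^bsub>M\<^esub> x \<in> mod_part M (d + e)"
    and comp: "\<And>x d. x \<in> carrier M \<Longrightarrow> \<pi> x d \<in> mod_part M d"
    and add: "\<And>x y d. x \<in> carrier M \<Longrightarrow> y \<in> carrier M \<Longrightarrow> \<pi> (x \<oplus>\<^bsub>M\<^esub> y) d = \<pi> x d \<oplus>\<^bsub>M\<^esub> \<pi> y d"
    and homog: "\<And>x d e. x \<in> mod_part M e \<Longrightarrow> \<pi> x d = (if d = e then x else \<zero>\<^bsub>M\<^esub>)"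
    and fin: "\<And>x. x \<in> carrier M \<Longrightarrow> finite {d. \<pi> x d \<noteq> \<zero>\<^bsub>M\<^esub>}"
    and sum: "\<And>x. x \<in> carrier M \<Longrightarrow> x = (\<Oplus>\<^bsub>M\<^esub>d\<in>{d. \<pi> x d \<noteq> \<zero>\<^bsub>M\<^esub>}. \<pi> x d)"
  shows "graded_module A M"
  unfolding graded_module_def
proof (intro conjI allI ballI)
  interpret M: module A M by fact
  have pc: "x \<in> carrier M" if "x \<in> mod_part M d" for x d
    using subgroup.subset[OF sub] that by auto
  fix x assume x: "x \<in> carrier M"
  show "\<exists>!c. (\<forall>d. c d \<in> mod_part M d) \<and> finite {d. c d \<noteq> \<zero>\<^bsub>M\<^esub>} \<and>
        x = (\<Oplus>\<^bsub>M\<^esub>d\<in>{d. c d \<noteq> \<zero>\<^bsub>M\<^esub>}. c d)"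
  proof (rule ex1I[of _ "\<pi> x"])
    show "(\<forall>d. \<pi> x d \<in> mod_part M d) \<and> finite {d. \<pi> x d \<noteq> \<zero>\<^bsub>M\<^esub>} \<and>
        x = (\<Oplus>\<^bsub>M\<^esub>d\<in>{d. \<pi> x d \<noteq> \<zero>\<^bsub>M\<^esub>}. \<pi> x d)" using comp fin sum x by auto
  next
    fix c assume c: "(\<forall>d. c d \<in> mod_part M d) \<and> finite {d. c d \<noteq> \<zero>\<^bsub>M\<^esub>} \<and>
        x = (\<Oplus>\<^bsub>M\<^esub>d\<in>{d. c d \<noteq> \<zero>\<^bsub>M\<^esub>}. c d)"
    let ?S = "{d. c d \<noteq> \<zero>\<^bsub>M\<^esub>}"
    have cc: "c d \<in> carrier M" for d using c pc by blast
    show "c = \<pi> x"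
    proof
      fix e
      have "\<pi> x e = \<pi> (\<Oplus>\<^bsub>M\<^esub>d\<in>?S. c d) e" using c by metis
      also have "\<dots> = (\<Oplus>\<^bsub>M\<^esub>d\<in>?S. \<pi> (c d) e)"
        by (rule additive_finsum[where f = "\<lambda>x. \<pi> x e"])
          (use c cc pc[OF comp] add M.abelian_group_axioms in auto)
      also have "\<dots> = (\<Oplus>\<^bsub>M\<^esub>d\<in>?S. if e = d then c d else \<zero>\<^bsub>M\<^esub>)"
        using c homog pc by (intro M.M.finsum_cong') (auto simp: cc)
      also have "\<dots> = c e"
      proof (cases "e \<in> ?S")
        case True
        thus ?thesis using c cc by (subst M.M.finsum_singleton) auto
      next
        case False
        hence "(\<Oplus>\<^bsub>M\<^esub>d\<in>?S. if e = d then c d else \<zero>\<^bsub>M\<^esub>) = (\<Oplus>\<^bsub>M\<^esub>d\<in>?S. \<zero>\<^bsub>M\<^esub>)"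
          by (intro M.M.finsum_cong') auto
        thus ?thesis using False by simp
      qed
      finally show "c e = \<pi> x e" by simp
    qed
  qed
qed (use M sub smult in auto)

section \<open>Graded submodules and quotients\<close>

text \<open>A graded ring is taken to be a ring graded as a module over itself. The condition
  \<open>one_part\<close> gives the degree of zeroth powers and of the generator of the
  ring.\<close>

locale gring = cring A for A :: "('a, 'x) gring_scheme" (structure) +
  assumes graded_self: "graded_module A (self_gmodule A)"
    and one_part: "\<one> \<in> ring_part A 0"

lemma (in gring) ring_part_closed: "a \<in> ring_part A d \<Longrightarrow> a \<in> carrier A"
proof -
  interpret S: gmod A "self_gmodule A" using graded_self by (simp add: gmod_iff)
  show "a \<in> ring_part A d \<Longrightarrow> a \<in> carrier A" using S.part_closed by (simp add: self_gmodule_def)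
qed

lemma (in abelian_group) add_subgroupI:
  assumes "H \<subseteq> carrier G" "\<zero> \<in> H" "\<And>x y. x \<in> H \<Longrightarrow> y \<in> H \<Longrightarrow> x \<oplus> y \<in> H"
    and "\<And>x. x \<in> H \<Longrightarrow> \<ominus> x \<in> H"
  shows "subgroup H (add_monoid G)"
  by (rule subgroup.intro) (use assms in \<open>auto simp: a_inv_def\<close>)

text \<open>The last clause is homogeneity. Negatives are covered by scaling with
  \<open>\<ominus> \<one>\<close>.\<close>

definition graded_submodule ::
    "('a, 'x) gring_scheme \<Rightarrow> ('a, 'm, 'y) gmodule_scheme \<Rightarrow> 'm set \<Rightarrow> bool" where
  "graded_submodule A M N \<longleftrightarrow> N \<subseteq> carrier M \<and> \<zero>\<^bsub>M\<^esub> \<in> N \<and>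
     (\<forall>x\<in>N. \<forall>y\<in>N. x \<oplus>\<^bsub>M\<^esub> y \<in> N) \<and> (\<forall>a\<in>carrier A. \<forall>x\<in>N. a \<odot>\<^bsub>M\<^esub> x \<in> N) \<and>
     (\<forall>x\<in>N. \<forall>d. homog_comp M x d \<in> N)"

context gmod
begin

lemma part_uminus: "x \<in> mod_part M d \<Longrightarrow> \<ominus>\<^bsub>M\<^esub> x \<in> mod_part M d"
  using subgroup.m_inv_closed[OF part_subgroup] by (simp add: a_inv_def)

lemma graded_submodule_uminus:
  assumes "graded_submodule A M N" "x \<in> N"
  shows "\<ominus>\<^bsub>M\<^esub> x \<in> N"
proof -
  have "x \<in> carrier M" using assms unfolding graded_submodule_def by blast
  hence "\<ominus>\<^bsub>M\<^esub> x = (\<ominus> \<one>) \<odot>\<^bsub>M\<^esub> x" by (simp add: smult_l_minus)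
  thus ?thesis using assms unfolding graded_submodule_def by simp
qed

lemma graded_submodule_subgroup:
  assumes "graded_submodule A M N"
  shows "subgroup N (add_monoid M)"
  using assms graded_submodule_uminus[OF assms] unfolding graded_submodule_def
  by (intro M.add_subgroupI) auto

end

text \<open>The inclusion is additive, so finite sums agree in both modules and the ambient
  components serve for the submodule. The second claim is for nested submodules: cocycles sit inside
  torsion inside \<open>J j\<close>, and all components can then be computed in
  \<open>J j\<close>.\<close>

lemma (in gring) graded_module_gsub:
  fixes M :: "('a, 'm) gmodule"
  assumes M: "graded_module A M" and N: "graded_submodule A M N"
  shows "graded_module A (gsub M N)"
    and "\<And>x. x \<in> N \<Longrightarrow> homog_comp (gsub M N) x = homog_comp M x"
proof -
  interpret gmod A M using M by (simp add: gmod_iff)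
  let ?G = "gsub M N"
  note [simp] = gsub_def
  have sub: "N \<subseteq> carrier M" and z: "\<zero>\<^bsub>M\<^esub> \<in> N" and
    a: "\<And>x y. x \<in> N \<Longrightarrow> y \<in> N \<Longrightarrow> x \<oplus>\<^bsub>M\<^esub> y \<in> N" and
    s: "\<And>a x. a \<in> carrier A \<Longrightarrow> x \<in> N \<Longrightarrow> a \<odot>\<^bsub>M\<^esub> x \<in> N" and
    h: "\<And>x d. x \<in> N \<Longrightarrow> homog_comp M x d \<in> N"
    using N unfolding graded_submodule_def by auto
  have c: "x \<in> carrier M" if "x \<in> N" for x using that sub by blast
  have G: "abelian_group ?G"
  proof (rule abelian_groupI)
    show "\<exists>y\<in>carrier ?G. y \<oplus>\<^bsub>?G\<^esub> x = \<zero>\<^bsub>?G\<^esub>" if "x \<in> carrier ?G" for x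
      using that graded_submodule_uminus[OF N, of x] c[of x] M.l_neg[of x]
      by (intro bexI[of _ "\<ominus>\<^bsub>M\<^esub> x"]) auto
  qed (auto simp: a z c M.a_ac)
  have mod: "module A ?G"
    by (rule moduleI[OF is_cring G]) (auto simp: s c smult_l_distr smult_r_distr smult_assoc1)
  interpret G: module A ?G by fact
  have fs: "finsum ?G f S = finsum M f S" if "finite S" "\<And>i. i \<in> S \<Longrightarrow> f i \<in> N" for f :: "int \<Rightarrow> 'm" and S
    using additive_finsum[OF G M.abelian_group_axioms, of "\<lambda>x. x" S f] that c by (auto simp: Pi_def)
  show gr: "graded_module A ?G"
  proof (rule graded_moduleI[OF mod, where \<pi> = "homog_comp M"])
    show "subgroup (mod_part ?G d) (add_monoid ?G)" for d
    proof (rule G.M.add_subgroupI)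
      show "\<ominus>\<^bsub>?G\<^esub> x \<in> mod_part ?G d" if "x \<in> mod_part ?G d" for x
      proof -
        have x: "x \<in> N" "x \<in> mod_part M d" using that by auto
        have "\<ominus>\<^bsub>?G\<^esub> x = \<ominus>\<^bsub>M\<^esub> x"
          using graded_submodule_uminus[OF N x(1)] x c M.l_neg
          by (intro G.M.minus_equality) auto
        thus ?thesis using graded_submodule_uminus[OF N x(1)] part_uminus[OF x(2)] by simp
      qed
    qed (auto simp: a z part_add)
    show "a \<odot>\<^bsub>?G\<^esub> x \<in> mod_part ?G (d + e)" if "a \<in> ring_part A d" "x \<in> mod_part ?G e" for d e a x
      using that s part_smult ring_part_closed by auto
    show "x = (\<Oplus>\<^bsub>?G\<^esub>d\<in>{d. homog_comp M x d \<noteq> \<zero>\<^bsub>?G\<^esub>}. homog_comp M x d)" if "x \<in> carrier ?G" for x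
    proof -
      have x: "x \<in> N" using that by simp
      have "(\<Oplus>\<^bsub>?G\<^esub>d\<in>{d. homog_comp M x d \<noteq> \<zero>\<^bsub>M\<^esub>}. homog_comp M x d) = x"
        using homog_comp_spec[OF c[OF x]] h[OF x] by (subst fs) auto
      thus ?thesis by simp
    qed
  qed (use h homog_comp_part c homog_comp_add homog_comp_spec homog_comp_homog in auto)
  interpret G: gmod A ?G using gr by (simp add: gmod_iff)
  fix x assume x: "x \<in> N"
  show "homog_comp ?G x = homog_comp M x"
  proof (rule G.homog_comp_eqI)
    show fin: "finite {d. homog_comp M x d \<noteq> \<zero>\<^bsub>M\<^esub>}" using homog_comp_spec c[OF x] by blast
    show "x = (\<Oplus>\<^bsub>?G\<^esub>d\<in>{d. homog_comp M x d \<noteq> \<zero>\<^bsub>M\<^esub>}. homog_comp M x d)"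
      using homog_comp_spec[OF c[OF x]] h[OF x] by (subst fs) auto
  qed (use homog_comp_part[OF c[OF x]] h[OF x] in auto)
qed

text \<open>The module axioms are equations between images of elements of \<open>M\<close>, hence
  pass along a surjection that respects the operations. The map is a coset projection in one
  application and the identity onto a regraded copy in another.\<close>

lemma module_image:
  assumes M: "module A M" and q: "carrier Q = q ` carrier M" and z: "q \<zero>\<^bsub>M\<^esub> = \<zero>\<^bsub>Q\<^esub>"
    and add: "\<And>x y. x \<in> carrier M \<Longrightarrow> y \<in> carrier M \<Longrightarrow> q (x \<oplus>\<^bsub>M\<^esub> y) = q x \<oplus>\<^bsub>Q\<^esub> q y"
    and smult: "\<And>a x. a \<in> carrier A \<Longrightarrow> x \<in> carrier M \<Longrightarrow> q (a \<odot>\<^bsub>M\<^esub> x) = a \<odot>\<^bsub>Q\<^esub> q x"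
  shows "module A Q"
proof -
  interpret M: module A M by fact
  note [simp] = add[symmetric] z[symmetric] smult[symmetric]
  have Q: "abelian_group Q"
  proof (rule abelian_groupI)
    show "\<exists>y\<in>carrier Q. y \<oplus>\<^bsub>Q\<^esub> x = \<zero>\<^bsub>Q\<^esub>" if x: "x \<in> carrier Q" for x
    proof -
      obtain y where y: "y \<in> carrier M" "x = q y" using x q by auto
      show ?thesis using y q M.M.l_neg[of y] by (intro bexI[of _ "q (\<ominus>\<^bsub>M\<^esub> y)"]) auto
    qed
  qed (auto simp: q M.a_ac)
  show ?thesis
    by (rule moduleI[OF M.R.is_cring Q])
      (auto simp: q M.smult_l_distr M.smult_r_distr M.smult_assoc1)
qed

text \<open>Homogeneity of the kernel (\<open>ker\<close>) is what makes the image of a component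
  depend only on the image of the element.\<close>

lemma (in gring) graded_module_image:
  assumes M: "graded_module A M" and q: "carrier Q = q ` carrier M" and z: "q \<zero>\<^bsub>M\<^esub> = \<zero>\<^bsub>Q\<^esub>"
    and add: "\<And>x y. x \<in> carrier M \<Longrightarrow> y \<in> carrier M \<Longrightarrow> q (x \<oplus>\<^bsub>M\<^esub> y) = q x \<oplus>\<^bsub>Q\<^esub> q y"
    and smult: "\<And>a x. a \<in> carrier A \<Longrightarrow> x \<in> carrier M \<Longrightarrow> q (a \<odot>\<^bsub>M\<^esub> x) = a \<odot>\<^bsub>Q\<^esub> q x"
    and part: "\<And>d. mod_part Q d = q ` mod_part M d"
    and ker: "\<And>x d. x \<in> carrier M \<Longrightarrow> q x = \<zero>\<^bsub>Q\<^esub> \<Longrightarrow> q (homog_comp M x d) = \<zero>\<^bsub>Q\<^esub>"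
  shows "graded_module A Q"
proof -
  interpret M: gmod A M using M by (simp add: gmod_iff)
  interpret Q: module A Q by (rule module_image[OF M.module_axioms q z add smult])
  have qM: "q \<in> carrier M \<rightarrow> carrier Q" using q by auto
  have ag: "abelian_group M" "abelian_group Q" by unfold_locales
  note minus = additive_minus[OF ag qM add]
  have wd: "q (homog_comp M x d) = q (homog_comp M y d)"
    if "x \<in> carrier M" "y \<in> carrier M" "q x = q y" for x y d
  proof -
    have "q (x \<oplus>\<^bsub>M\<^esub> \<ominus>\<^bsub>M\<^esub> y) = \<zero>\<^bsub>Q\<^esub>" using that funcset_mem[OF qM] by (simp add: add minus Q.M.r_neg)
    hence "q (homog_comp M (x \<oplus>\<^bsub>M\<^esub> \<ominus>\<^bsub>M\<^esub> y) d) = \<zero>\<^bsub>Q\<^esub>" using that ker by simp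
    moreover have "homog_comp M x d = homog_comp M (x \<oplus>\<^bsub>M\<^esub> \<ominus>\<^bsub>M\<^esub> y) d \<oplus>\<^bsub>M\<^esub> homog_comp M y d"
      using that by (subst M.homog_comp_add[symmetric]) (auto simp: M.M.a_assoc M.M.l_neg)
    moreover have "q (homog_comp M y d) \<in> carrier Q" using qM that by auto
    ultimately show ?thesis using that by (simp add: add)
  qed
  \<comment> \<open>An arbitrary preimage is chosen; \<open>wd\<close> makes the choice
    immaterial.\<close>
  define \<pi> where "\<pi> X d = q (homog_comp M (SOME x. x \<in> carrier M \<and> q x = X) d)" for X d
  have pi: "\<pi> (q x) d = q (homog_comp M x d)" if "x \<in> carrier M" for x d
  proof -
    have "(SOME y. y \<in> carrier M \<and> q y = q x) \<in> carrier M \<and> q (SOME y. y \<in> carrier M \<and> q y = q x) = q x"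
      by (rule someI[of _ x]) (use that in auto)
    thus ?thesis unfolding \<pi>_def using wd that by blast
  qed
  have fin: "finite {d. q (homog_comp M x d) \<noteq> \<zero>\<^bsub>Q\<^esub>}" if "x \<in> carrier M" for x
    by (rule finite_subset[of _ "{d. homog_comp M x d \<noteq> \<zero>\<^bsub>M\<^esub>}"]) (use M.homog_comp_spec[OF that] z in auto)
  show ?thesis
  proof (rule graded_moduleI[OF Q.module_axioms, where \<pi> = \<pi>])
    show "subgroup (mod_part Q d) (add_monoid Q)" for d
    proof (rule Q.M.add_subgroupI)
      show "\<ominus>\<^bsub>Q\<^esub> x \<in> mod_part Q d" if "x \<in> mod_part Q d" for x
        using that M.part_uminus M.part_closed by (auto simp: part minus[symmetric])
      show "x \<oplus>\<^bsub>Q\<^esub> y \<in> mod_part Q d" if "x \<in> mod_part Q d" "y \<in> mod_part Q d" for x y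
        using that M.part_add M.part_closed by (auto simp: part add[symmetric])
    qed (use M.part_closed M.part_zero[of d] in \<open>auto simp: part q z[symmetric] simp del: M.part_zero\<close>)
    show "a \<odot>\<^bsub>Q\<^esub> x \<in> mod_part Q (d + e)" if "a \<in> ring_part A d" "x \<in> mod_part Q e" for d e a x
      using that M.part_smult M.part_closed ring_part_closed by (auto simp: part smult[symmetric])
    show "X = (\<Oplus>\<^bsub>Q\<^esub>d\<in>{d. \<pi> X d \<noteq> \<zero>\<^bsub>Q\<^esub>}. \<pi> X d)" if X: "X \<in> carrier Q" for X
    proof -
      obtain x where x: "x \<in> carrier M" "X = q x" using X q by auto
      let ?S = "{d. homog_comp M x d \<noteq> \<zero>\<^bsub>M\<^esub>}"
      have "X = q (\<Oplus>\<^bsub>M\<^esub>d\<in>?S. homog_comp M x d)" using M.homog_comp_spec[OF x(1)] x(2) by metis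
      also have "\<dots> = (\<Oplus>\<^bsub>Q\<^esub>d\<in>?S. \<pi> X d)"
        unfolding x(2) pi[OF x(1)]
        by (rule additive_finsum[OF ag qM add]) (use x M.homog_comp_spec[OF x(1)] in auto)
      also have "\<dots> = (\<Oplus>\<^bsub>Q\<^esub>d\<in>{d. \<pi> X d \<noteq> \<zero>\<^bsub>Q\<^esub>}. \<pi> X d)"
        unfolding x(2) pi[OF x(1)]
        by (rule Q.M.add.finprod_mono_neutral_cong_right)
          (use qM x M.homog_comp_spec[OF x(1)] z in auto)
      finally show ?thesis .
    qed
    show "\<pi> (X \<oplus>\<^bsub>Q\<^esub> Y) d = \<pi> X d \<oplus>\<^bsub>Q\<^esub> \<pi> Y d" if "X \<in> carrier Q" "Y \<in> carrier Q" for X Y d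
      using that by (auto simp: q add[symmetric] pi M.homog_comp_add)
  qed (use M.homog_comp_part M.homog_comp_homog M.part_closed fin z in \<open>auto simp: pi q part\<close>)
qed


text \<open>The scalar action of \<open>gquot\<close> is a union of cosets over all representatives.
  Closure of \<open>B\<close> under scalars makes these cosets coincide, so the union is a single
  coset.\<close>

lemma (in gring)
  fixes M :: "('a, 'm) gmodule"
  assumes M: "graded_module A M" and B: "graded_submodule A M B"
  shows graded_module_gquot: "graded_module A (gquot M B)"
    and smult_gquot: "\<And>a x. a \<in> carrier A \<Longrightarrow> x \<in> carrier M \<Longrightarrow>
      a \<odot>\<^bsub>gquot M B\<^esub> (B +>\<^bsub>M\<^esub> x) = B +>\<^bsub>M\<^esub> (a \<odot>\<^bsub>M\<^esub> x)"
proof -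
  interpret M: gmod A M using M by (simp add: gmod_iff)
  note sg = M.graded_submodule_subgroup[OF B]
  interpret B: abelian_subgroup B M
    by (rule abelian_subgroupI3[OF additive_subgroupI[OF sg] M.M.abelian_group_axioms])
  have Bs: "a \<odot>\<^bsub>M\<^esub> x \<in> B" if "a \<in> carrier A" "x \<in> B" for a x
    using B that unfolding graded_submodule_def by blast
  show smult: "a \<odot>\<^bsub>gquot M B\<^esub> (B +>\<^bsub>M\<^esub> x) = B +>\<^bsub>M\<^esub> (a \<odot>\<^bsub>M\<^esub> x)"
    if a: "a \<in> carrier A" and x: "x \<in> carrier M" for a x
  proof -
    have "B +>\<^bsub>M\<^esub> (a \<odot>\<^bsub>M\<^esub> y) = B +>\<^bsub>M\<^esub> (a \<odot>\<^bsub>M\<^esub> x)" if "y \<in> B +>\<^bsub>M\<^esub> x" for y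
    proof -
      obtain h where h: "h \<in> B" "y = h \<oplus>\<^bsub>M\<^esub> x" using \<open>y \<in> _\<close> by (auto simp: a_r_coset_def')
      have "a \<odot>\<^bsub>M\<^esub> y = a \<odot>\<^bsub>M\<^esub> h \<oplus>\<^bsub>M\<^esub> a \<odot>\<^bsub>M\<^esub> x" using h a x B.a_subset by (auto simp: M.smult_r_distr)
      hence "a \<odot>\<^bsub>M\<^esub> y \<in> B +>\<^bsub>M\<^esub> (a \<odot>\<^bsub>M\<^esub> x)" using Bs[OF a h(1)] by (auto simp: a_r_coset_def')
      thus ?thesis using M.M.a_repr_independence[OF _ _ sg] a x by simp
    qed
    hence "(\<Union>y\<in>B +>\<^bsub>M\<^esub> x. B +>\<^bsub>M\<^esub> (a \<odot>\<^bsub>M\<^esub> y)) = B +>\<^bsub>M\<^esub> (a \<odot>\<^bsub>M\<^esub> x)"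
      using B.a_rcos_self[OF x] by blast
    thus ?thesis by (simp add: gquot_def)
  qed
  have zero_iff: "B +>\<^bsub>M\<^esub> x = B \<longleftrightarrow> x \<in> B" if "x \<in> carrier M" for x
    using M.M.a_coset_join1[OF _ _ sg] M.M.a_coset_join2[OF _ sg] that by blast
  show "graded_module A (gquot M B)"
  proof (rule graded_module_image[OF M, where q = "\<lambda>x. B +>\<^bsub>M\<^esub> x"])
    show "B +>\<^bsub>M\<^esub> homog_comp M x d = \<zero>\<^bsub>gquot M B\<^esub>"
      if "x \<in> carrier M" "B +>\<^bsub>M\<^esub> x = \<zero>\<^bsub>gquot M B\<^esub>" for x d
      using that B zero_iff unfolding graded_submodule_def by (simp add: gquot_def)
  qed (use smult B.a_rcos_sum B.a_subset in \<open>auto simp: gquot_def A_RCOSETS_def'\<close>)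
qed

text \<open>This moves quasi-cyclicity from cosets to representatives: both the inclusions and the
  generation are congruences modulo \<open>B\<close>, so the homological part never has to handle
  cosets.\<close>

lemma (in gring) graded_quasi_cyclic_gquot:
  fixes M :: "('a, 'm) gmodule"
  assumes M: "graded_module A M" and B: "graded_submodule A M B"
    and z: "\<And>t. z t \<in> mod_part M (e t)"
    and inc: "\<And>t. \<exists>b\<in>carrier A. \<exists>u\<in>B. z t = u \<oplus>\<^bsub>M\<^esub> b \<odot>\<^bsub>M\<^esub> z (Suc t)"
    and gen: "\<And>x. x \<in> carrier M \<Longrightarrow> \<exists>t. \<exists>a\<in>carrier A. \<exists>u\<in>B. x = u \<oplus>\<^bsub>M\<^esub> a \<odot>\<^bsub>M\<^esub> z t"
  shows "graded_quasi_cyclic A (gquot M B)"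
proof -
  interpret M: gmod A M using M by (simp add: gmod_iff)
  note sg = M.graded_submodule_subgroup[OF B]
  note smult = smult_gquot[OF M B]
  have zc: "z t \<in> carrier M" for t using z M.part_closed by blast
  define q where "q x = B +>\<^bsub>M\<^esub> x" for x
  have q_eq: "q (u \<oplus>\<^bsub>M\<^esub> x) = q x" if "u \<in> B" "x \<in> carrier M" for u x
    unfolding q_def using M.M.a_repr_independence[OF _ that(2) sg, of "u \<oplus>\<^bsub>M\<^esub> x"] that
    by (auto simp: a_r_coset_def')
  have cyc: "cyclic_submodule A (gquot M B) (q (z t)) = (\<lambda>a. q (a \<odot>\<^bsub>M\<^esub> z t)) ` carrier A" for t
    unfolding cyclic_submodule_def q_def using smult zc by auto
  show ?thesis
    unfolding graded_quasi_cyclic_def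
  proof (intro conjI exI[of _ "\<lambda>t. q (z t)"] allI)
    show "graded_module A (gquot M B)" by (rule graded_module_gquot[OF M B])
    show "q (z t) \<in> (\<Union>d. mod_part (gquot M B) d)" for t
      using z[of t] by (auto simp: gquot_def q_def)
    show "cyclic_submodule A (gquot M B) (q (z t)) \<subseteq> cyclic_submodule A (gquot M B) (q (z (Suc t)))" for t
    proof -
      obtain b u where bu: "b \<in> carrier A" "u \<in> B" "z t = u \<oplus>\<^bsub>M\<^esub> b \<odot>\<^bsub>M\<^esub> z (Suc t)" using inc by blast
      have "q (a \<odot>\<^bsub>M\<^esub> z t) = q ((a \<otimes> b) \<odot>\<^bsub>M\<^esub> z (Suc t))" if a: "a \<in> carrier A" for a
      proof -
        have "a \<odot>\<^bsub>M\<^esub> u \<in> B" "u \<in> carrier M" using a bu B unfolding graded_submodule_def by auto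
        thus ?thesis using a bu zc by (simp add: M.smult_r_distr M.smult_assoc1 q_eq)
      qed
      thus ?thesis unfolding cyc using bu by auto
    qed
    have "carrier (gquot M B) = q ` carrier M" by (auto simp: gquot_def A_RCOSETS_def' q_def)
    also have "\<dots> = (\<Union>t. cyclic_submodule A (gquot M B) (q (z t)))"
    proof (intro equalityI subsetI)
      fix X assume "X \<in> q ` carrier M"
      then obtain x where x: "x \<in> carrier M" "X = q x" by blast
      from gen[OF x(1)] show "X \<in> (\<Union>t. cyclic_submodule A (gquot M B) (q (z t)))"
        unfolding cyc x(2) using q_eq zc by fastforce
    qed (use zc in \<open>auto simp: cyc\<close>)
    finally show "carrier (gquot M B) = (\<Union>t. cyclic_submodule A (gquot M B) (q (z t)))" .
  qed
qed

section \<open>Torsion in Noetherian rings\<close>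

text \<open>In a Noetherian ring a nonempty chain of ideals contains its union; an index at which
  the union is attained bounds all the others.\<close>

lemma (in noetherian_ring) ideal_seq_stable:
  assumes C: "\<And>i. ideal (C i) R" and inc: "\<And>i :: nat. C i \<subseteq> C (Suc i)"
  obtains N where "\<And>i. C i \<subseteq> C N"
proof -
  have mono: "C i \<subseteq> C j" if "i \<le> j" for i j using lift_Suc_mono_le[of C] inc that by blast
  have "\<Union>(range C) \<in> range C"
  proof (rule ideal_chain_is_trivial)
    show "subset.chain {I. ideal I R} (range C)"
      unfolding subset_chain_def using C by (auto simp: image_iff) (metis linear mono subsetD)
  qed auto
  thus ?thesis using that by auto
qed

lemma idealI_comm:
  assumes "cring R" "I \<subseteq> carrier R" "\<zero>\<^bsub>R\<^esub> \<in> I" "\<And>a b. a \<in> I \<Longrightarrow> b \<in> I \<Longrightarrow> a \<oplus>\<^bsub>R\<^esub> b \<in> I"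
    and "\<And>a b. a \<in> carrier R \<Longrightarrow> b \<in> I \<Longrightarrow> a \<otimes>\<^bsub>R\<^esub> b \<in> I"
  shows "ideal I R"
proof -
  interpret cring R by fact
  have "\<ominus>\<^bsub>R\<^esub> a \<in> I" if "a \<in> I" for a
  proof -
    have "\<ominus>\<^bsub>R\<^esub> a = (\<ominus>\<^bsub>R\<^esub> \<one>\<^bsub>R\<^esub>) \<otimes>\<^bsub>R\<^esub> a" using that assms(2) by (simp add: l_minus subset_iff)
    thus ?thesis using assms(5) that by simp
  qed
  hence "subgroup I (add_monoid R)" using assms by (intro add_subgroupI) auto
  moreover have "b \<otimes>\<^bsub>R\<^esub> a \<in> I" if "a \<in> carrier R" "b \<in> I" for a b
    using assms(5)[OF that] m_comm[of a b] that assms(2) by auto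
  ultimately show ?thesis
    using assms(2,5) by (intro idealI) (auto simp: ring_axioms subset_iff)
qed

lemma (in module) ann_ideal:
  assumes "x \<in> carrier M"
  shows "ideal {a \<in> carrier R. a \<odot>\<^bsub>M\<^esub> x = \<zero>\<^bsub>M\<^esub>} R"
  by (rule idealI_comm) (use assms in \<open>auto simp: R.is_cring smult_l_distr smult_assoc1\<close>)

lemma (in ring) ideal_nat_pow:
  assumes "ideal I R" shows "ideal (I [^]\<^bsub>ideals_set R\<^esub> (t :: nat)) R"
  by (induction t)
    (use assms ideal_prod_is_ideal oneideal in \<open>auto simp: ideals_set_def nat_pow_def\<close>)

lemma (in ring) ideal_nat_pow_Suc:
  "I [^]\<^bsub>ideals_set R\<^esub> Suc t = ideal_prod R (I [^]\<^bsub>ideals_set R\<^esub> t) I"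
  "I [^]\<^bsub>ideals_set R\<^esub> (0 :: nat) = carrier R"
  by (auto simp: ideals_set_def nat_pow_def)

lemma (in ring) elem_nat_pow_in:
  assumes "ideal I R" "a \<in> I" shows "a [^] t \<in> I [^]\<^bsub>ideals_set R\<^esub> (t :: nat)"
proof (induction t)
  case 0
  show ?case unfolding ideal_nat_pow_Suc by simp
next
  case (Suc t)
  thus ?case unfolding ideal_nat_pow_Suc using assms by (auto intro: ideal_prod.prod)
qed

text \<open>The ideals \<open>C t\<close> of those \<open>b\<close> with \<open>I\<^sup>t b x = 0\<close> become stationary at some \<open>C N\<close>.  If \<open>1 \<notin> C N\<close>,
  multiplying by suitable powers of the generators produces \<open>b \<notin> C N\<close> with \<open>I b \<subseteq> C N\<close>, so that
  \<open>b \<in> C (N + 1) = C N\<close>.\<close>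

lemma power_torsion:
  assumes "noetherian_ring A" "module A M" and x: "x \<in> carrier M"
    and gens: "finite S" "S \<subseteq> carrier A"
    and tors: "\<And>a. a \<in> S \<Longrightarrow> \<exists>m :: nat. (a [^]\<^bsub>A\<^esub> m) \<odot>\<^bsub>M\<^esub> x = \<zero>\<^bsub>M\<^esub>"
  shows "\<exists>t :: nat. \<forall>a \<in> (Idl\<^bsub>A\<^esub> S) [^]\<^bsub>ideals_set A\<^esub> t. a \<odot>\<^bsub>M\<^esub> x = \<zero>\<^bsub>M\<^esub>"
proof -
  interpret noetherian_ring A by fact
  interpret M: module A M by fact
  define I where "I = Idl\<^bsub>A\<^esub> S"
  have I: "ideal I A" unfolding I_def by (rule genideal_ideal[OF gens(2)])
  define P where "P t = I [^]\<^bsub>ideals_set A\<^esub> t" for t :: nat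
  have Pi: "ideal (P t) A" for t unfolding P_def by (rule ideal_nat_pow[OF I])
  have Pc: "a \<in> carrier A" if "a \<in> P t" for a t using ideal.Icarr[OF Pi that] .
  have Ic: "a \<in> carrier A" if "a \<in> I" for a using ideal.Icarr[OF I that] .
  define C where "C t = {b \<in> carrier A. \<forall>a \<in> P t. (b \<otimes>\<^bsub>A\<^esub> a) \<odot>\<^bsub>M\<^esub> x = \<zero>\<^bsub>M\<^esub>}" for t
  have Ci: "ideal (C t) A" for t
    by (rule idealI_comm[OF M.R.is_cring])
      (use x Pc in \<open>auto simp: C_def M.smult_l_distr M.smult_assoc1 l_distr\<close>)
  have "P (Suc t) \<subseteq> P t" for t :: nat
    using ideal_prod_inter[OF Pi I] unfolding P_def ideal_nat_pow_Suc by blast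
  hence "C t \<subseteq> C (Suc t)" for t unfolding C_def by blast
  from ideal_seq_stable[of C, OF Ci this] obtain N where N: "\<And>i. C i \<subseteq> C N" by blast
  have "\<one>\<^bsub>A\<^esub> \<in> C N"
  proof (rule ccontr)
    assume one: "\<one>\<^bsub>A\<^esub> \<notin> C N"
    have ex: "\<exists>b\<in>carrier A. b \<notin> C N \<and> (\<forall>s\<in>T. s \<otimes>\<^bsub>A\<^esub> b \<in> C N)" if "finite T" "T \<subseteq> S" for T
      using that
    proof (induction T)
      case empty
      thus ?case using one by auto
    next
      case (insert s T)
      then obtain b where b: "b \<in> carrier A" "b \<notin> C N" "\<forall>s\<in>T. s \<otimes>\<^bsub>A\<^esub> b \<in> C N" by auto
      have s: "s \<in> carrier A" "s \<in> S" using insert.prems gens by auto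
      obtain m :: nat where m: "(s [^]\<^bsub>A\<^esub> m) \<odot>\<^bsub>M\<^esub> x = \<zero>\<^bsub>M\<^esub>" using tors s by blast
      have "s [^]\<^bsub>A\<^esub> m \<otimes>\<^bsub>A\<^esub> b \<in> C N"
      proof -
        have "(s [^]\<^bsub>A\<^esub> m \<otimes>\<^bsub>A\<^esub> b \<otimes>\<^bsub>A\<^esub> a) \<odot>\<^bsub>M\<^esub> x = \<zero>\<^bsub>M\<^esub>" if "a \<in> P N" for a
        proof -
          have "s [^]\<^bsub>A\<^esub> m \<otimes>\<^bsub>A\<^esub> b \<otimes>\<^bsub>A\<^esub> a = (b \<otimes>\<^bsub>A\<^esub> a) \<otimes>\<^bsub>A\<^esub> s [^]\<^bsub>A\<^esub> m"
            using b s Pc[OF that] by (simp add: M.R.m_ac)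
          thus ?thesis using b s Pc[OF that] x m by (simp add: M.smult_assoc1)
        qed
        thus ?thesis using b s by (simp add: C_def)
      qed
      \<comment> \<open>Take the least exponent that moves \<open>b\<close> into \<open>C N\<close>.
        It is positive, and its predecessor gives the new witness: that witness is still outside
        \<open>C N\<close>, while multiplication by \<open>s\<close> brings it inside.\<close>
      then obtain k :: nat where k: "s [^]\<^bsub>A\<^esub> k \<otimes>\<^bsub>A\<^esub> b \<in> C N"
          "\<And>j. j < k \<Longrightarrow> s [^]\<^bsub>A\<^esub> j \<otimes>\<^bsub>A\<^esub> b \<notin> C N"
        using exists_least_iff[of "\<lambda>m. s [^]\<^bsub>A\<^esub> m \<otimes>\<^bsub>A\<^esub> b \<in> C N"] by blast
      have "k \<noteq> 0" using k(1) b by (metis l_one nat_pow_0)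
      then obtain j where j: "k = Suc j" using not0_implies_Suc by blast
      let ?b = "s [^]\<^bsub>A\<^esub> j \<otimes>\<^bsub>A\<^esub> b"
      have "s \<otimes>\<^bsub>A\<^esub> ?b \<in> C N" using k(1) s b unfolding j by (simp add: M.R.m_ac)
      moreover have "s' \<otimes>\<^bsub>A\<^esub> ?b \<in> C N" if "s' \<in> T" for s'
      proof -
        have "s' \<in> carrier A" using that insert.prems gens by auto
        hence "s' \<otimes>\<^bsub>A\<^esub> ?b = s [^]\<^bsub>A\<^esub> j \<otimes>\<^bsub>A\<^esub> (s' \<otimes>\<^bsub>A\<^esub> b)" using s b by (simp add: M.R.m_ac)
        thus ?thesis using b(3) that s ideal.I_l_closed[OF Ci] by simp
      qed
      ultimately show ?case using k(2)[of j] j s b by (intro bexI[of _ ?b]) auto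
    qed
    from ex[OF gens(1)] obtain b where b: "b \<in> carrier A" "b \<notin> C N" "\<forall>s\<in>S. s \<otimes>\<^bsub>A\<^esub> b \<in> C N" by auto
    have "ideal {a \<in> carrier A. a \<otimes>\<^bsub>A\<^esub> b \<in> C N} A"
      by (rule idealI_comm[OF M.R.is_cring])
        (use b additive_subgroup.zero_closed[OF ideal.axioms(1)[OF Ci]]
          additive_subgroup.a_closed[OF ideal.axioms(1)[OF Ci]] ideal.I_l_closed[OF Ci] in
          \<open>auto simp: l_distr m_assoc\<close>)
    hence sub: "I \<subseteq> {a \<in> carrier A. a \<otimes>\<^bsub>A\<^esub> b \<in> C N}"
      unfolding I_def using gens(2) b(3) by (intro genideal_minimal) auto
    have "(b \<otimes>\<^bsub>A\<^esub> a) \<odot>\<^bsub>M\<^esub> x = \<zero>\<^bsub>M\<^esub>" if "a \<in> P (Suc N)" for a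
    proof -
      from that have "a \<in> ideal_prod A (P N) I" unfolding P_def ideal_nat_pow_Suc .
      thus ?thesis
      proof induction
        case (prod i j)
        have "j \<otimes>\<^bsub>A\<^esub> b \<in> C N" using prod sub by blast
        hence "(j \<otimes>\<^bsub>A\<^esub> b \<otimes>\<^bsub>A\<^esub> i) \<odot>\<^bsub>M\<^esub> x = \<zero>\<^bsub>M\<^esub>" using prod unfolding C_def by blast
        moreover have "j \<otimes>\<^bsub>A\<^esub> b \<otimes>\<^bsub>A\<^esub> i = b \<otimes>\<^bsub>A\<^esub> (i \<otimes>\<^bsub>A\<^esub> j)"
          using Pc[OF prod(1)] Ic[OF prod(2)] b by (simp add: M.R.m_ac)
        ultimately show ?case by simp
      next
        case (sum s1 s2)
        have "s1 \<in> carrier A" "s2 \<in> carrier A" using sum ideal_prod_in_carrier[OF Pi I] by auto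
        thus ?case using sum b x by (simp add: r_distr M.smult_l_distr)
      qed
    qed
    hence "b \<in> C (Suc N)" using b by (simp add: C_def)
    thus False using N b by blast
  qed
  hence "\<forall>a\<in>P N. a \<odot>\<^bsub>M\<^esub> x = \<zero>\<^bsub>M\<^esub>" using Pc unfolding C_def by auto
  thus ?thesis unfolding P_def I_def by blast
qed

section \<open>Divisibility in graded injective modules\<close>

context gring
begin

lemma ring_part_mult: "a \<in> ring_part A d \<Longrightarrow> b \<in> ring_part A e \<Longrightarrow> a \<otimes> b \<in> ring_part A (d + e)"
proof -
  interpret S: gmod A "self_gmodule A" using graded_self by (simp add: gmod_iff)
  show "a \<in> ring_part A d \<Longrightarrow> b \<in> ring_part A e \<Longrightarrow> a \<otimes> b \<in> ring_part A (d + e)"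
    using S.part_smult by (simp add: self_gmodule_def)
qed

lemma ring_part_pow: "a \<in> ring_part A d \<Longrightarrow> a [^] (s :: nat) \<in> ring_part A (int s * d)"
proof (induction s)
  case 0
  thus ?case using one_part by simp
next
  case (Suc s)
  thus ?case using ring_part_mult[of "a [^] s" "int s * d" a d] by (simp add: algebra_simps)
qed

text \<open>Members of \<open>graded_hom\<close> have degree 0, so a map sending
  \<open>\<one>\<close> to an element of some other degree has to start from a regraded copy of the
  ring.\<close>

lemma graded_module_shift:
  fixes M :: "('a, 'm) gmodule"
  assumes M: "graded_module A M"
  shows "graded_module A (M\<lparr>mod_part := \<lambda>d. mod_part M (d + s)\<rparr>)"
proof -
  interpret gmod A M using M by (simp add: gmod_iff)
  let ?N = "M\<lparr>mod_part := \<lambda>d. mod_part M (d + s)\<rparr>"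
  have N: "module A ?N" by (rule module_image[OF module_axioms, of _ "\<lambda>x. x"]) auto
  interpret N: module A ?N by fact
  have fs: "finsum ?N f S = finsum M f S" if "finite S" "\<And>i. i \<in> S \<Longrightarrow> f i \<in> carrier M" for f :: "int \<Rightarrow> 'm" and S
    using additive_finsum[OF N.M.abelian_group_axioms M.abelian_group_axioms, of "\<lambda>x. x" S f] that by (auto simp: Pi_def)
  have fin: "finite {d. homog_comp M x (d + s) \<noteq> \<zero>\<^bsub>M\<^esub>}"
    and im: "(\<lambda>d. d + s) ` {d. homog_comp M x (d + s) \<noteq> \<zero>\<^bsub>M\<^esub>} = {d. homog_comp M x d \<noteq> \<zero>\<^bsub>M\<^esub>}"
    if "x \<in> carrier M" for x
  proof -
    show im: "(\<lambda>d. d + s) ` {d. homog_comp M x (d + s) \<noteq> \<zero>\<^bsub>M\<^esub>} = {d. homog_comp M x d \<noteq> \<zero>\<^bsub>M\<^esub>}"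
      by (auto intro!: image_eqI[where x = "d - s" for d])
    show "finite {d. homog_comp M x (d + s) \<noteq> \<zero>\<^bsub>M\<^esub>}"
      by (rule finite_imageD[of "\<lambda>d. d + s"]) (use im homog_comp_spec[OF that] in \<open>auto simp: inj_on_def\<close>)
  qed
  show ?thesis
  proof (rule graded_moduleI[OF N, where \<pi> = "\<lambda>x d. homog_comp M x (d + s)"])
    show "subgroup (mod_part ?N d) (add_monoid ?N)" for d
      using part_subgroup[of "d + s"] by (auto simp: subgroup_def m_inv_def)
    show "a \<odot>\<^bsub>?N\<^esub> x \<in> mod_part ?N (d + e)" if "a \<in> ring_part A d" "x \<in> mod_part ?N e" for d e a x
      using part_smult[of a d x "e + s"] that by (simp add: add.assoc)
    show "x = (\<Oplus>\<^bsub>?N\<^esub>d\<in>{d. homog_comp M x (d + s) \<noteq> \<zero>\<^bsub>?N\<^esub>}. homog_comp M x (d + s))"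
      if "x \<in> carrier ?N" for x
    proof -
      have x: "x \<in> carrier M" using that by simp
      have "x = (\<Oplus>\<^bsub>M\<^esub>d\<in>{d. homog_comp M x d \<noteq> \<zero>\<^bsub>M\<^esub>}. homog_comp M x d)"
        using homog_comp_spec[OF x] by simp
      also have "\<dots> = (\<Oplus>\<^bsub>M\<^esub>d\<in>{d. homog_comp M x (d + s) \<noteq> \<zero>\<^bsub>M\<^esub>}. homog_comp M x (d + s))"
        unfolding im[OF x, symmetric] by (rule M.finsum_reindex) (use x in \<open>auto simp: inj_on_def\<close>)
      also have "\<dots> = (\<Oplus>\<^bsub>?N\<^esub>d\<in>{d. homog_comp M x (d + s) \<noteq> \<zero>\<^bsub>M\<^esub>}. homog_comp M x (d + s))"
        by (rule fs[symmetric]) (use x fin[OF x] in auto)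
      finally show ?thesis by simp
    qed
  qed (use homog_comp_part homog_comp_homog homog_comp_add fin in auto)
qed

end

locale noetherian_gring = gring A + noetherian_ring A for A (structure)

text \<open>With \<open>m\<close> such that \<open>f\<^sup>m\<^sup>+\<^sup>1 a x = 0\<close> implies \<open>f\<^sup>m a x = 0\<close>, the assignment
  \<open>a f\<^sup>m\<^sup>+\<^sup>1 + b \<mapsto> a f\<^sup>m x\<close> is well defined on the ideal \<open>f\<^sup>m\<^sup>+\<^sup>1 A + ann x\<close>; the value at \<open>1\<close> of an
  extension to \<open>A\<close> is the required \<open>y\<close>.  No Artin--Rees argument is needed, because the
  extension kills \<open>ann x\<close>.\<close>

lemma (in noetherian_gring) graded_injective_divide:
  fixes J :: "('a, 'm) gmodule"
  assumes J: "graded_injective A J" and x: "x \<in> mod_part J e" and f: "f \<in> ring_part A \<delta>"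
  shows "\<exists>m. \<exists>y\<in>mod_part J (e - \<delta>). (f [^] Suc m) \<odot>\<^bsub>J\<^esub> y = (f [^] (m :: nat)) \<odot>\<^bsub>J\<^esub> x \<and>
    (\<forall>a\<in>carrier A. a \<odot>\<^bsub>J\<^esub> x = \<zero>\<^bsub>J\<^esub> \<longrightarrow> a \<odot>\<^bsub>J\<^esub> y = \<zero>\<^bsub>J\<^esub>)"
proof -
  have gJ: "graded_module A J" using J unfolding graded_injective_def by blast
  interpret J: gmod A J using gJ by (simp add: gmod_iff)
  have xc: "x \<in> carrier J" using x J.part_closed by blast
  have fc: "f \<in> carrier A" using f ring_part_closed by blast
  define Z where "Z i = {a \<in> carrier A. a \<odot>\<^bsub>J\<^esub> ((f [^] (i :: nat)) \<odot>\<^bsub>J\<^esub> x) = \<zero>\<^bsub>J\<^esub>}" for i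
  have "ideal (Z i) A" for i unfolding Z_def by (rule J.ann_ideal) (use xc fc in auto)
  moreover have "Z i \<subseteq> Z (Suc i)" for i
  proof
    fix a assume "a \<in> Z i"
    hence a: "a \<in> carrier A" "a \<odot>\<^bsub>J\<^esub> ((f [^] i) \<odot>\<^bsub>J\<^esub> x) = \<zero>\<^bsub>J\<^esub>" by (auto simp: Z_def)
    have "a \<odot>\<^bsub>J\<^esub> ((f [^] Suc i) \<odot>\<^bsub>J\<^esub> x) = (a \<otimes> f [^] Suc i) \<odot>\<^bsub>J\<^esub> x"
      using a fc xc by (subst J.smult_assoc1) auto
    also have "a \<otimes> f [^] Suc i = f \<otimes> (a \<otimes> f [^] i)" using a fc by (simp add: m_ac)
    also have "(f \<otimes> (a \<otimes> f [^] i)) \<odot>\<^bsub>J\<^esub> x = f \<odot>\<^bsub>J\<^esub> (a \<odot>\<^bsub>J\<^esub> ((f [^] i) \<odot>\<^bsub>J\<^esub> x))"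
      using a fc xc by (simp add: J.smult_assoc1)
    finally show "a \<in> Z (Suc i)" using a fc by (simp add: Z_def)
  qed
  ultimately obtain m where m: "\<And>i. Z i \<subseteq> Z m" using ideal_seq_stable[of Z] by blast
  define F where "F = f [^] Suc m"
  define v where "v = (f [^] m) \<odot>\<^bsub>J\<^esub> x"
  have Fc: "F \<in> carrier A" and vc: "v \<in> carrier J" using fc xc by (auto simp: F_def v_def)
  have Fp: "F \<in> ring_part A (int (Suc m) * \<delta>)" unfolding F_def by (rule ring_part_pow[OF f])
  have vp: "v \<in> mod_part J (int m * \<delta> + e)" unfolding v_def by (rule J.part_smult[OF ring_part_pow[OF f] x])
  have kill: "a \<odot>\<^bsub>J\<^esub> v = \<zero>\<^bsub>J\<^esub>" if "a \<in> carrier A" "(a \<otimes> F) \<odot>\<^bsub>J\<^esub> x = \<zero>\<^bsub>J\<^esub>" for a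
    using m[of "Suc m"] that fc xc unfolding Z_def v_def F_def by (auto simp: J.smult_assoc1)
  \<comment> \<open>With this shift \<open>\<one>\<close> has degree \<open>e - \<delta>\<close>,
    the degree wanted for \<open>y\<close>, and \<open>F\<close> has degree
    \<open>int m * \<delta> + e\<close>, the degree of \<open>v\<close>. Hence the map sending
    \<open>F\<close> to \<open>v\<close> has degree 0.\<close>
  define s where "s = \<delta> - e"
  define N where "N = (self_gmodule A)\<lparr>mod_part := \<lambda>d. mod_part (self_gmodule A) (d + s)\<rparr>"
  have gN: "graded_module A N" unfolding N_def by (rule graded_module_shift[OF graded_self])
  interpret N: gmod A N using gN by (simp add: gmod_iff)
  have N [simp]: "carrier N = carrier A" "\<And>d. mod_part N d = ring_part A (d + s)"
    "add N = add A" "zero N = zero A" "smult N = monoid.mult A"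
    by (auto simp: N_def self_gmodule_def)
  define H where "H = {a \<otimes> F \<oplus> b | a b. a \<in> carrier A \<and> b \<in> carrier A \<and> b \<odot>\<^bsub>J\<^esub> x = \<zero>\<^bsub>J\<^esub>}"
  have compF: "homog_comp N (a \<otimes> F) d = homog_comp N a (d - int (Suc m) * \<delta>) \<otimes> F"
    if "a \<in> carrier A" for a d
  proof -
    have "homog_comp N (a \<otimes> F) (d - int (Suc m) * \<delta> + int (Suc m) * \<delta>) =
        homog_comp N a (d - int (Suc m) * \<delta>) \<otimes> F"
    proof (rule homog_comp_map[OF gN gN])
      show "y \<otimes> F \<in> mod_part N (d + int (Suc m) * \<delta>)" if "y \<in> mod_part N d" for y d
        using ring_part_mult[OF _ Fp, of y "d + s"] that by (simp only: N ac_simps)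
    qed (use that Fc in \<open>auto simp: l_distr\<close>)
    thus ?thesis by simp
  qed
  have compx: "homog_comp N b d \<odot>\<^bsub>J\<^esub> x = \<zero>\<^bsub>J\<^esub>" if "b \<in> carrier A" "b \<odot>\<^bsub>J\<^esub> x = \<zero>\<^bsub>J\<^esub>" for b d
  proof -
    have "homog_comp J (b \<odot>\<^bsub>J\<^esub> x) (d + \<delta>) = homog_comp N b d \<odot>\<^bsub>J\<^esub> x"
    proof (rule homog_comp_map[OF gN gJ])
      show "y \<odot>\<^bsub>J\<^esub> x \<in> mod_part J (d + \<delta>)" if "y \<in> mod_part N d" for y d
        using J.part_smult[OF _ x, of y "d + s"] that by (simp add: s_def)
    qed (use that xc in \<open>auto simp: J.smult_l_distr\<close>)
    thus ?thesis using that(2) J.homog_comp_homog[of "\<zero>\<^bsub>J\<^esub>"] by simp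
  qed
  have comp_dec: "homog_comp N (a \<otimes> F \<oplus> b) d =
      homog_comp N a (d - int (Suc m) * \<delta>) \<otimes> F \<oplus> homog_comp N b d"
    if "a \<in> carrier A" "b \<in> carrier A" for a b d
    using that Fc N.homog_comp_add[of "a \<otimes> F" b d] compF by simp
  have Ncl: "homog_comp N a d \<in> carrier A" if "a \<in> carrier A" for a d using N.homog_comp_closed that by simp
  have H: "graded_submodule A N H"
    unfolding graded_submodule_def
  proof (intro conjI ballI allI)
    show "H \<subseteq> carrier N" unfolding H_def using Fc by auto
    have "\<zero> = \<zero> \<otimes> F \<oplus> \<zero>" using Fc by simp
    thus "\<zero>\<^bsub>N\<^esub> \<in> H" unfolding H_def using xc by (auto intro!: exI[of _ \<zero>])
    fix h assume "h \<in> H"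
    then obtain a b where h: "h = a \<otimes> F \<oplus> b" "a \<in> carrier A" "b \<in> carrier A" "b \<odot>\<^bsub>J\<^esub> x = \<zero>\<^bsub>J\<^esub>"
      unfolding H_def by blast
    show "homog_comp N h d \<in> H" for d
      unfolding h(1) comp_dec[OF h(2,3)] H_def using Ncl h compx by blast
    show "c \<odot>\<^bsub>N\<^esub> h \<in> H" if c: "c \<in> carrier A" for c
    proof -
      have "c \<otimes> h = (c \<otimes> a) \<otimes> F \<oplus> c \<otimes> b" using h c Fc by (simp add: r_distr m_assoc)
      moreover have "(c \<otimes> b) \<odot>\<^bsub>J\<^esub> x = \<zero>\<^bsub>J\<^esub>" using h c xc by (simp add: J.smult_assoc1)
      ultimately show ?thesis using h c unfolding H_def by auto
    qed
    fix h' assume "h' \<in> H"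
    then obtain a' b' where h': "h' = a' \<otimes> F \<oplus> b'" "a' \<in> carrier A" "b' \<in> carrier A" "b' \<odot>\<^bsub>J\<^esub> x = \<zero>\<^bsub>J\<^esub>"
      unfolding H_def by blast
    have "h \<oplus> h' = (a \<oplus> a') \<otimes> F \<oplus> (b \<oplus> b')" using h h' Fc by (simp add: l_distr a_ac)
    moreover have "(b \<oplus> b') \<odot>\<^bsub>J\<^esub> x = \<zero>\<^bsub>J\<^esub>" using h h' xc by (simp add: J.smult_l_distr)
    ultimately show "h \<oplus>\<^bsub>N\<^esub> h' \<in> H" using h h' unfolding H_def by auto
  qed
  define \<phi> where "\<phi> h = (SOME w. \<exists>a b. h = a \<otimes> F \<oplus> b \<and> a \<in> carrier A \<and> b \<in> carrier A \<and>
    b \<odot>\<^bsub>J\<^esub> x = \<zero>\<^bsub>J\<^esub> \<and> w = a \<odot>\<^bsub>J\<^esub> v)" for h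
  have wd: "a \<odot>\<^bsub>J\<^esub> v = a' \<odot>\<^bsub>J\<^esub> v"
    if "a \<otimes> F \<oplus> b = a' \<otimes> F \<oplus> b'" "a \<in> carrier A" "b \<in> carrier A" "b \<odot>\<^bsub>J\<^esub> x = \<zero>\<^bsub>J\<^esub>"
      "a' \<in> carrier A" "b' \<in> carrier A" "b' \<odot>\<^bsub>J\<^esub> x = \<zero>\<^bsub>J\<^esub>" for a b a' b'
  proof -
    have "(a \<otimes> F \<oplus> b) \<odot>\<^bsub>J\<^esub> x = (a' \<otimes> F \<oplus> b') \<odot>\<^bsub>J\<^esub> x" using that(1) by simp
    hence "(a \<otimes> F) \<odot>\<^bsub>J\<^esub> x = (a' \<otimes> F) \<odot>\<^bsub>J\<^esub> x" using that(2-) Fc xc by (simp add: J.smult_l_distr)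
    hence "((a \<ominus> a') \<otimes> F) \<odot>\<^bsub>J\<^esub> x = \<zero>\<^bsub>J\<^esub>"
      using that(2-) Fc xc by (simp add: l_distr a_minus_def J.smult_l_distr l_minus J.smult_l_minus J.M.r_neg)
    hence "(a \<ominus> a') \<odot>\<^bsub>J\<^esub> v = \<zero>\<^bsub>J\<^esub>" using kill that(2-) by simp
    hence "a \<odot>\<^bsub>J\<^esub> v \<oplus>\<^bsub>J\<^esub> \<ominus>\<^bsub>J\<^esub> (a' \<odot>\<^bsub>J\<^esub> v) = \<zero>\<^bsub>J\<^esub>"
      using that(2-) vc by (simp add: a_minus_def J.smult_l_distr J.smult_l_minus)
    thus ?thesis using that(2-) vc by (metis J.smult_closed J.M.minus_equality J.M.minus_minus J.M.a_inv_closed)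
  qed
  have phi: "\<phi> (a \<otimes> F \<oplus> b) = a \<odot>\<^bsub>J\<^esub> v"
    if "a \<in> carrier A" "b \<in> carrier A" "b \<odot>\<^bsub>J\<^esub> x = \<zero>\<^bsub>J\<^esub>" for a b
  proof -
    have "\<exists>a' b'. a \<otimes> F \<oplus> b = a' \<otimes> F \<oplus> b' \<and> a' \<in> carrier A \<and> b' \<in> carrier A \<and>
      b' \<odot>\<^bsub>J\<^esub> x = \<zero>\<^bsub>J\<^esub> \<and> \<phi> (a \<otimes> F \<oplus> b) = a' \<odot>\<^bsub>J\<^esub> v"
      unfolding \<phi>_def by (rule someI[of _ "a \<odot>\<^bsub>J\<^esub> v"]) (use that in blast)
    thus ?thesis using wd that by metis
  qed
  define M where "M = gsub N H"
  have gM: "graded_module A M" unfolding M_def by (rule graded_module_gsub(1)[OF gN H])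
  have M [simp]: "carrier M = H" "\<And>d. mod_part M d = H \<inter> ring_part A (d + s)"
    "add M = add A" "zero M = zero A" "smult M = monoid.mult A"
    by (auto simp: M_def gsub_def)
  have Hc: "h \<in> carrier A" if "h \<in> H" for h using that H unfolding graded_submodule_def by auto
  have "\<phi> \<in> graded_hom A M J"
    unfolding graded_hom_def
  proof (intro CollectI conjI ballI allI)
    show "\<phi> \<in> carrier M \<rightarrow> carrier J" using phi vc by (auto simp: H_def)
    show "\<phi> (h \<oplus>\<^bsub>M\<^esub> h') = \<phi> h \<oplus>\<^bsub>J\<^esub> \<phi> h'" if hh: "h \<in> carrier M" "h' \<in> carrier M" for h h'
    proof -
      obtain a b where h: "h = a \<otimes> F \<oplus> b" "a \<in> carrier A" "b \<in> carrier A" "b \<odot>\<^bsub>J\<^esub> x = \<zero>\<^bsub>J\<^esub>"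
        using hh unfolding M H_def by blast
      obtain a' b' where h': "h' = a' \<otimes> F \<oplus> b'" "a' \<in> carrier A" "b' \<in> carrier A" "b' \<odot>\<^bsub>J\<^esub> x = \<zero>\<^bsub>J\<^esub>"
        using hh unfolding M H_def by blast
      have "h \<oplus> h' = (a \<oplus> a') \<otimes> F \<oplus> (b \<oplus> b')" using h h' Fc by (simp add: l_distr a_ac)
      moreover have "(b \<oplus> b') \<odot>\<^bsub>J\<^esub> x = \<zero>\<^bsub>J\<^esub>" using h h' xc by (simp add: J.smult_l_distr)
      ultimately have "\<phi> (h \<oplus> h') = (a \<oplus> a') \<odot>\<^bsub>J\<^esub> v" using phi h h' by simp
      thus ?thesis using h h' vc phi by (simp add: J.smult_l_distr)
    qed
    show "\<phi> (c \<odot>\<^bsub>M\<^esub> h) = c \<odot>\<^bsub>J\<^esub> \<phi> h" if c: "c \<in> carrier A" and hh: "h \<in> carrier M" for c h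
    proof -
      obtain a b where h: "h = a \<otimes> F \<oplus> b" "a \<in> carrier A" "b \<in> carrier A" "b \<odot>\<^bsub>J\<^esub> x = \<zero>\<^bsub>J\<^esub>"
        using hh unfolding M H_def by blast
      have "c \<otimes> h = (c \<otimes> a) \<otimes> F \<oplus> c \<otimes> b" using h c Fc by (simp add: r_distr m_assoc)
      moreover have "(c \<otimes> b) \<odot>\<^bsub>J\<^esub> x = \<zero>\<^bsub>J\<^esub>" using h c xc by (simp add: J.smult_assoc1)
      ultimately have "\<phi> (c \<otimes> h) = (c \<otimes> a) \<odot>\<^bsub>J\<^esub> v" using phi h c by simp
      thus ?thesis using h c vc phi by (simp add: J.smult_assoc1)
    qed
    \<comment> \<open>The coefficients in a representation of a homogeneous \<open>h\<close> need
      not be homogeneous. Taking components of degree \<open>d\<close> yields another representation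
      of \<open>h\<close> whose coefficients are, and the value of \<open>\<phi>\<close> can be read
      off from that one.\<close>
    show "\<phi> ` mod_part M d \<subseteq> mod_part J d" for d
    proof (intro subsetI, elim imageE)
      fix w h assume w: "w = \<phi> h" and "h \<in> mod_part M d"
      hence hd: "h \<in> H" "h \<in> mod_part N d" by auto
      obtain a b where h: "h = a \<otimes> F \<oplus> b" "a \<in> carrier A" "b \<in> carrier A" "b \<odot>\<^bsub>J\<^esub> x = \<zero>\<^bsub>J\<^esub>"
        using hd unfolding H_def by blast
      let ?a = "homog_comp N a (d - int (Suc m) * \<delta>)" and ?b = "homog_comp N b d"
      have "h = ?a \<otimes> F \<oplus> ?b"
        using comp_dec[OF h(2,3), of d] N.homog_comp_homog[OF hd(2), of d] h(1) by simp
      hence "\<phi> h = ?a \<odot>\<^bsub>J\<^esub> v" using phi[OF Ncl Ncl compx] h by metis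
      moreover have "?a \<in> ring_part A (d - int (Suc m) * \<delta> + s)"
        using N.homog_comp_part[of a "d - int (Suc m) * \<delta>"] h by simp
      from J.part_smult[OF this vp] have "?a \<odot>\<^bsub>J\<^esub> v \<in> mod_part J d" by (simp add: s_def algebra_simps)
      ultimately show "w \<in> mod_part J d" using w by simp
    qed
  qed
  moreover have "(\<lambda>h. h) \<in> graded_hom A M N"
    unfolding graded_hom_def using Hc by auto
  \<comment> \<open>The lifting property is applied to an ideal inside a shift of the ring. Both
    carriers lie in the element type of \<open>A\<close>, as the definition of
    \<open>graded_injective\<close> demands.\<close>
  ultimately obtain g where g: "g \<in> graded_hom A N J" "\<forall>h\<in>H. g h = \<phi> h"
    using J gM gN unfolding graded_injective_def by (metis M(1) inj_on_id2)
  have g_lin: "g a = a \<odot>\<^bsub>J\<^esub> g \<one>" if "a \<in> carrier A" for a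
  proof -
    have "\<forall>a\<in>carrier A. \<forall>b\<in>carrier A. g (a \<otimes> b) = a \<odot>\<^bsub>J\<^esub> g b"
      using g(1) unfolding graded_hom_def by simp
    from this[rule_format, OF that one_closed] show ?thesis using that by simp
  qed
  show ?thesis
  proof (intro exI[of _ m] bexI[of _ "g \<one>"] conjI ballI impI)
    have "\<one> \<in> mod_part N (e - \<delta>)" using one_part by (simp add: s_def)
    thus "g \<one> \<in> mod_part J (e - \<delta>)" using g(1) unfolding graded_hom_def by blast
    have "\<one> \<otimes> F \<oplus> \<zero> \<in> H" unfolding H_def using xc by (intro CollectI exI conjI refl) auto
    hence "F \<in> H" using Fc by simp
    hence "F \<odot>\<^bsub>J\<^esub> g \<one> = \<phi> F" using g(2) g_lin[OF Fc] by metis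
    also have "\<phi> F = v" using phi[of \<one> \<zero>] xc vc Fc by simp
    finally show "(f [^] Suc m) \<odot>\<^bsub>J\<^esub> g \<one> = (f [^] m) \<odot>\<^bsub>J\<^esub> x" unfolding F_def v_def .
    fix a assume a: "a \<in> carrier A" "a \<odot>\<^bsub>J\<^esub> x = \<zero>\<^bsub>J\<^esub>"
    have a1: "a = \<zero> \<otimes> F \<oplus> a" using Fc a by simp
    have "\<zero> \<otimes> F \<oplus> a \<in> H" unfolding H_def using a by (intro CollectI exI[of _ \<zero>] exI[of _ a]) auto
    hence "a \<in> H" using a1 by simp
    hence "a \<odot>\<^bsub>J\<^esub> g \<one> = \<phi> a" using g(2) g_lin[OF a(1)] by metis
    also have "\<phi> a = \<zero>\<^bsub>J\<^esub>" using phi[of \<zero> a] a1 a vc by simp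
    finally show "a \<odot>\<^bsub>J\<^esub> g \<one> = \<zero>\<^bsub>J\<^esub>" .
  qed
qed

text \<open>The exponent may depend on \<open>f\<close>, so imposing one more condition is just
  \<open>insert\<close> into the set. For a finite set of ring elements this is the torsion with
  respect to the ideal they generate, by \<open>power_torsion\<close>.\<close>

definition torsion_by ::
    "('a, 'x) gring_scheme \<Rightarrow> ('a, 'm, 'y) gmodule_scheme \<Rightarrow> 'a set \<Rightarrow> 'm set" where
  "torsion_by A M F = {x \<in> carrier M. \<forall>f\<in>F. \<exists>t :: nat. (f [^]\<^bsub>A\<^esub> t) \<odot>\<^bsub>M\<^esub> x = \<zero>\<^bsub>M\<^esub>}"

lemma (in module) pow_smult_mono:
  assumes "f \<in> carrier R" "x \<in> carrier M" "(f [^] t) \<odot>\<^bsub>M\<^esub> x = \<zero>\<^bsub>M\<^esub>" "(t :: nat) \<le> u"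
  shows "(f [^] u) \<odot>\<^bsub>M\<^esub> x = \<zero>\<^bsub>M\<^esub>"
proof -
  have "f [^] u = f [^] (u - t) \<otimes> f [^] t" using assms by (simp add: R.nat_pow_mult)
  thus ?thesis using assms by (simp add: smult_assoc1)
qed

text \<open>Multiplication by a power of a homogeneous \<open>f\<close> shifts degrees uniformly, so
  a power killing \<open>x\<close> kills each component of \<open>x\<close>. For a sum, the larger
  of the two exponents works.\<close>

lemma (in gring) torsion_by_graded_submodule:
  fixes M :: "('a, 'm, 'y) gmodule_scheme"
  assumes M: "graded_module A M" and F: "F \<subseteq> homogeneous_elems A"
  shows "graded_submodule A M (torsion_by A M F)"
proof -
  interpret M: gmod A M using M by (simp add: gmod_iff)
  have Fc: "f \<in> carrier A" if "f \<in> F" for f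
    using F that ring_part_closed unfolding homogeneous_elems_def by blast
  show ?thesis
    unfolding graded_submodule_def
  proof (intro conjI ballI allI)
    show "torsion_by A M F \<subseteq> carrier M" by (auto simp: torsion_by_def)
    show "\<zero>\<^bsub>M\<^esub> \<in> torsion_by A M F" using Fc by (auto simp: torsion_by_def)
    fix x assume "x \<in> torsion_by A M F"
    hence x: "x \<in> carrier M" "\<And>f. f \<in> F \<Longrightarrow> \<exists>t :: nat. (f [^] t) \<odot>\<^bsub>M\<^esub> x = \<zero>\<^bsub>M\<^esub>"
      by (auto simp: torsion_by_def)
    show "a \<odot>\<^bsub>M\<^esub> x \<in> torsion_by A M F" if a: "a \<in> carrier A" for a
    proof -
      have "\<exists>t :: nat. (f [^] t) \<odot>\<^bsub>M\<^esub> (a \<odot>\<^bsub>M\<^esub> x) = \<zero>\<^bsub>M\<^esub>" if f: "f \<in> F" for f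
      proof -
        obtain t :: nat where t: "(f [^] t) \<odot>\<^bsub>M\<^esub> x = \<zero>\<^bsub>M\<^esub>" using x f by blast
        have "(f [^] t) \<odot>\<^bsub>M\<^esub> (a \<odot>\<^bsub>M\<^esub> x) = a \<odot>\<^bsub>M\<^esub> ((f [^] t) \<odot>\<^bsub>M\<^esub> x)"
          using a x Fc[OF f] by (simp add: M.smult_assoc1[symmetric] m_comm)
        thus ?thesis using t a by auto
      qed
      thus ?thesis using a x by (auto simp: torsion_by_def)
    qed
    show "homog_comp M x d \<in> torsion_by A M F" for d
    proof -
      have "\<exists>t :: nat. (f [^] t) \<odot>\<^bsub>M\<^esub> homog_comp M x d = \<zero>\<^bsub>M\<^esub>" if f: "f \<in> F" for f
      proof -
        obtain t :: nat where t: "(f [^] t) \<odot>\<^bsub>M\<^esub> x = \<zero>\<^bsub>M\<^esub>" using x f by blast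
        obtain e where e: "f \<in> ring_part A e" using F f unfolding homogeneous_elems_def by blast
        have "homog_comp M ((f [^] t) \<odot>\<^bsub>M\<^esub> x) (d + int t * e) = (f [^] t) \<odot>\<^bsub>M\<^esub> homog_comp M x d"
        proof (rule homog_comp_map[OF M M])
          show "(f [^] t) \<odot>\<^bsub>M\<^esub> y \<in> mod_part M (d + int t * e)" if "y \<in> mod_part M d" for y d
            using M.part_smult[OF ring_part_pow[OF e] that] by (simp add: add.commute)
        qed (use x Fc[OF f] in \<open>auto simp: M.smult_r_distr\<close>)
        thus ?thesis using t M.homog_comp_homog[of "\<zero>\<^bsub>M\<^esub>"] by (intro exI[of _ t]) simp
      qed
      thus ?thesis using x by (auto simp: torsion_by_def)
    qed
    fix y assume "y \<in> torsion_by A M F"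
    hence y: "y \<in> carrier M" "\<And>f. f \<in> F \<Longrightarrow> \<exists>t :: nat. (f [^] t) \<odot>\<^bsub>M\<^esub> y = \<zero>\<^bsub>M\<^esub>"
      by (auto simp: torsion_by_def)
    have "\<exists>t :: nat. (f [^] t) \<odot>\<^bsub>M\<^esub> (x \<oplus>\<^bsub>M\<^esub> y) = \<zero>\<^bsub>M\<^esub>" if f: "f \<in> F" for f
    proof -
      obtain t u :: nat where t: "(f [^] t) \<odot>\<^bsub>M\<^esub> x = \<zero>\<^bsub>M\<^esub>" and u: "(f [^] u) \<odot>\<^bsub>M\<^esub> y = \<zero>\<^bsub>M\<^esub>"
        using x y f by metis
      show ?thesis
        using M.pow_smult_mono[OF Fc[OF f] x(1) t, of "max t u"]
          M.pow_smult_mono[OF Fc[OF f] y(1) u, of "max t u"] x y Fc[OF f]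
        by (intro exI[of _ "max t u"]) (simp add: M.smult_r_distr)
    qed
    thus "x \<oplus>\<^bsub>M\<^esub> y \<in> torsion_by A M F" using x y by (auto simp: torsion_by_def)
  qed
qed

text \<open>In the localisation at \<open>g\<close>, the element \<open>y\<close> represents
  \<open>x / g^s\<close>. It comes from \<open>graded_injective_divide\<close> with the divisor
  \<open>g^s\<close>; the error is killed by \<open>g^(s m)\<close>, and the annihilator condition
  there keeps \<open>y\<close> in the \<open>F\<close>-torsion.\<close>

lemma (in noetherian_gring) divide_homog_mod_torsion:
  fixes J :: "('a, 'm) gmodule"
  assumes J: "graded_injective A J" and x: "x \<in> torsion_by A J F" "x \<in> mod_part J e"
    and F: "F \<subseteq> homogeneous_elems A" and g: "g \<in> ring_part A \<delta>"
  shows "\<exists>y\<in>torsion_by A J F \<inter> mod_part J (e - int s * \<delta>).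
    x \<ominus>\<^bsub>J\<^esub> (g [^] s) \<odot>\<^bsub>J\<^esub> y \<in> torsion_by A J {g}"
proof -
  have gJ: "graded_module A J" using J unfolding graded_injective_def by blast
  interpret J: gmod A J using gJ by (simp add: gmod_iff)
  have gc: "g \<in> carrier A" using g ring_part_closed by blast
  have Fc: "f \<in> carrier A" if "f \<in> F" for f
    using F that ring_part_closed unfolding homogeneous_elems_def by blast
  have xc: "x \<in> carrier J" using x J.part_closed by blast
  obtain m y where y: "y \<in> mod_part J (e - int s * \<delta>)"
      "((g [^] s) [^] Suc m) \<odot>\<^bsub>J\<^esub> y = ((g [^] s) [^] (m :: nat)) \<odot>\<^bsub>J\<^esub> x"
      "\<And>a. a \<in> carrier A \<Longrightarrow> a \<odot>\<^bsub>J\<^esub> x = \<zero>\<^bsub>J\<^esub> \<Longrightarrow> a \<odot>\<^bsub>J\<^esub> y = \<zero>\<^bsub>J\<^esub>"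
    using graded_injective_divide[OF J x(2) ring_part_pow[OF g]] by blast
  have yc: "y \<in> carrier J" using y J.part_closed by blast
  have "(g [^] (s * m)) \<odot>\<^bsub>J\<^esub> (x \<ominus>\<^bsub>J\<^esub> (g [^] s) \<odot>\<^bsub>J\<^esub> y) = \<zero>\<^bsub>J\<^esub>"
  proof -
    have "(g [^] s) [^] m \<odot>\<^bsub>J\<^esub> ((g [^] s) \<odot>\<^bsub>J\<^esub> y) = ((g [^] s) [^] m) \<odot>\<^bsub>J\<^esub> x"
      using y(2) gc yc by (simp add: J.smult_assoc1)
    hence "(g [^] s) [^] m \<odot>\<^bsub>J\<^esub> (x \<ominus>\<^bsub>J\<^esub> (g [^] s) \<odot>\<^bsub>J\<^esub> y) = \<zero>\<^bsub>J\<^esub>"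
      using xc yc gc by (simp add: a_minus_def J.smult_r_distr J.smult_r_minus J.M.r_neg)
    thus ?thesis using gc by (simp add: nat_pow_pow)
  qed
  hence "x \<ominus>\<^bsub>J\<^esub> (g [^] s) \<odot>\<^bsub>J\<^esub> y \<in> torsion_by A J {g}"
    using xc yc gc by (auto simp: torsion_by_def)
  moreover have "y \<in> torsion_by A J F" 
  proof -
    have "\<exists>t :: nat. (f [^] t) \<odot>\<^bsub>J\<^esub> y = \<zero>\<^bsub>J\<^esub>" if f: "f \<in> F" for f
    proof -
      obtain t :: nat where "(f [^] t) \<odot>\<^bsub>J\<^esub> x = \<zero>\<^bsub>J\<^esub>" using x(1) f unfolding torsion_by_def by blast
      thus ?thesis using y(3) Fc[OF f] by blast
    qed
    thus ?thesis using yc by (auto simp: torsion_by_def)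
  qed
  ultimately show ?thesis using y(1) by blast
qed

text \<open>Being divisible in this sense is preserved by sums, since both torsion sets are
  submodules, so the homogeneous components can be treated separately.\<close>

lemma (in noetherian_gring) divide_mod_torsion:
  fixes J :: "('a, 'm) gmodule"
  assumes J: "graded_injective A J" and x: "x \<in> torsion_by A J F"
    and F: "F \<subseteq> homogeneous_elems A" and g: "g \<in> homogeneous_elems A"
  shows "\<exists>y\<in>torsion_by A J F. x \<ominus>\<^bsub>J\<^esub> (g [^] (s :: nat)) \<odot>\<^bsub>J\<^esub> y \<in> torsion_by A J {g}"
proof -
  have gJ: "graded_module A J" using J unfolding graded_injective_def by blast
  interpret J: gmod A J using gJ by (simp add: gmod_iff)
  obtain \<delta> where \<delta>: "g \<in> ring_part A \<delta>" using g unfolding homogeneous_elems_def by blast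
  have gc: "g \<in> carrier A" using \<delta> ring_part_closed by blast
  have tF: "graded_submodule A J (torsion_by A J F)" by (rule torsion_by_graded_submodule[OF gJ F])
  have tg: "graded_submodule A J (torsion_by A J {g})"
    by (rule torsion_by_graded_submodule[OF gJ]) (use g in auto)
  have Fc: "y \<in> carrier J" if "y \<in> torsion_by A J F" for y using that by (auto simp: torsion_by_def)
  have xc: "x \<in> carrier J" by (rule Fc[OF x])
  show ?thesis
  proof (rule J.homog_induct[OF xc])
    show "\<exists>y\<in>torsion_by A J F. homog_comp J x d \<ominus>\<^bsub>J\<^esub> (g [^] s) \<odot>\<^bsub>J\<^esub> y \<in> torsion_by A J {g}" for d
    proof -
      have "homog_comp J x d \<in> torsion_by A J F" using tF x unfolding graded_submodule_def by blast
      from divide_homog_mod_torsion[OF J this J.homog_comp_part[OF xc] F \<delta>] show ?thesis by blast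
    qed
    have "\<zero>\<^bsub>J\<^esub> \<ominus>\<^bsub>J\<^esub> (g [^] s) \<odot>\<^bsub>J\<^esub> \<zero>\<^bsub>J\<^esub> = \<zero>\<^bsub>J\<^esub>" using gc by (simp add: a_minus_def)
    thus "\<exists>y\<in>torsion_by A J F. \<zero>\<^bsub>J\<^esub> \<ominus>\<^bsub>J\<^esub> (g [^] s) \<odot>\<^bsub>J\<^esub> y \<in> torsion_by A J {g}"
      using tF tg unfolding graded_submodule_def by metis
    fix u v assume uv: "u \<in> carrier J" "v \<in> carrier J"
    assume "\<exists>y\<in>torsion_by A J F. u \<ominus>\<^bsub>J\<^esub> (g [^] s) \<odot>\<^bsub>J\<^esub> y \<in> torsion_by A J {g}"
    then obtain y where y: "y \<in> torsion_by A J F" "u \<ominus>\<^bsub>J\<^esub> (g [^] s) \<odot>\<^bsub>J\<^esub> y \<in> torsion_by A J {g}" by blast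
    assume "\<exists>y\<in>torsion_by A J F. v \<ominus>\<^bsub>J\<^esub> (g [^] s) \<odot>\<^bsub>J\<^esub> y \<in> torsion_by A J {g}"
    then obtain z where z: "z \<in> torsion_by A J F" "v \<ominus>\<^bsub>J\<^esub> (g [^] s) \<odot>\<^bsub>J\<^esub> z \<in> torsion_by A J {g}" by blast
    have "u \<oplus>\<^bsub>J\<^esub> v \<ominus>\<^bsub>J\<^esub> (g [^] s) \<odot>\<^bsub>J\<^esub> (y \<oplus>\<^bsub>J\<^esub> z) =
        (u \<ominus>\<^bsub>J\<^esub> (g [^] s) \<odot>\<^bsub>J\<^esub> y) \<oplus>\<^bsub>J\<^esub> (v \<ominus>\<^bsub>J\<^esub> (g [^] s) \<odot>\<^bsub>J\<^esub> z)"
      using uv Fc[OF y(1)] Fc[OF z(1)] gc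
      by (simp add: a_minus_def J.smult_r_distr J.M.minus_add J.M.a_ac)
    moreover have "\<dots> \<in> torsion_by A J {g}" using y(2) z(2) tg unfolding graded_submodule_def by blast
    moreover have "y \<oplus>\<^bsub>J\<^esub> z \<in> torsion_by A J F" using y(1) z(1) tF unfolding graded_submodule_def by blast
    ultimately show "\<exists>y\<in>torsion_by A J F. u \<oplus>\<^bsub>J\<^esub> v \<ominus>\<^bsub>J\<^esub> (g [^] s) \<odot>\<^bsub>J\<^esub> y \<in> torsion_by A J {g}"
      by metis
  qed
qed

section \<open>Torsion subcomplexes of a graded injective resolution\<close>

lemma (in abelian_group) minus_add_cancel_middle:
  assumes "x \<in> carrier G" "u \<in> carrier G" "u' \<in> carrier G" "c \<in> carrier G"
  shows "x \<ominus> (u' \<oplus> c) = (x \<ominus> (u \<oplus> c)) \<oplus> (u \<ominus> u')"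
proof -
  have "(x \<ominus> (u \<oplus> c)) \<oplus> (u \<ominus> u') = (x \<oplus> (\<ominus> u' \<oplus> \<ominus> c)) \<oplus> (\<ominus> u \<oplus> u)"
    using assms by (simp add: a_minus_def minus_add a_ac)
  thus ?thesis using assms by (simp add: a_minus_def minus_add l_neg)
qed

lemma (in abelian_group) uminus_add_cancel_middle:
  assumes "x \<in> carrier G" "u \<in> carrier G" "y \<in> carrier G" "c \<in> carrier G"
  shows "\<ominus> (u \<oplus> x) \<oplus> y \<oplus> (x \<ominus> c) = y \<ominus> (u \<oplus> c)"
proof -
  have "\<ominus> (u \<oplus> x) \<oplus> y \<oplus> (x \<ominus> c) = (y \<oplus> (\<ominus> u \<oplus> \<ominus> c)) \<oplus> (\<ominus> x \<oplus> x)"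
    using assms by (simp add: a_minus_def minus_add a_ac)
  thus ?thesis using assms by (simp add: a_minus_def minus_add l_neg)
qed

lemma (in abelian_group) add_minus_add_left_cancel:
  assumes "x \<in> carrier G" "u \<in> carrier G" "y \<in> carrier G"
  shows "(u \<oplus> x) \<ominus> (u \<oplus> y) = x \<ominus> y"
proof -
  have "(u \<oplus> x) \<ominus> (u \<oplus> y) = (x \<oplus> \<ominus> y) \<oplus> (\<ominus> u \<oplus> u)"
    using assms by (simp add: a_minus_def minus_add a_ac)
  thus ?thesis using assms by (simp add: a_minus_def l_neg)
qed

locale graded_resolution = noetherian_gring A for A :: "('a, 'x) gring_scheme" (structure) +
  fixes J :: "nat \<Rightarrow> ('a, 'm) gmodule" and d :: "nat \<Rightarrow> 'm \<Rightarrow> 'm" and \<eta> :: "'a \<Rightarrow> 'm"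
  assumes resolution: "graded_injective_resolution A (self_gmodule A) \<eta> J d"
begin

lemma injective: "graded_injective A (J j)"
  using resolution unfolding graded_injective_resolution_def by blast

lemma graded_J: "graded_module A (J j)"
  using injective unfolding graded_injective_def by blast

sublocale J: gmod A "J j" for j
  using graded_J by (simp add: gmod_iff)

lemma d_hom: "d j \<in> graded_hom A (J j) (J (Suc j))"
  using resolution unfolding graded_injective_resolution_def by blast

lemma d_closed [simp]: "x \<in> carrier (J j) \<Longrightarrow> d j x \<in> carrier (J (Suc j))"
  and d_add: "x \<in> carrier (J j) \<Longrightarrow> y \<in> carrier (J j) \<Longrightarrow> d j (x \<oplus>\<^bsub>J j\<^esub> y) = d j x \<oplus>\<^bsub>J (Suc j)\<^esub> d j y"
  and d_smult: "a \<in> carrier A \<Longrightarrow> x \<in> carrier (J j) \<Longrightarrow> d j (a \<odot>\<^bsub>J j\<^esub> x) = a \<odot>\<^bsub>J (Suc j)\<^esub> d j x"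
  and d_part: "x \<in> mod_part (J j) e \<Longrightarrow> d j x \<in> mod_part (J (Suc j)) e"
  using d_hom[of j] unfolding graded_hom_def by (blast, blast, blast, blast)

lemma d_exact: "d j ` carrier (J j) = {x \<in> carrier (J (Suc j)). d (Suc j) x = \<zero>\<^bsub>J (Suc (Suc j))\<^esub>}"
  using resolution unfolding graded_injective_resolution_def by blast

lemma d_d: "x \<in> carrier (J j) \<Longrightarrow> d (Suc j) (d j x) = \<zero>\<^bsub>J (Suc (Suc j))\<^esub>"
  using d_exact by blast

lemma d_zero [simp]: "d j \<zero>\<^bsub>J j\<^esub> = \<zero>\<^bsub>J (Suc j)\<^esub>"
  by (rule additive_zero) (auto simp: d_add J.M.abelian_group_axioms)

lemma d_minus: "x \<in> carrier (J j) \<Longrightarrow> y \<in> carrier (J j) \<Longrightarrow> d j (x \<ominus>\<^bsub>J j\<^esub> y) = d j x \<ominus>\<^bsub>J (Suc j)\<^esub> d j y"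
  using additive_minus[of "J j" "J (Suc j)" "d j" y]
  by (simp add: a_minus_def d_add J.M.abelian_group_axioms)

lemma homog_comp_d: "x \<in> carrier (J j) \<Longrightarrow> homog_comp (J (Suc j)) (d j x) e = d j (homog_comp (J j) x e)"
  using homog_comp_map[OF graded_J graded_J, of "d j" j "Suc j" 0 x e] by (simp add: d_add d_part)

lemma d_torsion: "F \<subseteq> carrier A \<Longrightarrow> x \<in> torsion_by A (J j) F \<Longrightarrow> d j x \<in> torsion_by A (J (Suc j)) F"
proof -
  assume F: "F \<subseteq> carrier A" and x: "x \<in> torsion_by A (J j) F"
  have "\<exists>t :: nat. (f [^] t) \<odot>\<^bsub>J (Suc j)\<^esub> d j x = \<zero>\<^bsub>J (Suc j)\<^esub>" if f: "f \<in> F" for f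
  proof -
    obtain t :: nat where "(f [^] t) \<odot>\<^bsub>J j\<^esub> x = \<zero>\<^bsub>J j\<^esub>" using x f unfolding torsion_by_def by blast
    hence "(f [^] t) \<odot>\<^bsub>J (Suc j)\<^esub> d j x = \<zero>\<^bsub>J (Suc j)\<^esub>"
      using x f F d_smult[of "f [^] t" x j] by (auto simp: torsion_by_def)
    thus ?thesis ..
  qed
  thus "d j x \<in> torsion_by A (J (Suc j)) F" using x by (auto simp: torsion_by_def)
qed

text \<open>Coboundaries of the \<open>F\<close>-torsion subcomplex. In degree 0 they vanish, since
  the augmentation is not part of the complex; this is why the cohomology of \<open>J\<close> in
  degree 0 is a copy of the ring.\<close>

definition bd :: "'a set \<Rightarrow> nat \<Rightarrow> 'm set" where
  "bd F j = (case j of 0 \<Rightarrow> {\<zero>\<^bsub>J 0\<^esub>} | Suc i \<Rightarrow> d i ` torsion_by A (J i) F)"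

end

text \<open>Some proofs use this twice at once: for the conditions \<open>F\<close> already imposed,
  and for the singleton \<open>{g}\<close> measuring errors in the localisation.\<close>

locale torsion_resolution = graded_resolution +
  fixes F :: "'a set"
  assumes F: "F \<subseteq> homogeneous_elems A"
begin

lemma F_closed: "f \<in> F \<Longrightarrow> f \<in> carrier A"
  using F ring_part_closed unfolding homogeneous_elems_def by blast

lemma tors: "graded_submodule A (J j) (torsion_by A (J j) F)"
  by (rule torsion_by_graded_submodule[OF graded_J F])

lemma tors_closed: "x \<in> torsion_by A (J j) F \<Longrightarrow> x \<in> carrier (J j)"
  and tors_zero: "\<zero>\<^bsub>J j\<^esub> \<in> torsion_by A (J j) F"
  and tors_add: "x \<in> torsion_by A (J j) F \<Longrightarrow> y \<in> torsion_by A (J j) F \<Longrightarrow> x \<oplus>\<^bsub>J j\<^esub> y \<in> torsion_by A (J j) F"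
  and tors_smult: "a \<in> carrier A \<Longrightarrow> x \<in> torsion_by A (J j) F \<Longrightarrow> a \<odot>\<^bsub>J j\<^esub> x \<in> torsion_by A (J j) F"
  using tors[of j] unfolding graded_submodule_def by auto

lemma tors_minus: "x \<in> torsion_by A (J j) F \<Longrightarrow> y \<in> torsion_by A (J j) F \<Longrightarrow> x \<ominus>\<^bsub>J j\<^esub> y \<in> torsion_by A (J j) F"
  unfolding a_minus_def using J.graded_submodule_uminus[OF tors] tors_add by blast

lemma d_tors: "x \<in> torsion_by A (J j) F \<Longrightarrow> d j x \<in> torsion_by A (J (Suc j)) F"
  using d_torsion F_closed by blast

lemma bd_submodule: "graded_submodule A (J j) (bd F j)"
proof (cases j)
  case 0
  thus ?thesis using J.homog_comp_homog[OF J.part_zero] by (simp add: bd_def graded_submodule_def)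
next
  case (Suc i)
  have bd: "bd F (Suc i) = d i ` torsion_by A (J i) F" by (simp add: bd_def)
  show ?thesis
    unfolding Suc bd graded_submodule_def
  proof (intro conjI ballI allI)
    show "\<zero>\<^bsub>J (Suc i)\<^esub> \<in> d i ` torsion_by A (J i) F" using tors_zero[of i] d_zero[of i] by force
    fix x assume "x \<in> d i ` torsion_by A (J i) F"
    then obtain u where u: "u \<in> torsion_by A (J i) F" "x = d i u" by blast
    note uc = tors_closed[OF u(1)]
    show "a \<odot>\<^bsub>J (Suc i)\<^esub> x \<in> d i ` torsion_by A (J i) F" if "a \<in> carrier A" for a
      using u uc tors_smult that by (auto simp: d_smult[symmetric])
    show "homog_comp (J (Suc i)) x e \<in> d i ` torsion_by A (J i) F" for e
      using u uc tors[of i] by (auto simp: homog_comp_d graded_submodule_def)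
    fix y assume "y \<in> d i ` torsion_by A (J i) F"
    then obtain v where v: "v \<in> torsion_by A (J i) F" "y = d i v" by blast
    note vc = tors_closed[OF v(1)]
    show "x \<oplus>\<^bsub>J (Suc i)\<^esub> y \<in> d i ` torsion_by A (J i) F"
      using u v uc vc tors_add by (auto simp: d_add[symmetric])
  qed (use d_closed tors_closed in auto)
qed

lemma bd_tors: "u \<in> bd F j \<Longrightarrow> u \<in> torsion_by A (J j) F"
  using tors_zero d_tors by (auto simp: bd_def split: nat.splits)

lemma d_bd: "u \<in> bd F j \<Longrightarrow> d j u = \<zero>\<^bsub>J (Suc j)\<^esub>"
  using tors_closed d_d by (auto simp: bd_def split: nat.splits)

text \<open>A coboundary is divided by dividing its primitive: the differential commutes with
  scalars and preserves \<open>g\<close>-torsion. In degree 0 there is only zero to divide.\<close>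

lemma bd_divide:
  assumes u: "u \<in> bd F j" and g: "g \<in> homogeneous_elems A"
  shows "\<exists>u'\<in>bd F j. u \<ominus>\<^bsub>J j\<^esub> (g [^] (s :: nat)) \<odot>\<^bsub>J j\<^esub> u' \<in> torsion_by A (J j) {g}"
proof (cases j)
  case 0
  have gc: "g \<in> carrier A" using g ring_part_closed unfolding homogeneous_elems_def by blast
  have "\<zero>\<^bsub>J 0\<^esub> \<ominus>\<^bsub>J 0\<^esub> (g [^] s) \<odot>\<^bsub>J 0\<^esub> \<zero>\<^bsub>J 0\<^esub> \<in> torsion_by A (J 0) {g}"
  proof -
    have "\<zero>\<^bsub>J 0\<^esub> \<ominus>\<^bsub>J 0\<^esub> (g [^] s) \<odot>\<^bsub>J 0\<^esub> \<zero>\<^bsub>J 0\<^esub> = \<zero>\<^bsub>J 0\<^esub>"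
      using gc J.M.r_neg[of "\<zero>\<^bsub>J 0\<^esub>" 0] by (simp add: a_minus_def)
    thus ?thesis using gc by (simp add: torsion_by_def)
  qed
  thus ?thesis using u 0 by (simp add: bd_def)
next
  case (Suc i)
  have gc: "g \<in> carrier A" using g ring_part_closed unfolding homogeneous_elems_def by blast
  obtain w where w: "w \<in> torsion_by A (J i) F" "u = d i w" using u Suc by (auto simp: bd_def)
  obtain y where y: "y \<in> torsion_by A (J i) F" "w \<ominus>\<^bsub>J i\<^esub> (g [^] s) \<odot>\<^bsub>J i\<^esub> y \<in> torsion_by A (J i) {g}"
    using divide_mod_torsion[OF injective w(1) F g] by blast
  have "d i (w \<ominus>\<^bsub>J i\<^esub> (g [^] s) \<odot>\<^bsub>J i\<^esub> y) \<in> torsion_by A (J (Suc i)) {g}"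
    by (rule d_torsion[OF _ y(2)]) (use gc in auto)
  moreover have "d i (w \<ominus>\<^bsub>J i\<^esub> (g [^] s) \<odot>\<^bsub>J i\<^esub> y) = u \<ominus>\<^bsub>J j\<^esub> (g [^] s) \<odot>\<^bsub>J j\<^esub> d i y"
    using w y(1) gc tors_closed by (simp add: d_minus d_smult Suc)
  moreover have "d i y \<in> bd F j" using y(1) by (simp add: bd_def Suc)
  ultimately show ?thesis unfolding Suc by auto
qed

text \<open>This replaces the connecting homomorphism: the hypothesis says that \<open>x\<close> and \<open>c y\<close> define the
  same class in the localisation of the cohomology at \<open>g\<close>.\<close>

lemma divide_coboundary:
  assumes x: "x \<in> torsion_by A (J j) F" and y: "y \<in> torsion_by A (J j) F" and c: "c \<in> carrier A"
    and u: "u \<in> bd F j" and g: "g \<in> homogeneous_elems A"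
    and T: "(g [^] (s :: nat)) \<odot>\<^bsub>J j\<^esub> x \<ominus>\<^bsub>J j\<^esub> (u \<oplus>\<^bsub>J j\<^esub> (g [^] s) \<odot>\<^bsub>J j\<^esub> (c \<odot>\<^bsub>J j\<^esub> y)) \<in> torsion_by A (J j) {g}"
  shows "\<exists>q\<in>torsion_by A (J j) (insert g F). d j x = d j q \<oplus>\<^bsub>J (Suc j)\<^esub> c \<odot>\<^bsub>J (Suc j)\<^esub> d j y"
proof -
  have gc: "g \<in> carrier A" using g ring_part_closed unfolding homogeneous_elems_def by blast
  interpret g: torsion_resolution A J d \<eta> "{g}" by unfold_locales (use g in auto)
  obtain u' where u': "u' \<in> bd F j" "u \<ominus>\<^bsub>J j\<^esub> (g [^] s) \<odot>\<^bsub>J j\<^esub> u' \<in> torsion_by A (J j) {g}"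
    using bd_divide[OF u g] by blast
  note cl = tors_closed[OF x] tors_closed[OF y] tors_closed[OF bd_tors[OF u]] tors_closed[OF bd_tors[OF u'(1)]]
  \<comment> \<open>Here \<open>u'\<close> stands for \<open>u / g^s\<close>. Thus
    \<open>g^s q\<close> differs from the element in \<open>T\<close> only by
    \<open>g\<close>-torsion, which makes \<open>q\<close> itself \<open>g\<close>-torsion, and the
    coboundary \<open>u'\<close> disappears under \<open>d j\<close>.\<close>
  define q where "q = x \<ominus>\<^bsub>J j\<^esub> (u' \<oplus>\<^bsub>J j\<^esub> c \<odot>\<^bsub>J j\<^esub> y)"
  have qF: "q \<in> torsion_by A (J j) F"
    unfolding q_def using x y c bd_tors[OF u'(1)] by (intro tors_minus tors_add tors_smult)
  have "(g [^] s) \<odot>\<^bsub>J j\<^esub> q = (g [^] s) \<odot>\<^bsub>J j\<^esub> x \<ominus>\<^bsub>J j\<^esub>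
      ((g [^] s) \<odot>\<^bsub>J j\<^esub> u' \<oplus>\<^bsub>J j\<^esub> (g [^] s) \<odot>\<^bsub>J j\<^esub> (c \<odot>\<^bsub>J j\<^esub> y))"
    unfolding q_def a_minus_def using cl c gc by (simp add: J.smult_r_distr J.smult_r_minus)
  also have "\<dots> = ((g [^] s) \<odot>\<^bsub>J j\<^esub> x \<ominus>\<^bsub>J j\<^esub> (u \<oplus>\<^bsub>J j\<^esub> (g [^] s) \<odot>\<^bsub>J j\<^esub> (c \<odot>\<^bsub>J j\<^esub> y)))
      \<oplus>\<^bsub>J j\<^esub> (u \<ominus>\<^bsub>J j\<^esub> (g [^] s) \<odot>\<^bsub>J j\<^esub> u')"
    by (rule J.M.minus_add_cancel_middle) (use cl c gc in auto)
  also have "\<dots> \<in> torsion_by A (J j) {g}" by (rule g.tors_add[OF T u'(2)])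
  finally obtain t :: nat where t: "(g [^] t) \<odot>\<^bsub>J j\<^esub> ((g [^] s) \<odot>\<^bsub>J j\<^esub> q) = \<zero>\<^bsub>J j\<^esub>"
    by (auto simp: torsion_by_def)
  have "(g [^] (t + s)) \<odot>\<^bsub>J j\<^esub> q = \<zero>\<^bsub>J j\<^esub>"
    using t tors_closed[OF qF] gc by (simp add: nat_pow_mult[symmetric] J.smult_assoc1)
  hence qg: "q \<in> torsion_by A (J j) (insert g F)" using qF unfolding torsion_by_def by blast
  have "x = q \<oplus>\<^bsub>J j\<^esub> (u' \<oplus>\<^bsub>J j\<^esub> c \<odot>\<^bsub>J j\<^esub> y)"
    unfolding q_def using cl c by (simp add: a_minus_def J.M.a_assoc J.M.l_neg)
  hence "d j x = d j q \<oplus>\<^bsub>J (Suc j)\<^esub> (d j u' \<oplus>\<^bsub>J (Suc j)\<^esub> c \<odot>\<^bsub>J (Suc j)\<^esub> d j y)"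
    using cl c tors_closed[OF qF] by (simp add: d_add d_smult)
  hence "d j x = d j q \<oplus>\<^bsub>J (Suc j)\<^esub> c \<odot>\<^bsub>J (Suc j)\<^esub> d j y"
    using d_bd[OF u'(1)] cl c by simp
  thus ?thesis using qg by blast
qed

lemma bd_zero: "\<zero>\<^bsub>J j\<^esub> \<in> bd F j"
  and bd_add: "x \<in> bd F j \<Longrightarrow> y \<in> bd F j \<Longrightarrow> x \<oplus>\<^bsub>J j\<^esub> y \<in> bd F j"
  and bd_smult: "a \<in> carrier A \<Longrightarrow> x \<in> bd F j \<Longrightarrow> a \<odot>\<^bsub>J j\<^esub> x \<in> bd F j"
  using bd_submodule[of j] unfolding graded_submodule_def by auto

lemma bd_closed: "x \<in> bd F j \<Longrightarrow> x \<in> carrier (J j)"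
  using bd_tors tors_closed by blast

text \<open>Composing the one-step inclusions multiplies the coefficients and collects the
  coboundary errors. It allows a generator to be exchanged for one of larger index.\<close>

lemma chain_le:
  assumes z: "\<And>t. z t \<in> carrier (J j)" and "t \<le> t'"
    and step: "\<And>t. \<exists>b\<in>carrier A. \<exists>u\<in>bd F j. z t = u \<oplus>\<^bsub>J j\<^esub> b \<odot>\<^bsub>J j\<^esub> z (Suc t)"
  shows "\<exists>b\<in>carrier A. \<exists>u\<in>bd F j. z t = u \<oplus>\<^bsub>J j\<^esub> b \<odot>\<^bsub>J j\<^esub> z t'"
  using \<open>t \<le> t'\<close>
proof (induction rule: dec_induct)
  case base
  show ?case using bd_zero[of j] z by (intro bexI[of _ \<one>] bexI[of _ "\<zero>\<^bsub>J j\<^esub>"]) auto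
next
  case (step k)
  obtain b u where b: "b \<in> carrier A" "u \<in> bd F j" "z t = u \<oplus>\<^bsub>J j\<^esub> b \<odot>\<^bsub>J j\<^esub> z k" using step.IH by blast
  obtain c v where c: "c \<in> carrier A" "v \<in> bd F j" "z k = v \<oplus>\<^bsub>J j\<^esub> c \<odot>\<^bsub>J j\<^esub> z (Suc k)"
    using assms(3) by blast
  have "z t = (u \<oplus>\<^bsub>J j\<^esub> b \<odot>\<^bsub>J j\<^esub> v) \<oplus>\<^bsub>J j\<^esub> (b \<otimes> c) \<odot>\<^bsub>J j\<^esub> z (Suc k)"
    unfolding b(3) by (subst c(3))
      (use b c z bd_closed in \<open>simp add: J.smult_r_distr J.smult_assoc1 J.M.a_assoc\<close>)
  moreover have "u \<oplus>\<^bsub>J j\<^esub> b \<odot>\<^bsub>J j\<^esub> v \<in> bd F j" using b c bd_add bd_smult by blast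
  ultimately show ?case using b c by blast
qed

end

section \<open>Imposing one more torsion condition\<close>

context graded_resolution
begin

text \<open>Quasi-cyclicity of the \<open>j\<close>-th cohomology of the \<open>F\<close>-torsion
  subcomplex, stated for homogeneous cocycles \<open>z t\<close> representing the generators, with
  coboundaries \<open>u\<close> as errors.\<close>

definition generating_chain :: "'a set \<Rightarrow> nat \<Rightarrow> (nat \<Rightarrow> 'm) \<Rightarrow> (nat \<Rightarrow> int) \<Rightarrow> bool" where
  "generating_chain F j z e \<longleftrightarrow>
     (\<forall>t. z t \<in> torsion_by A (J j) F) \<and> (\<forall>t. z t \<in> mod_part (J j) (e t)) \<and>
     (\<forall>t. d j (z t) = \<zero>\<^bsub>J (Suc j)\<^esub>) \<and>
     (\<forall>t. \<exists>b\<in>carrier A. \<exists>u\<in>bd F j. z t = u \<oplus>\<^bsub>J j\<^esub> b \<odot>\<^bsub>J j\<^esub> z (Suc t)) \<and>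
     (\<forall>w\<in>torsion_by A (J j) F. d j w = \<zero>\<^bsub>J (Suc j)\<^esub> \<longrightarrow>
        (\<exists>t. \<exists>a\<in>carrier A. \<exists>u\<in>bd F j. w = u \<oplus>\<^bsub>J j\<^esub> a \<odot>\<^bsub>J j\<^esub> z t))"

definition exact_at :: "'a set \<Rightarrow> nat \<Rightarrow> bool" where
  "exact_at F j \<longleftrightarrow> (\<forall>w\<in>torsion_by A (J j) F. d j w = \<zero>\<^bsub>J (Suc j)\<^esub> \<longrightarrow> w \<in> bd F j)"

lemma torsion_by_empty [simp]: "torsion_by A (J j) {} = carrier (J j)"
  by (simp add: torsion_by_def)

lemma exact_at_empty: "exact_at {} (Suc j)"
  unfolding exact_at_def bd_def using d_exact by auto

lemma generating_chain_empty: "generating_chain {} 0 (\<lambda>t. \<eta> \<one>) (\<lambda>t. 0)"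
proof -
  have \<eta>: "\<eta> \<in> graded_hom A (self_gmodule A) (J 0)"
    "\<eta> ` carrier (self_gmodule A) = {x \<in> carrier (J 0). d 0 x = \<zero>\<^bsub>J 1\<^esub>}"
    using resolution unfolding graded_injective_resolution_def by blast+
  have 1: "\<eta> \<one> \<in> carrier (J 0)" "d 0 (\<eta> \<one>) = \<zero>\<^bsub>J (Suc 0)\<^esub>"
    using \<eta>(2) by (auto simp: self_gmodule_def)
  have 2: "\<eta> a = a \<odot>\<^bsub>J 0\<^esub> \<eta> \<one>" if a: "a \<in> carrier A" for a
  proof -
    have "\<forall>a\<in>carrier A. \<forall>b\<in>carrier A. \<eta> (a \<otimes> b) = a \<odot>\<^bsub>J 0\<^esub> \<eta> b"
      using \<eta>(1) unfolding graded_hom_def by (simp add: self_gmodule_def)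
    from this[rule_format, OF a one_closed] show ?thesis using a by simp
  qed
  have 3: "\<eta> \<one> \<in> mod_part (J 0) 0"
  proof -
    have "\<eta> ` ring_part A 0 \<subseteq> mod_part (J 0) 0"
      using \<eta>(1) unfolding graded_hom_def by (simp add: self_gmodule_def)
    thus ?thesis using one_part by blast
  qed
  have 4: "\<exists>a\<in>carrier A. w = a \<odot>\<^bsub>J 0\<^esub> \<eta> \<one>" if "w \<in> carrier (J 0)" "d 0 w = \<zero>\<^bsub>J (Suc 0)\<^esub>" for w
  proof -
    have "w \<in> \<eta> ` carrier A" using \<eta>(2) that by (simp add: self_gmodule_def)
    thus ?thesis using 2 by blast
  qed
  have 5: "\<exists>b\<in>carrier A. \<eta> \<one> = b \<odot>\<^bsub>J 0\<^esub> \<eta> \<one>" using 1 by (intro bexI[of _ \<one>]) auto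
  show ?thesis
    unfolding generating_chain_def bd_def using 1 3 4 5 by simp
qed

text \<open>In the long exact sequence the new cohomology in degree \<open>Suc j\<close> lies
  between the localised cohomology in degree \<open>j\<close> and the old cohomology in degree
  \<open>Suc j\<close>, both zero. In elements: if \<open>w = d j v\<close> is killed by
  \<open>g^m\<close>, then \<open>g^m v\<close> is a cocycle, hence a coboundary, and
  \<open>divide_coboundary\<close> replaces \<open>v\<close> by a \<open>g\<close>-torsion
  primitive.\<close>

lemma exact_at_insert:
  assumes F: "F \<subseteq> homogeneous_elems A" and g: "g \<in> homogeneous_elems A"
    and ex: "exact_at F j" "exact_at F (Suc j)"
  shows "exact_at (insert g F) (Suc j)"
  unfolding exact_at_def
proof (intro ballI impI)
  interpret F: torsion_resolution A J d \<eta> F by unfold_locales (rule F)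
  have gc: "g \<in> carrier A" using g ring_part_closed unfolding homogeneous_elems_def by blast
  fix w assume w: "w \<in> torsion_by A (J (Suc j)) (insert g F)" "d (Suc j) w = \<zero>\<^bsub>J (Suc (Suc j))\<^esub>"
  hence "w \<in> torsion_by A (J (Suc j)) F" by (simp add: torsion_by_def)
  with ex(2) w(2) obtain v where v: "v \<in> torsion_by A (J j) F" "w = d j v"
    unfolding exact_at_def bd_def by auto
  note vc = F.tors_closed[OF v(1)]
  obtain m :: nat where m: "(g [^] m) \<odot>\<^bsub>J (Suc j)\<^esub> w = \<zero>\<^bsub>J (Suc j)\<^esub>"
    using w(1) unfolding torsion_by_def by blast
  have u: "(g [^] m) \<odot>\<^bsub>J j\<^esub> v \<in> bd F j"
    using ex(1) F.tors_smult[OF _ v(1)] m v(2) vc gc unfolding exact_at_def by (simp add: d_smult)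
  \<comment> \<open>The term \<open>c y\<close> of \<open>divide_coboundary\<close> is switched off
    by taking both factors zero, and \<open>u\<close> is \<open>g^m v\<close> itself.\<close>
  have "(g [^] m) \<odot>\<^bsub>J j\<^esub> v \<ominus>\<^bsub>J j\<^esub> ((g [^] m) \<odot>\<^bsub>J j\<^esub> v \<oplus>\<^bsub>J j\<^esub> (g [^] m) \<odot>\<^bsub>J j\<^esub> (\<zero> \<odot>\<^bsub>J j\<^esub> \<zero>\<^bsub>J j\<^esub>)) = \<zero>\<^bsub>J j\<^esub>"
    using vc gc by (simp add: a_minus_def J.M.r_neg)
  also have "\<dots> \<in> torsion_by A (J j) {g}" using gc by (auto simp: torsion_by_def)
  finally obtain q where q: "q \<in> torsion_by A (J j) (insert g F)"
      "d j v = d j q \<oplus>\<^bsub>J (Suc j)\<^esub> \<zero> \<odot>\<^bsub>J (Suc j)\<^esub> d j \<zero>\<^bsub>J j\<^esub>"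
    using F.divide_coboundary[OF v(1) F.tors_zero zero_closed u g] by blast
  have "q \<in> carrier (J j)" using q(1) by (simp add: torsion_by_def)
  thus "w \<in> bd (insert g F) (Suc j)" using q v(2) by (auto simp: bd_def)
qed

text \<open>Since the old cohomology vanishes in degree \<open>Suc j\<close>, the connecting map is
  onto the new one. The new generators are the images \<open>d j (v t)\<close> of the fractions
  \<open>z t / g^t\<close>, represented by \<open>v t\<close>.\<close>

lemma generating_chain_insert:
  assumes F: "F \<subseteq> homogeneous_elems A" and g: "g \<in> homogeneous_elems A"
    and ex: "exact_at F (Suc j)" and gen: "generating_chain F j z e"
  shows "\<exists>z' e'. generating_chain (insert g F) (Suc j) z' e'"
proof -
  interpret F: torsion_resolution A J d \<eta> F by unfold_locales (rule F)
  interpret g: torsion_resolution A J d \<eta> "{g}" by unfold_locales (use g in auto)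
  obtain \<delta> where \<delta>: "g \<in> ring_part A \<delta>" using g unfolding homogeneous_elems_def by blast
  have gc: "g \<in> carrier A" using \<delta> ring_part_closed by blast
  have z: "\<And>t. z t \<in> torsion_by A (J j) F" "\<And>t. z t \<in> mod_part (J j) (e t)"
    "\<And>t. d j (z t) = \<zero>\<^bsub>J (Suc j)\<^esub>"
    "\<And>t. \<exists>b\<in>carrier A. \<exists>u\<in>bd F j. z t = u \<oplus>\<^bsub>J j\<^esub> b \<odot>\<^bsub>J j\<^esub> z (Suc t)"
    "\<And>w. w \<in> torsion_by A (J j) F \<Longrightarrow> d j w = \<zero>\<^bsub>J (Suc j)\<^esub> \<Longrightarrow>
        \<exists>t. \<exists>a\<in>carrier A. \<exists>u\<in>bd F j. w = u \<oplus>\<^bsub>J j\<^esub> a \<odot>\<^bsub>J j\<^esub> z t"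
    using gen unfolding generating_chain_def by blast+
  have zc: "z t \<in> carrier (J j)" for t using F.tors_closed[OF z(1)] .
  have "\<forall>t. \<exists>y. y \<in> torsion_by A (J j) F \<and> y \<in> mod_part (J j) (e t - int t * \<delta>) \<and>
      z t \<ominus>\<^bsub>J j\<^esub> (g [^] t) \<odot>\<^bsub>J j\<^esub> y \<in> torsion_by A (J j) {g}"
    using divide_homog_mod_torsion[OF injective z(1,2) F \<delta>] by blast
  from choice[OF this] obtain v where v: "\<And>t. v t \<in> torsion_by A (J j) F"
      "\<And>t. v t \<in> mod_part (J j) (e t - int t * \<delta>)"
      "\<And>t. z t \<ominus>\<^bsub>J j\<^esub> (g [^] t) \<odot>\<^bsub>J j\<^esub> v t \<in> torsion_by A (J j) {g}"
    by blast
  have vc: "v t \<in> carrier (J j)" for t using F.tors_closed[OF v(1)] .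
  have "generating_chain (insert g F) (Suc j) (\<lambda>t. d j (v t)) (\<lambda>t. e t - int t * \<delta>)"
    unfolding generating_chain_def
  proof (intro conjI allI ballI impI)
    fix t
    show "d j (v t) \<in> mod_part (J (Suc j)) (e t - int t * \<delta>)" using d_part[OF v(2)] .
    show "d (Suc j) (d j (v t)) = \<zero>\<^bsub>J (Suc (Suc j))\<^esub>" using d_d[OF vc] .
    \<comment> \<open>As \<open>z t\<close> is a cocycle, the differential of this
      \<open>g\<close>-torsion element is \<open>- g^t d j (v t)\<close>; so
      \<open>d j (v t)\<close> is \<open>g\<close>-torsion although \<open>v t\<close> need not
      be.\<close>
    have "d j (z t \<ominus>\<^bsub>J j\<^esub> (g [^] t) \<odot>\<^bsub>J j\<^esub> v t) \<in> torsion_by A (J (Suc j)) {g}"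
      by (rule g.d_tors[OF v(3)])
    moreover have "d j (z t \<ominus>\<^bsub>J j\<^esub> (g [^] t) \<odot>\<^bsub>J j\<^esub> v t) = \<ominus>\<^bsub>J (Suc j)\<^esub> ((g [^] t) \<odot>\<^bsub>J (Suc j)\<^esub> d j (v t))"
      using zc vc gc z(3) by (simp add: d_minus d_smult) (simp add: a_minus_def)
    ultimately obtain p :: nat where
      "(g [^] p) \<odot>\<^bsub>J (Suc j)\<^esub> (\<ominus>\<^bsub>J (Suc j)\<^esub> ((g [^] t) \<odot>\<^bsub>J (Suc j)\<^esub> d j (v t))) = \<zero>\<^bsub>J (Suc j)\<^esub>"
      by (auto simp: torsion_by_def)
    hence "\<ominus>\<^bsub>J (Suc j)\<^esub> ((g [^] (p + t)) \<odot>\<^bsub>J (Suc j)\<^esub> d j (v t)) = \<zero>\<^bsub>J (Suc j)\<^esub>"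
      using vc gc by (simp add: J.smult_r_minus nat_pow_mult[symmetric] J.smult_assoc1)
    hence "(g [^] (p + t)) \<odot>\<^bsub>J (Suc j)\<^esub> d j (v t) = \<zero>\<^bsub>J (Suc j)\<^esub>"
      using vc[of t] gc by (simp add: J.M.add.inv_eq_1_iff)
    thus "d j (v t) \<in> torsion_by A (J (Suc j)) (insert g F)"
      using F.d_tors[OF v(1)[of t]] unfolding torsion_by_def by blast
    obtain b u where b: "b \<in> carrier A" "u \<in> bd F j" "z t = u \<oplus>\<^bsub>J j\<^esub> b \<odot>\<^bsub>J j\<^esub> z (Suc t)" using z(4) by blast
    let ?v = "(g [^] t) \<odot>\<^bsub>J j\<^esub> v t" and ?v' = "(g [^] Suc t) \<odot>\<^bsub>J j\<^esub> v (Suc t)"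
    \<comment> \<open>If \<open>z t\<close> is \<open>b z (Suc t)\<close> in cohomology, then
      \<open>z t / g^t\<close> is \<open>g b\<close> times \<open>z (Suc t) / g^(Suc t)\<close>;
      this explains the coefficient \<open>g \<otimes> b\<close>.\<close>
    have eq: "(g [^] t) \<odot>\<^bsub>J j\<^esub> ((g \<otimes> b) \<odot>\<^bsub>J j\<^esub> v (Suc t)) = b \<odot>\<^bsub>J j\<^esub> ?v'"
      using b vc gc by (simp add: J.smult_assoc1[symmetric] m_ac)
    have "\<ominus>\<^bsub>J j\<^esub> (z t \<ominus>\<^bsub>J j\<^esub> ?v) \<oplus>\<^bsub>J j\<^esub> b \<odot>\<^bsub>J j\<^esub> (z (Suc t) \<ominus>\<^bsub>J j\<^esub> ?v') =
        \<ominus>\<^bsub>J j\<^esub> z t \<oplus>\<^bsub>J j\<^esub> ?v \<oplus>\<^bsub>J j\<^esub> (b \<odot>\<^bsub>J j\<^esub> z (Suc t) \<ominus>\<^bsub>J j\<^esub> b \<odot>\<^bsub>J j\<^esub> ?v')"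
      using b(1) zc vc gc by (simp add: a_minus_def J.M.minus_add J.smult_r_distr J.smult_r_minus)
    also have "\<dots> = ?v \<ominus>\<^bsub>J j\<^esub> (u \<oplus>\<^bsub>J j\<^esub> b \<odot>\<^bsub>J j\<^esub> ?v')"
      unfolding b(3) by (rule J.M.uminus_add_cancel_middle) (use b zc vc gc F.bd_closed in auto)
    finally have "?v \<ominus>\<^bsub>J j\<^esub> (u \<oplus>\<^bsub>J j\<^esub> (g [^] t) \<odot>\<^bsub>J j\<^esub> ((g \<otimes> b) \<odot>\<^bsub>J j\<^esub> v (Suc t))) \<in> torsion_by A (J j) {g}"
      unfolding eq using g.tors_add[OF J.graded_submodule_uminus[OF g.tors v(3)] g.tors_smult[OF b(1) v(3)]]
      by metis
    from F.divide_coboundary[OF v(1) v(1) _ b(2) g this] b gc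
    obtain q where "q \<in> torsion_by A (J j) (insert g F)"
      "d j (v t) = d j q \<oplus>\<^bsub>J (Suc j)\<^esub> (g \<otimes> b) \<odot>\<^bsub>J (Suc j)\<^esub> d j (v (Suc t))" by auto
    thus "\<exists>b\<in>carrier A. \<exists>u\<in>bd (insert g F) (Suc j).
        d j (v t) = u \<oplus>\<^bsub>J (Suc j)\<^esub> b \<odot>\<^bsub>J (Suc j)\<^esub> d j (v (Suc t))"
      using b gc by (intro bexI[of _ "g \<otimes> b"] bexI[of _ "d j q"]) (auto simp: bd_def)
  next
    fix w assume w: "w \<in> torsion_by A (J (Suc j)) (insert g F)" "d (Suc j) w = \<zero>\<^bsub>J (Suc (Suc j))\<^esub>"
    hence "w \<in> torsion_by A (J (Suc j)) F" by (simp add: torsion_by_def)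
    with ex w(2) obtain x where x: "x \<in> torsion_by A (J j) F" "w = d j x"
      unfolding exact_at_def bd_def by auto
    note xc = F.tors_closed[OF x(1)]
    obtain m :: nat where m: "(g [^] m) \<odot>\<^bsub>J (Suc j)\<^esub> w = \<zero>\<^bsub>J (Suc j)\<^esub>"
      using w(1) unfolding torsion_by_def by blast
    have "(g [^] m) \<odot>\<^bsub>J j\<^esub> x \<in> torsion_by A (J j) F" "d j ((g [^] m) \<odot>\<^bsub>J j\<^esub> x) = \<zero>\<^bsub>J (Suc j)\<^esub>"
      using F.tors_smult[OF _ x(1)] m x(2) xc gc by (auto simp: d_smult)
    from z(5)[OF this] obtain t0 a0 u0 where a0: "a0 \<in> carrier A" "u0 \<in> bd F j"
        "(g [^] m) \<odot>\<^bsub>J j\<^esub> x = u0 \<oplus>\<^bsub>J j\<^esub> a0 \<odot>\<^bsub>J j\<^esub> z t0" by blast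
    \<comment> \<open>The index must reach the generator that produces the numerator and also be at
      least the exponent \<open>m\<close> of the denominator.\<close>
    define t where "t = max m t0"
    obtain b u1 where b: "b \<in> carrier A" "u1 \<in> bd F j" "z t0 = u1 \<oplus>\<^bsub>J j\<^esub> b \<odot>\<^bsub>J j\<^esub> z t"
      using F.chain_le[of z j t0 t, OF zc _ z(4)] unfolding t_def by auto
    define a u where "a = a0 \<otimes> b" and "u = u0 \<oplus>\<^bsub>J j\<^esub> a0 \<odot>\<^bsub>J j\<^esub> u1"
    have a: "a \<in> carrier A" and u: "u \<in> bd F j"
      using a0 b F.bd_add F.bd_smult by (auto simp: a_def u_def)
    note uc = F.bd_closed[OF u] F.bd_closed[OF a0(2)] F.bd_closed[OF b(2)]
    have gx: "(g [^] m) \<odot>\<^bsub>J j\<^esub> x = u \<oplus>\<^bsub>J j\<^esub> a \<odot>\<^bsub>J j\<^esub> z t"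
      unfolding a0(3) b(3) a_def u_def
      using a0(1) b(1) uc zc by (simp add: J.smult_r_distr J.smult_assoc1 J.M.a_assoc)
    \<comment> \<open>From \<open>a z t / g^m = a g^(t - m) (z t / g^t)\<close>, which makes sense
      because \<open>m \<le> t\<close>.\<close>
    let ?c = "a \<otimes> g [^] (t - m)"
    have "(g [^] m) \<otimes> ?c = a \<otimes> (g [^] m \<otimes> g [^] (t - m))" using a gc by (simp add: m_ac)
    also have "g [^] m \<otimes> g [^] (t - m) = g [^] t" using gc by (simp add: nat_pow_mult t_def)
    finally have eq: "(g [^] m) \<odot>\<^bsub>J j\<^esub> (?c \<odot>\<^bsub>J j\<^esub> v t) = a \<odot>\<^bsub>J j\<^esub> ((g [^] t) \<odot>\<^bsub>J j\<^esub> v t)"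
      using a gc vc by (metis J.smult_assoc1 nat_pow_closed m_closed)
    have "a \<odot>\<^bsub>J j\<^esub> (z t \<ominus>\<^bsub>J j\<^esub> (g [^] t) \<odot>\<^bsub>J j\<^esub> v t) =
        a \<odot>\<^bsub>J j\<^esub> z t \<ominus>\<^bsub>J j\<^esub> a \<odot>\<^bsub>J j\<^esub> ((g [^] t) \<odot>\<^bsub>J j\<^esub> v t)"
      using a zc vc gc by (simp add: a_minus_def J.smult_r_distr J.smult_r_minus)
    also have "\<dots> = (g [^] m) \<odot>\<^bsub>J j\<^esub> x \<ominus>\<^bsub>J j\<^esub> (u \<oplus>\<^bsub>J j\<^esub> a \<odot>\<^bsub>J j\<^esub> ((g [^] t) \<odot>\<^bsub>J j\<^esub> v t))"
      unfolding gx by (rule J.M.add_minus_add_left_cancel[symmetric]) (use a zc vc gc uc in auto)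
    finally have "(g [^] m) \<odot>\<^bsub>J j\<^esub> x \<ominus>\<^bsub>J j\<^esub> (u \<oplus>\<^bsub>J j\<^esub> (g [^] m) \<odot>\<^bsub>J j\<^esub> (?c \<odot>\<^bsub>J j\<^esub> v t)) \<in> torsion_by A (J j) {g}"
      unfolding eq using g.tors_smult[OF a v(3)[of t]] by metis
    from F.divide_coboundary[OF x(1) v(1) _ u g this] a gc
    obtain q where q: "q \<in> torsion_by A (J j) (insert g F)"
      "d j x = d j q \<oplus>\<^bsub>J (Suc j)\<^esub> ?c \<odot>\<^bsub>J (Suc j)\<^esub> d j (v t)" by auto
    thus "\<exists>t. \<exists>a\<in>carrier A. \<exists>u\<in>bd (insert g F) (Suc j). w = u \<oplus>\<^bsub>J (Suc j)\<^esub> a \<odot>\<^bsub>J (Suc j)\<^esub> d j (v t)"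
      using a gc x(2) by (intro exI[of _ t] bexI[of _ ?c] bexI[of _ "d j q"]) (auto simp: bd_def)
  qed
  thus ?thesis by blast
qed

text \<open>The two claims are proved together: producing the chain one degree higher uses exactness
  just above the current top degree. Each entry of the list raises the top degree by one.\<close>

lemma torsion_cohomology:
  assumes "set fs \<subseteq> homogeneous_elems A"
  shows "(\<forall>j>length fs. exact_at (set fs) j) \<and> (\<exists>z e. generating_chain (set fs) (length fs) z e)"
  using assms
proof (induction fs)
  case Nil
  have "exact_at {} j" if "j > 0" for j using exact_at_empty[of "j - 1"] that by simp
  thus ?case using generating_chain_empty by auto
next
  case (Cons g fs)
  hence g: "g \<in> homogeneous_elems A" and F: "set fs \<subseteq> homogeneous_elems A" by auto
  have ex: "\<And>j. j > length fs \<Longrightarrow> exact_at (set fs) j" using Cons.IH F by blast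
  have "exact_at (set (g # fs)) j" if j: "j > length (g # fs)" for j
  proof -
    obtain i where i: "j = Suc i" "i > length fs" using j by (cases j) auto
    \<comment> \<open>Exactness in degree \<open>Suc i\<close> after insertion needs it before in
      degrees \<open>i\<close> and \<open>Suc i\<close>, both above
      \<open>length fs\<close>.\<close>
    show ?thesis using exact_at_insert[OF F g ex[OF i(2)] ex] i by simp
  qed
  moreover have "\<exists>z e. generating_chain (set (g # fs)) (length (g # fs)) z e"
    using generating_chain_insert[OF F g ex] Cons.IH F by auto
  ultimately show ?case by blast
qed

end

section \<open>The coordinate ring of projective space\<close>

lemma mono_subseq_nat:
  fixes f :: "nat \<Rightarrow> nat"
  shows "\<exists>\<phi> :: nat \<Rightarrow> nat. strict_mono \<phi> \<and> mono (\<lambda>n. f (\<phi> n))"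
proof -
  obtain \<phi> where \<phi>: "strict_mono \<phi>" "monoseq (\<lambda>n. f (\<phi> n))" using seq_monosub by blast
  show ?thesis
  proof (cases "mono (\<lambda>n. f (\<phi> n))")
    case False
    hence dec: "f (\<phi> n) \<le> f (\<phi> m)" if "m \<le> n" for m n
      using \<phi>(2) that unfolding monoseq_def mono_def by blast
    \<comment> \<open>A decreasing sequence of natural numbers is constant from the point where it
      attains its minimum, and a constant sequence is monotone.\<close>
    define v where "v = (LEAST v. v \<in> range (\<lambda>n. f (\<phi> n)))"
    have "v \<in> range (\<lambda>n. f (\<phi> n))" unfolding v_def by (rule LeastI[of _ "f (\<phi> 0)"]) auto
    then obtain N where N: "f (\<phi> N) = v" by auto
    have "f (\<phi> (N + n)) = v" for n
      using dec[of N "N + n"] N Least_le[of "\<lambda>v. v \<in> range (\<lambda>n. f (\<phi> n))" "f (\<phi> (N + n))"]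
      unfolding v_def by auto
    moreover have "strict_mono (\<lambda>n. \<phi> (N + n))" using \<phi>(1) by (simp add: strict_mono_def)
    ultimately show ?thesis by (intro exI[of _ "\<lambda>n. \<phi> (N + n)"]) (simp add: mono_def)
  qed (use \<phi> in blast)
qed

text \<open>The coordinates are treated one at a time; monotonicity already achieved survives
  passing to a further subsequence.\<close>

lemma dickson_subseq:
  fixes f :: "nat \<Rightarrow> 'i \<Rightarrow> nat"
  assumes "finite S"
  shows "\<exists>\<phi> :: nat \<Rightarrow> nat. strict_mono \<phi> \<and> (\<forall>i\<in>S. mono (\<lambda>n. f (\<phi> n) i))"
  using assms
proof induction
  case empty
  show ?case by (intro exI[of _ id]) (simp add: strict_mono_def)
next
  case (insert i S)
  then obtain \<phi> :: "nat \<Rightarrow> nat" where \<phi>: "strict_mono \<phi>" "\<And>i. i \<in> S \<Longrightarrow> mono (\<lambda>n. f (\<phi> n) i)" by blast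
  obtain \<psi> :: "nat \<Rightarrow> nat" where \<psi>: "strict_mono \<psi>" "mono (\<lambda>n. f (\<phi> (\<psi> n)) i)"
    using mono_subseq_nat[of "\<lambda>n. f (\<phi> n) i"] by blast
  have "strict_mono (\<lambda>n. \<phi> (\<psi> n))" using \<phi>(1) \<psi>(1) by (simp add: strict_mono_def)
  moreover have "mono (\<lambda>n. f (\<phi> (\<psi> n)) j)" if "j \<in> S" for j
    using \<phi>(2)[OF that] strict_mono_mono[OF \<psi>(1)] unfolding mono_def by blast
  ultimately show ?case using \<psi>(2) by (intro exI[of _ "\<lambda>n. \<phi> (\<psi> n)"]) auto
qed

text \<open>Subtraction of exponents is truncated, so the equation expresses that \<open>m i\<close>
  divides \<open>m j\<close>. The first two terms of a subsequence monotone in every variable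
  provide such a pair.\<close>

lemma dickson_monomials:
  fixes m :: "nat \<Rightarrow> (nat \<Rightarrow>\<^sub>0 nat)"
  assumes "\<And>i. Poly_Mapping.keys (m i) \<subseteq> {0..n}"
  shows "\<exists>i j. i < j \<and> m j = m i + (m j - m i)"
proof -
  obtain \<phi> :: "nat \<Rightarrow> nat" where \<phi>: "strict_mono \<phi>"
      "\<And>k. k \<in> {0..n} \<Longrightarrow> mono (\<lambda>i. Poly_Mapping.lookup (m (\<phi> i)) k)"
    using dickson_subseq[of "{0..n}" "\<lambda>i. Poly_Mapping.lookup (m i)"] by auto
  have "Poly_Mapping.lookup (m (\<phi> 0)) k \<le> Poly_Mapping.lookup (m (\<phi> 1)) k" for k
  proof (cases "k \<in> {0..n}")
    case True
    thus ?thesis using \<phi>(2) by (auto simp: mono_def)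
  next
    case False
    hence "k \<notin> Poly_Mapping.keys (m (\<phi> 0))" using assms by blast
    thus ?thesis by (simp add: in_keys_iff)
  qed
  hence "m (\<phi> 1) = m (\<phi> 0) + (m (\<phi> 1) - m (\<phi> 0))"
    by (intro poly_mapping_eqI) (simp add: lookup_add lookup_minus)
  moreover have "\<phi> 0 < \<phi> 1" using \<phi>(1) by (simp add: strict_mono_def)
  ultimately show ?thesis by blast
qed

text \<open>The order is lexicographic: an exponent function below 0 would have a negative value at
  the first difference. It follows that a monomial is at most each of its multiples.\<close>

lemma poly_mapping_nat_nonneg: "(0 :: nat \<Rightarrow>\<^sub>0 nat) \<le> c"
proof -
  have "\<not> c < 0" by transfer (simp add: less_fun_def)
  thus ?thesis by simp
qed

text \<open>In an infinite descent some monomial would divide a later one and so not exceed it. The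
  bound on the variables matters: over infinitely many variables
  \<open>x\<^sub>0 > x\<^sub>1 > x\<^sub>2 > \<dots>\<close> descends forever in this order.\<close>

lemma wf_monomials:
  "wf {(a, b :: nat \<Rightarrow>\<^sub>0 nat). Poly_Mapping.keys a \<subseteq> {0..n} \<and> Poly_Mapping.keys b \<subseteq> {0..n} \<and> a < b}"
  unfolding wf_iff_no_infinite_down_chain
proof
  assume "\<exists>f. \<forall>i. (f (Suc i), f i) \<in>
    {(a, b :: nat \<Rightarrow>\<^sub>0 nat). Poly_Mapping.keys a \<subseteq> {0..n} \<and> Poly_Mapping.keys b \<subseteq> {0..n} \<and> a < b}"
  then obtain f :: "nat \<Rightarrow> (nat \<Rightarrow>\<^sub>0 nat)" where
    "\<forall>i. (f (Suc i), f i) \<in>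
    {(a, b :: nat \<Rightarrow>\<^sub>0 nat). Poly_Mapping.keys a \<subseteq> {0..n} \<and> Poly_Mapping.keys b \<subseteq> {0..n} \<and> a < b}" by blast
  hence f: "\<And>i. Poly_Mapping.keys (f i) \<subseteq> {0..n}" "\<And>i. f (Suc i) < f i" by auto
  obtain i j where ij: "i < j" "f j = f i + (f j - f i)" using dickson_monomials[of f n] f(1) by blast
  have "f j < f i" using ij(1)
    by (induction rule: less_Suc_induct) (use f(2) in \<open>auto intro: less_trans\<close>)
  moreover have "f i \<le> f i + (f j - f i)" using add_left_mono[OF poly_mapping_nat_nonneg] by fastforce
  ultimately show False using ij(2) by simp
qed

lemma lookup_single_mult:
  fixes p :: "'a :: cancel_comm_monoid_add \<Rightarrow>\<^sub>0 'b :: comm_semiring_0"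
  shows "Poly_Mapping.lookup (Poly_Mapping.single t c * p) (t + l) = c * Poly_Mapping.lookup p l"
  by (simp add: lookup_mult lookup_single when_mult)

section \<open>Grading and Noetherianity of the polynomial ring\<close>

definition monomial_degree :: "(nat \<Rightarrow>\<^sub>0 nat) \<Rightarrow> nat" where
  "monomial_degree m = (\<Sum>i\<in>Poly_Mapping.keys m. Poly_Mapping.lookup m i)"

lemma monomial_degree_add: "monomial_degree (a + b) = monomial_degree a + monomial_degree b"
  unfolding monomial_degree_def by (rule setsum_keys_plus_distrib) auto

definition degree_part :: "((nat \<Rightarrow>\<^sub>0 nat) \<Rightarrow>\<^sub>0 'k :: zero) \<Rightarrow> int \<Rightarrow> ((nat \<Rightarrow>\<^sub>0 nat) \<Rightarrow>\<^sub>0 'k)" where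
  "degree_part p e = Abs_poly_mapping (\<lambda>m. Poly_Mapping.lookup p m when int (monomial_degree m) = e)"

lemma lookup_degree_part:
  "Poly_Mapping.lookup (degree_part p e) m = (Poly_Mapping.lookup p m when int (monomial_degree m) = e)"
proof -
  have "finite {m. (Poly_Mapping.lookup p m when int (monomial_degree m) = e) \<noteq> 0}"
    by (rule finite_subset[OF _ finite_keys[of p]]) (auto simp: in_keys_iff when_def)
  thus ?thesis unfolding degree_part_def by simp
qed

context
  fixes n :: nat and A :: "((nat \<Rightarrow>\<^sub>0 nat) \<Rightarrow>\<^sub>0 'k :: field) gring"
  assumes A: "A = coordinate_ring n"
begin

lemma coordinate_ring_carrier:
  "p \<in> carrier A \<longleftrightarrow> (\<forall>m\<in>Poly_Mapping.keys p. Poly_Mapping.keys m \<subseteq> {0..n})"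
  by (simp add: A coordinate_ring_def)

lemma coordinate_ring_simps [simp]:
  "x \<otimes>\<^bsub>A\<^esub> y = x * y" "\<one>\<^bsub>A\<^esub> = 1" "\<zero>\<^bsub>A\<^esub> = 0" "x \<oplus>\<^bsub>A\<^esub> y = x + y"
  by (simp_all add: A coordinate_ring_def)

lemma coordinate_ring_part:
  "p \<in> ring_part A e \<longleftrightarrow> p \<in> carrier A \<and> (\<forall>m\<in>Poly_Mapping.keys p. int (monomial_degree m) = e)"
  by (simp add: A coordinate_ring_def monomial_degree_def)

lemma coordinate_ring_add_closed:
  assumes "p \<in> carrier A" "q \<in> carrier A"
  shows "p + q \<in> carrier A"
  using assms keys_add[of p q] unfolding coordinate_ring_carrier by blast

lemma coordinate_ring_mult_closed:
  assumes "p \<in> carrier A" "q \<in> carrier A"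
  shows "p * q \<in> carrier A"
  unfolding coordinate_ring_carrier
proof
  fix m assume "m \<in> Poly_Mapping.keys (p * q)"
  then obtain a b where ab: "m = a + b" "a \<in> Poly_Mapping.keys p" "b \<in> Poly_Mapping.keys q"
    using keys_mult[of p q] by blast
  thus "Poly_Mapping.keys m \<subseteq> {0..n}"
    using assms keys_add[of a b] unfolding coordinate_ring_carrier by blast
qed

lemma coordinate_ring_uminus_closed: "p \<in> carrier A \<Longrightarrow> - p \<in> carrier A"
  by (simp add: coordinate_ring_carrier in_keys_iff)

lemma coordinate_ring_zero_closed: "0 \<in> carrier A" and coordinate_ring_one_closed: "1 \<in> carrier A"
  by (simp_all add: coordinate_ring_carrier)

lemmas coordinate_ring_closed = coordinate_ring_add_closed coordinate_ring_mult_closed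
  coordinate_ring_uminus_closed coordinate_ring_zero_closed coordinate_ring_one_closed

lemma coordinate_ring_abelian_group: "abelian_group A"
proof (rule abelian_groupI)
  show "\<exists>y\<in>carrier A. y \<oplus>\<^bsub>A\<^esub> x = \<zero>\<^bsub>A\<^esub>" if "x \<in> carrier A" for x
    using that by (intro bexI[of _ "- x"]) (auto simp: coordinate_ring_closed)
qed (auto simp: coordinate_ring_closed add_ac)

lemma coordinate_ring_cring: "cring A"
  by (rule cringI[OF coordinate_ring_abelian_group comm_monoidI])
    (auto simp: coordinate_ring_closed algebra_simps)

lemma degree_part_part:
  assumes "p \<in> carrier A"
  shows "degree_part p e \<in> ring_part A e"
proof -
  have "Poly_Mapping.lookup p m \<noteq> 0 \<and> int (monomial_degree m) = e"
    if "m \<in> Poly_Mapping.keys (degree_part p e)" for m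
    using that by (auto simp: in_keys_iff lookup_degree_part when_def split: if_splits)
  thus ?thesis using assms by (auto simp: coordinate_ring_part coordinate_ring_carrier in_keys_iff)
qed

lemma coordinate_ring_graded: "graded_module A (self_gmodule A)"
proof -
  interpret A: cring A by (rule coordinate_ring_cring)
  let ?S = "self_gmodule A"
  have [simp]: "carrier ?S = carrier A" "\<And>e. mod_part ?S e = ring_part A e" "\<zero>\<^bsub>?S\<^esub> = 0"
    "\<And>x y. x \<oplus>\<^bsub>?S\<^esub> y = x + y" "\<And>x y. x \<odot>\<^bsub>?S\<^esub> y = x * y"
    by (auto simp: self_gmodule_def)
  have ag: "abelian_group ?S"
    by (rule abelian_groupI)
      (use A.l_neg A.a_inv_closed in \<open>auto simp: coordinate_ring_closed add_ac\<close>)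
  interpret S: module A ?S
    by (rule moduleI[OF coordinate_ring_cring ag]) (auto simp: coordinate_ring_closed algebra_simps)
  have fs: "finsum ?S f K = sum f K" if "finite K" "\<And>i. i \<in> K \<Longrightarrow> f i \<in> carrier A" for f :: "int \<Rightarrow> _" and K
    using that by (induction K) (auto simp: S.M.finsum_insert Pi_def)
  have fin: "finite {e. degree_part p e \<noteq> 0}" for p :: "(nat \<Rightarrow>\<^sub>0 nat) \<Rightarrow>\<^sub>0 'k"
  proof (rule finite_subset)
    show "{e. degree_part p e \<noteq> 0} \<subseteq> (\<lambda>m. int (monomial_degree m)) ` Poly_Mapping.keys p"
    proof
      fix e assume "e \<in> {e. degree_part p e \<noteq> 0}"
      then obtain m where "Poly_Mapping.lookup (degree_part p e) m \<noteq> 0"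
        by (metis (mono_tags) mem_Collect_eq lookup_zero poly_mapping_eqI)
      thus "e \<in> (\<lambda>m. int (monomial_degree m)) ` Poly_Mapping.keys p"
        by (auto simp: lookup_degree_part when_def in_keys_iff split: if_splits)
    qed
  qed simp
  have sum: "(\<Sum>e\<in>{e. degree_part p e \<noteq> 0}. degree_part p e) = p" for p :: "(nat \<Rightarrow>\<^sub>0 nat) \<Rightarrow>\<^sub>0 'k"
  proof (rule poly_mapping_eqI)
    fix m
    \<comment> \<open>The coefficient at \<open>m\<close> comes only from the summand of degree
      \<open>monomial_degree m\<close>. If that degree is missing from the index set, the
      coefficient has to vanish.\<close>
    have "Poly_Mapping.lookup p m = 0" if "degree_part p (int (monomial_degree m)) = 0"
      using arg_cong[OF that, of "\<lambda>q. Poly_Mapping.lookup q m"] by (simp add: lookup_degree_part)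
    thus "Poly_Mapping.lookup (\<Sum>e\<in>{e. degree_part p e \<noteq> 0}. degree_part p e) m = Poly_Mapping.lookup p m"
      using fin[of p] by (auto simp: lookup_sum lookup_degree_part when_def sum.delta)
  qed
  show ?thesis
  proof (rule graded_moduleI[OF S.module_axioms, where \<pi> = degree_part])
    show "subgroup (mod_part ?S e) (add_monoid ?S)" for e
    proof (rule S.M.add_subgroupI)
      show "\<ominus>\<^bsub>?S\<^esub> x \<in> mod_part ?S e" if x: "x \<in> mod_part ?S e" for x
      proof -
        have xc: "x \<in> carrier A" using x by (simp add: coordinate_ring_part)
        have "\<ominus>\<^bsub>?S\<^esub> x = - x" using xc coordinate_ring_uminus_closed by (intro S.M.minus_equality) auto
        thus ?thesis using x coordinate_ring_uminus_closed by (auto simp: coordinate_ring_part in_keys_iff)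
      qed
      show "x \<oplus>\<^bsub>?S\<^esub> y \<in> mod_part ?S e" if "x \<in> mod_part ?S e" "y \<in> mod_part ?S e" for x y
        using that keys_add[of x y] by (auto simp: coordinate_ring_part coordinate_ring_closed)
    qed (auto simp: coordinate_ring_part coordinate_ring_closed)
    show "a \<odot>\<^bsub>?S\<^esub> x \<in> mod_part ?S (d + e)" if "a \<in> ring_part A d" "x \<in> mod_part ?S e" for d e a x
    proof -
      have "int (monomial_degree m) = d + e" if m: "m \<in> Poly_Mapping.keys (a * x)" for m
      proof -
        obtain u v where "m = u + v" "u \<in> Poly_Mapping.keys a" "v \<in> Poly_Mapping.keys x"
          using keys_mult[of a x] m by blast
        thus ?thesis using \<open>a \<in> _\<close> \<open>x \<in> _\<close> by (simp add: monomial_degree_add coordinate_ring_part)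
      qed
      thus ?thesis using that by (auto simp: coordinate_ring_part coordinate_ring_closed)
    qed
    show "degree_part x d = (if d = e then x else \<zero>\<^bsub>?S\<^esub>)" if "x \<in> mod_part ?S e" for x d e
    proof (rule poly_mapping_eqI)
      fix m
      show "Poly_Mapping.lookup (degree_part x d) m = Poly_Mapping.lookup (if d = e then x else \<zero>\<^bsub>?S\<^esub>) m"
        using that by (cases "m \<in> Poly_Mapping.keys x")
          (auto simp: lookup_degree_part coordinate_ring_part when_def in_keys_iff)
    qed
    show "degree_part (x \<oplus>\<^bsub>?S\<^esub> y) d = degree_part x d \<oplus>\<^bsub>?S\<^esub> degree_part y d" for x y d
      by (rule poly_mapping_eqI) (simp add: lookup_degree_part lookup_add when_def)
    show "x = (\<Oplus>\<^bsub>?S\<^esub>d\<in>{d. degree_part x d \<noteq> \<zero>\<^bsub>?S\<^esub>}. degree_part x d)" if "x \<in> carrier ?S" for x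
      using sum[of x] degree_part_part that fin[of x] by (simp add: fs coordinate_ring_part)
  qed (use fin degree_part_part in auto)
qed

text \<open>In an ideal without finite generating set, successively choose \<open>p\<^sub>i\<close> outside the ideal generated
  by its predecessors with lexicographically least leading monomial.  By Dickson's lemma some
  leading monomial divides a later one, and cancelling it contradicts minimality.\<close>

lemma coordinate_ring_noetherian: "noetherian_ring A"
proof (rule ring.noetherian_ringI)
  interpret A: cring A by (rule coordinate_ring_cring)
  show "ring A" by (rule A.ring_axioms)
  define lm :: "((nat \<Rightarrow>\<^sub>0 nat) \<Rightarrow>\<^sub>0 'k) \<Rightarrow> (nat \<Rightarrow>\<^sub>0 nat)" where "lm p = Max (Poly_Mapping.keys p)" for p
  have lm_in: "lm p \<in> Poly_Mapping.keys p" if "p \<noteq> 0" for p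
    unfolding lm_def using that by (intro Max_in) (auto simp: poly_mapping_eq_iff fun_eq_iff in_keys_iff)
  have lm_ge: "m \<le> lm p" if "m \<in> Poly_Mapping.keys p" for p m
    unfolding lm_def using that by (intro Max_ge) auto
  fix I assume I: "ideal I A"
  have Ic: "I \<subseteq> carrier A" using ideal.Icarr[OF I] by blast
  show "\<exists>S\<subseteq>carrier A. finite S \<and> I = Idl\<^bsub>A\<^esub> S"
  proof (rule ccontr)
    assume no: "\<not> (\<exists>S\<subseteq>carrier A. finite S \<and> I = Idl\<^bsub>A\<^esub> S)"
    have "\<exists>p. p \<in> I \<and> p \<notin> Idl\<^bsub>A\<^esub> S \<and> (\<forall>q\<in>I. q \<notin> Idl\<^bsub>A\<^esub> S \<longrightarrow> \<not> lm q < lm p)"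
      if S: "finite S" "S \<subseteq> I" for S
    proof -
      have "Idl\<^bsub>A\<^esub> S \<subseteq> I" by (rule A.genideal_minimal[OF I S(2)])
      moreover have "I \<noteq> Idl\<^bsub>A\<^esub> S" using no S Ic by blast
      ultimately obtain p where p: "p \<in> I" "p \<notin> Idl\<^bsub>A\<^esub> S" by blast
      let ?Q = "lm ` (I - Idl\<^bsub>A\<^esub> S)"
      have z: "0 \<in> Idl\<^bsub>A\<^esub> S"
        using additive_subgroup.zero_closed[OF ideal.axioms(1)[OF A.genideal_ideal, of S]] S Ic by auto
      have keys: "Poly_Mapping.keys (lm q) \<subseteq> {0..n}" if "q \<in> I - Idl\<^bsub>A\<^esub> S" for q
        using lm_in[of q] that z Ic coordinate_ring_carrier[of q] by blast
      let ?R = "{(a, b). Poly_Mapping.keys a \<subseteq> {0..n} \<and> Poly_Mapping.keys b \<subseteq> {0..n} \<and> a < b}"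
      have "lm p \<in> ?Q" using p by blast
      then obtain m where m: "m \<in> ?Q" "\<And>b. (b, m) \<in> ?R \<Longrightarrow> b \<notin> ?Q"
        by (rule wfE_min[OF wf_monomials[of n]]) blast
      then obtain p' where p': "p' \<in> I - Idl\<^bsub>A\<^esub> S" "m = lm p'" by blast
      have "\<not> lm q < lm p'" if "q \<in> I" "q \<notin> Idl\<^bsub>A\<^esub> S" for q
        using m(2)[of "lm q"] keys[of q] keys[OF p'(1)] that p'(2) by blast
      thus ?thesis using p'(1) by blast
    qed
    hence "\<forall>S\<in>{S. finite S \<and> S \<subseteq> I}. \<exists>p. p \<in> I \<and> p \<notin> Idl\<^bsub>A\<^esub> S \<and>
        (\<forall>q\<in>I. q \<notin> Idl\<^bsub>A\<^esub> S \<longrightarrow> \<not> lm q < lm p)" by simp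
    from bchoice[OF this] obtain G where G0: "\<forall>S\<in>{S. finite S \<and> S \<subseteq> I}. G S \<in> I \<and> G S \<notin> Idl\<^bsub>A\<^esub> S \<and>
        (\<forall>q\<in>I. q \<notin> Idl\<^bsub>A\<^esub> S \<longrightarrow> \<not> lm q < lm (G S))" ..
    have G: "G S \<in> I" "G S \<notin> Idl\<^bsub>A\<^esub> S" "\<And>q. q \<in> I \<Longrightarrow> q \<notin> Idl\<^bsub>A\<^esub> S \<Longrightarrow> \<not> lm q < lm (G S)"
      if "finite S" "S \<subseteq> I" for S
      using bspec[OF G0, of S] that by simp_all
    define S where "S = rec_nat {} (\<lambda>_ T. insert (G T) T)"
    have S_simps: "S 0 = {}" "S (Suc i) = insert (G (S i)) (S i)" for i by (auto simp: S_def)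
    have S: "finite (S i)" "S i \<subseteq> I" for i
      by (induction i) (use G(1) in \<open>auto simp: S_simps\<close>)
    have S_mono: "S i \<subseteq> S j" if "i \<le> j" for i j
      using lift_Suc_mono_le[of S, OF _ that] by (auto simp: S_simps)
    have Si: "ideal (Idl\<^bsub>A\<^esub> (S i)) A" for i using A.genideal_ideal S(2) Ic by blast
    define p where "p i = G (S i)" for i
    have p: "p i \<in> I" "p i \<notin> Idl\<^bsub>A\<^esub> (S i)" "p i \<in> carrier A" "p i \<noteq> 0" for i
    proof -
      show "p i \<in> I" "p i \<notin> Idl\<^bsub>A\<^esub> (S i)" using G S by (auto simp: p_def)
      thus "p i \<in> carrier A" "p i \<noteq> 0"
        using Ic additive_subgroup.zero_closed[OF ideal.axioms(1)[OF Si[of i]]] by auto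
    qed
    have lmk: "Poly_Mapping.keys (lm (p i)) \<subseteq> {0..n}" for i
      using lm_in[OF p(4)] p(3)[of i] coordinate_ring_carrier by blast
    obtain i j where ij: "i < j" "lm (p j) = lm (p i) + (lm (p j) - lm (p i))"
      using dickson_monomials[of "\<lambda>i. lm (p i)" n, OF lmk] by blast
    define t where "t = lm (p j) - lm (p i)"
    have t: "lm (p j) = t + lm (p i)" using ij(2) by (simp add: t_def add.commute)
    \<comment> \<open>The quotient of the leading coefficients, so that \<open>h\<close> has the
      same leading term as \<open>p j\<close> and it cancels in \<open>p j - h\<close>.\<close>
    define c where "c = Poly_Mapping.lookup (p j) (lm (p j)) / Poly_Mapping.lookup (p i) (lm (p i))"
    define h where "h = Poly_Mapping.single t c * p i"
    have "Poly_Mapping.keys t \<subseteq> {0..n}"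
      using lmk[of j] unfolding t_def by (auto simp: in_keys_iff lookup_minus)
    hence single: "Poly_Mapping.single t c \<in> carrier A" by (simp add: coordinate_ring_carrier)
    have "p i \<in> S j" using S_mono[of "Suc i" j] ij(1) by (auto simp: S_simps p_def)
    hence "p i \<in> Idl\<^bsub>A\<^esub> (S j)" using A.genideal_self[of "S j"] S(2) Ic by blast
    hence h: "h \<in> Idl\<^bsub>A\<^esub> (S j)" using ideal.I_l_closed[OF Si _ single] by (simp add: h_def)
    have hI: "h \<in> I" using ideal.I_l_closed[OF I p(1) single] by (simp add: h_def)
    have neg1: "- 1 \<in> carrier A" by (simp add: coordinate_ring_closed)
    define q where "q = p j - h"
    have "- 1 * h \<in> I" using ideal.I_l_closed[OF I hI neg1] by simp
    hence "q \<in> I"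
      using additive_subgroup.a_closed[OF ideal.axioms(1)[OF I], of "p j" "- h"] p(1) by (simp add: q_def)
    \<comment> \<open>Otherwise \<open>p j = q + h\<close> would lie in the ideal generated by its
      predecessors, as \<open>h\<close> is a multiple of the predecessor \<open>p i\<close>.\<close>
    moreover have "q \<notin> Idl\<^bsub>A\<^esub> (S j)"
      using additive_subgroup.a_closed[OF ideal.axioms(1)[OF Si], of q j h] h p(2)[of j] by (auto simp: q_def)
    moreover have "lm q < lm (p j)"
    proof -
      have "q \<noteq> 0" using \<open>q \<notin> _\<close> additive_subgroup.zero_closed[OF ideal.axioms(1)[OF Si[of j]]] by auto
      hence lq: "lm q \<in> Poly_Mapping.keys q" by (rule lm_in)
      have "Poly_Mapping.keys q \<subseteq> Poly_Mapping.keys (p j) \<union> Poly_Mapping.keys h"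
        unfolding q_def by (auto simp: in_keys_iff lookup_minus)
      moreover have "m \<le> lm (p j)" if "m \<in> Poly_Mapping.keys h" for m
      proof -
        obtain b where "m = t + b" "b \<in> Poly_Mapping.keys (p i)"
          using keys_mult[of "Poly_Mapping.single t c" "p i"] \<open>m \<in> _\<close>
          unfolding h_def by (auto split: if_splits)
        thus ?thesis unfolding t using lm_ge by (simp add: add_left_mono)
      qed
      ultimately have "lm q \<le> lm (p j)" using lq lm_ge by blast
      moreover have "Poly_Mapping.lookup (p i) (lm (p i)) \<noteq> 0" using lm_in[OF p(4)] by (simp add: in_keys_iff)
      hence "Poly_Mapping.lookup q (lm (p j)) = 0"
        unfolding q_def h_def lookup_minus by (subst (2) t) (simp add: lookup_single_mult c_def)
      hence "lm q \<noteq> lm (p j)" using lq by (auto simp: in_keys_iff)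
      ultimately show ?thesis by simp
    qed
    ultimately show False using G(3)[OF S[of j]] by (simp add: p_def)
  qed
qed

lemma coordinate_ring_noetherian_gring: "noetherian_gring A"
proof -
  have "1 \<in> ring_part A 0" by (simp add: coordinate_ring_part coordinate_ring_closed monomial_degree_def)
  thus ?thesis
    using coordinate_ring_cring coordinate_ring_graded coordinate_ring_noetherian
    by (simp add: noetherian_gring_def gring_def gring_axioms_def)
qed

end

section \<open>Local cohomology of a set-theoretic complete intersection\<close>

text \<open>If a power of an ideal kills \<open>x\<close>, then every element of its radical has a
  power killing \<open>x\<close>. Conversely \<open>power_torsion\<close> recovers a killing ideal
  power from finitely many generators. Used for both ideals, this passes between them through the
  common radical.\<close>

lemma (in noetherian_gring) torsion_part_eq:
  fixes M :: "('a, 'm) gmodule"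
  assumes M: "module A M" and I: "ideal I A" and F: "F \<subseteq> carrier A" "finite F"
    and rad: "ideal_radical A I = ideal_radical A (Idl F)"
  shows "torsion_part A I M = gsub M (torsion_by A M F)"
proof -
  interpret M: module A M by fact
  have pow: "\<exists>t :: nat. (a [^] t) \<odot>\<^bsub>M\<^esub> x = \<zero>\<^bsub>M\<^esub>"
    if K: "ideal K A" "\<forall>b \<in> K [^]\<^bsub>ideals_set A\<^esub> (t :: nat). b \<odot>\<^bsub>M\<^esub> x = \<zero>\<^bsub>M\<^esub>"
      and a: "a \<in> ideal_radical A K" for K a x t
  proof -
    obtain m :: nat where m: "a \<in> carrier A" "a [^] m \<in> K" using a unfolding ideal_radical_def by blast
    have "(a [^] m) [^] t \<in> K [^]\<^bsub>ideals_set A\<^esub> t" by (rule elem_nat_pow_in[OF K(1) m(2)])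
    thus ?thesis using K(2) m(1) by (auto simp: nat_pow_pow)
  qed
  have "(\<exists>t :: nat. \<forall>a \<in> I [^]\<^bsub>ideals_set A\<^esub> t. a \<odot>\<^bsub>M\<^esub> x = \<zero>\<^bsub>M\<^esub>) \<longleftrightarrow>
      (\<forall>f\<in>F. \<exists>t :: nat. (f [^] t) \<odot>\<^bsub>M\<^esub> x = \<zero>\<^bsub>M\<^esub>)" if x: "x \<in> carrier M" for x
  proof
    assume "\<exists>t :: nat. \<forall>a \<in> I [^]\<^bsub>ideals_set A\<^esub> t. a \<odot>\<^bsub>M\<^esub> x = \<zero>\<^bsub>M\<^esub>"
    then obtain t :: nat where t: "\<forall>a \<in> I [^]\<^bsub>ideals_set A\<^esub> t. a \<odot>\<^bsub>M\<^esub> x = \<zero>\<^bsub>M\<^esub>" ..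
    show "\<forall>f\<in>F. \<exists>t :: nat. (f [^] t) \<odot>\<^bsub>M\<^esub> x = \<zero>\<^bsub>M\<^esub>"
    proof
      fix f assume f: "f \<in> F"
      have "f [^] (1 :: nat) \<in> Idl F" using f F(1) genideal_self[OF F(1)] by (simp add: subset_iff)
      hence "f \<in> ideal_radical A (Idl F)" using f F unfolding ideal_radical_def by blast
      thus "\<exists>t :: nat. (f [^] t) \<odot>\<^bsub>M\<^esub> x = \<zero>\<^bsub>M\<^esub>" using pow[OF I t] rad by simp
    qed
  next
    assume F_tors: "\<forall>f\<in>F. \<exists>t :: nat. (f [^] t) \<odot>\<^bsub>M\<^esub> x = \<zero>\<^bsub>M\<^esub>"
    obtain t :: nat where t: "\<forall>a \<in> (Idl F) [^]\<^bsub>ideals_set A\<^esub> t. a \<odot>\<^bsub>M\<^esub> x = \<zero>\<^bsub>M\<^esub>"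
      using power_torsion[OF noetherian_ring_axioms M x F(2,1)] F_tors by blast
    \<comment> \<open>The elements of \<open>F\<close> need not lie in \<open>I\<close>, only in its
      radical, so \<open>I\<close> needs finite generators of its own for
      \<open>power_torsion\<close>.\<close>
    obtain S where S: "S \<subseteq> carrier A" "finite S" "I = Idl S" using finetely_gen[OF I] by blast
    have "\<exists>t :: nat. (a [^] t) \<odot>\<^bsub>M\<^esub> x = \<zero>\<^bsub>M\<^esub>" if a: "a \<in> S" for a
    proof -
      have "a [^] (1 :: nat) \<in> I" using a S(1,3) genideal_self[OF S(1)] by (simp add: subset_iff)
      hence "a \<in> ideal_radical A I" using a S unfolding ideal_radical_def by blast
      thus ?thesis using pow[OF genideal_ideal[OF F(1)] t] rad by simp
    qed
    thus "\<exists>t :: nat. \<forall>a \<in> I [^]\<^bsub>ideals_set A\<^esub> t. a \<odot>\<^bsub>M\<^esub> x = \<zero>\<^bsub>M\<^esub>"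
      unfolding S(3) using power_torsion[OF noetherian_ring_axioms M x S(2,1)] by blast
  qed
  hence "{x \<in> carrier M. \<exists>t :: nat. \<forall>a \<in> I [^]\<^bsub>ideals_set A\<^esub> t. a \<odot>\<^bsub>M\<^esub> x = \<zero>\<^bsub>M\<^esub>} = torsion_by A M F"
    unfolding torsion_by_def by blast
  thus ?thesis unfolding torsion_part_def by simp
qed

text \<open>The cohomology module is a quotient of nested submodule records. Once their operations
  and components are reduced to those of \<open>J r\<close>, a generating chain is exactly the input
  of \<open>graded_quasi_cyclic_gquot\<close>.\<close>

lemma (in torsion_resolution) graded_quasi_cyclic_cohomology:
  assumes gen: "generating_chain F r z e"
  shows "graded_quasi_cyclic A (cohomology (\<lambda>j. gsub (J j) (torsion_by A (J j) F)) d r)"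
proof -
  define C where "C j = gsub (J j) (torsion_by A (J j) F)" for j
  define Z where "Z = cocycles C d r"
  have C [simp]: "carrier (C j) = torsion_by A (J j) F" "zero (C j) = zero (J j)" "add (C j) = add (J j)"
    "smult (C j) = smult (J j)" "mod_part (C j) e = torsion_by A (J j) F \<inter> mod_part (J j) e" for j e
    by (auto simp: C_def gsub_def)
  have gC: "graded_module A (C j)"
    and cC: "x \<in> torsion_by A (J j) F \<Longrightarrow> homog_comp (C j) x = homog_comp (J j) x" for j x
    unfolding C_def using graded_module_gsub[OF graded_J tors] by auto
  have Z: "Z = {x \<in> torsion_by A (J r) F. d r x = \<zero>\<^bsub>J (Suc r)\<^esub>}"
    by (simp add: Z_def cocycles_def)
  have Zs: "graded_submodule A (C r) Z"
    unfolding graded_submodule_def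
  proof (intro conjI ballI allI)
    show "Z \<subseteq> carrier (C r)" "\<zero>\<^bsub>C r\<^esub> \<in> Z" using tors_zero by (auto simp: Z)
    fix x assume x: "x \<in> Z"
    show "x \<oplus>\<^bsub>C r\<^esub> y \<in> Z" if "y \<in> Z" for y
      using that x tors_add by (auto simp: Z d_add tors_closed)
    show "a \<odot>\<^bsub>C r\<^esub> x \<in> Z" if "a \<in> carrier A" for a
      using that x tors_smult by (auto simp: Z d_smult tors_closed)
    show "homog_comp (C r) x e \<in> Z" for e
    proof -
      have x': "x \<in> torsion_by A (J r) F" "d r x = \<zero>\<^bsub>J (Suc r)\<^esub>" using x by (auto simp: Z)
      have "d r (homog_comp (J r) x e) = \<zero>\<^bsub>J (Suc r)\<^esub>"
        using homog_comp_d[OF tors_closed[OF x'(1)], of e] x'(2) J.homog_comp_homog[OF J.part_zero] by simp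
      moreover have "homog_comp (J r) x e \<in> torsion_by A (J r) F"
        using tors[of r] x'(1) unfolding graded_submodule_def by blast
      ultimately show ?thesis using cC[OF x'(1)] by (simp add: Z)
    qed
  qed
  define M where "M = gsub (C r) Z"
  have M [simp]: "carrier M = Z" "zero M = zero (J r)" "add M = add (J r)" "smult M = smult (J r)"
    "mod_part M e = Z \<inter> mod_part (J r) e" for e
    using Z by (auto simp: M_def gsub_def)
  have gM: "graded_module A M" and cM: "x \<in> Z \<Longrightarrow> homog_comp M x = homog_comp (J r) x" for x
    unfolding M_def using graded_module_gsub[OF gC Zs] cC by (auto simp: Z)
  have bdZ: "bd F r \<subseteq> Z" using bd_tors d_bd by (auto simp: Z)
  have B: "graded_submodule A M (bd F r)"
    using bd_submodule[of r] bdZ cM unfolding graded_submodule_def by auto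
  have "coboundaries C d r = bd F r"
    by (simp add: coboundaries_def bd_def split: nat.split)
  hence "cohomology C d r = gquot M (bd F r)"
    by (simp add: cohomology_def M_def Z_def)
  moreover have "graded_quasi_cyclic A (gquot M (bd F r))"
  proof (rule graded_quasi_cyclic_gquot[OF gM B, where z = z and e = e])
    show "z t \<in> mod_part M (e t)" for t using gen by (simp add: generating_chain_def Z)
    show "\<exists>b\<in>carrier A. \<exists>u\<in>bd F r. z t = u \<oplus>\<^bsub>M\<^esub> b \<odot>\<^bsub>M\<^esub> z (Suc t)" for t
      using gen unfolding generating_chain_def M by blast
    show "\<exists>t. \<exists>a\<in>carrier A. \<exists>u\<in>bd F r. x = u \<oplus>\<^bsub>M\<^esub> a \<odot>\<^bsub>M\<^esub> z t" if "x \<in> carrier M" for x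
      using gen that unfolding generating_chain_def M Z by blast
  qed
  ultimately show ?thesis unfolding C_def by simp
qed

theorem corollary4p6:
  fixes n r :: nat
    and A :: "((nat \<Rightarrow>\<^sub>0 nat) \<Rightarrow>\<^sub>0 'k :: field) gring"
    and V :: "((nat \<Rightarrow>\<^sub>0 nat) \<Rightarrow>\<^sub>0 'k) set set"
    and I :: "((nat \<Rightarrow>\<^sub>0 nat) \<Rightarrow>\<^sub>0 'k) set"
    and J :: "nat \<Rightarrow> ((nat \<Rightarrow>\<^sub>0 nat) \<Rightarrow>\<^sub>0 'k, 'm) gmodule"
    and d :: "nat \<Rightarrow> 'm \<Rightarrow> 'm"
    and \<eta> :: "((nat \<Rightarrow>\<^sub>0 nat) \<Rightarrow>\<^sub>0 'k) \<Rightarrow> 'm"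
  assumes "A = coordinate_ring n"
    and "projective_variety A V"
    and "codimension A V = enat r"
    and "I = vanishing_ideal A V"
    and "set_theoretic_complete_intersection A V"
    and "graded_injective_resolution A (self_gmodule A) \<eta> J d"
  shows "graded_quasi_cyclic A (local_cohomology A I J d r)"
proof -
  interpret noetherian_gring A by (rule coordinate_ring_noetherian_gring[OF assms(1)])
  interpret graded_resolution A J d \<eta> by unfold_locales (rule assms(6))
  \<comment> \<open>The number of hypersurfaces is the codimension, so it agrees with the
    cohomological degree \<open>r\<close>, the degree in which \<open>torsion_cohomology\<close>
    yields a chain.\<close>
  obtain fs where fs: "length fs = r" "set fs \<subseteq> homogeneous_elems A"
      "ideal_radical A I = ideal_radical A (Idl\<^bsub>A\<^esub> (set fs))"
    using assms(3,4,5) unfolding set_theoretic_complete_intersection_def by auto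
  interpret torsion_resolution A J d \<eta> "set fs" by unfold_locales (rule fs(2))
  have V: "V \<noteq> {}" "\<And>p. p \<in> V \<Longrightarrow> ideal p A"
    using assms(2) unfolding projective_variety_def proj_closed_def Proj_def primeideal_def by auto
  \<comment> \<open>An intersection of a nonempty family of ideals. Nonemptiness also keeps
    \<open>\<Inter>V\<close> inside the carrier, so that it is the vanishing ideal.\<close>
  have "ideal (\<Inter>V) A" using V by (intro i_Intersect) auto
  moreover have "\<Inter>V \<subseteq> carrier A" using ideal.Icarr[OF calculation] by (rule subsetI)
  ultimately have I: "ideal I A" unfolding assms(4) vanishing_ideal_def by (simp add: Int_absorb1)
  have "torsion_part A I (J j) = gsub (J j) (torsion_by A (J j) (set fs))" for j
    using F_closed by (intro torsion_part_eq[OF J.module_axioms I _ _ fs(3)]) auto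
  moreover obtain z e where "generating_chain (set fs) r z e"
    using torsion_cohomology[OF fs(2)] fs(1) by blast
  ultimately show ?thesis
    unfolding local_cohomology_def using graded_quasi_cyclic_cohomology by simp
qed

end
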